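(* Let $q$ be a fixed prime power, let $t$ be a fixed positive integer, and let $\theta_1,\theta_2$ be fixed real numbers. If $0<\theta_1,\theta_2<\frac{1}{2}$, then $$\lim_{n\to\infty}g(n,t,\sigma_{\theta_1,n},\sigma_{\theta_2,n})=q^{-(2-\theta_1-\theta_2)t},$$ where $\sigma_{\theta,n}:=q^{-(1-\theta)n}$.
   Context: $\mathbb{F}_q$ is the field with $q$ elements and $\Omega_n$ is the set of all subspaces of the $n$-dimensional vector space $\mathbb{F}_q^n$. For a real number $\sigma>0$ and $0\leqslant k\leqslant n$, put $$\phi_{\sigma,n}(k):=\frac{\sigma^{k}q^{\binom{k}{2}}}{(-\sigma;q)_n},\qquad (-\sigma;q)_n:=\prod_{j=0}^{n-1}(1+\sigma q^j).$$ The $\sigma$-biased (probability) measure $\mu_\sigma$ on $\Omega_n$ is defined by $\mu_{\sigma}(U):=\sum_{x\in U}\phi_{\sigma,n}(\dim x)$ for $U\subset\Omega_n$. Two families $U,W\subset\Omega_n$ are called cross $t$-intersecting if $\dim(x\cap y)\geqslant t$ for all $x\in U$ and $y\in W$. Define $$g(n,t,\sigma_1,\sigma_2):=\max\{\left(\mu_{\sigma_1}(U)\mu_{\sigma_2}(W)\right)^{\frac{1}{n}}: U,W\subset\Omega_n \text{ are cross $t$-intersecting}\}.$$ *)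

theory Defs
  imports Complex_Main "HOL-Library.Function_Algebras" "HOL-Library.Cardinality"
begin

text \<open>
  The field with \<open>q\<close> elements is a type \<open>'a :: {field, finite}\<close> with \<open>q = CARD('a)\<close>. The space
  of \<open>n\<close>-tuples over \<open>'a\<close> is realised, for all \<open>n\<close> at once, as the set of sequences \<open>nat \<Rightarrow> 'a\<close>
  that vanish from index \<open>n\<close> on; subspaces and dimensions are the library's, for the pointwise
  \<open>'a\<close>-vector space structure on sequences.
\<close>

definition seq_scale :: "'a::field \<Rightarrow> (nat \<Rightarrow> 'a) \<Rightarrow> (nat \<Rightarrow> 'a)" where
  "seq_scale c x = (\<lambda>i. c * x i)"

global_interpretation seq_space: vector_space "seq_scale :: 'a::field \<Rightarrow> (nat \<Rightarrow> 'a) \<Rightarrow> (nat \<Rightarrow> 'a)"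
  by unfold_locales (auto simp: seq_scale_def fun_eq_iff algebra_simps)

definition coord_space :: "nat \<Rightarrow> (nat \<Rightarrow> 'a::field) set" where
  "coord_space n = {v. \<forall>i\<ge>n. v i = 0}"

definition subspaces :: "nat \<Rightarrow> (nat \<Rightarrow> 'a::field) set set" where
  "subspaces n = {x. seq_space.subspace x \<and> x \<subseteq> coord_space n}"

definition qpoch_neg :: "nat \<Rightarrow> real \<Rightarrow> nat \<Rightarrow> real" where
  "qpoch_neg q \<sigma> n = (\<Prod>j<n. 1 + \<sigma> * real q ^ j)"

definition biased_phi :: "nat \<Rightarrow> real \<Rightarrow> nat \<Rightarrow> nat \<Rightarrow> real" where
  "biased_phi q \<sigma> n k = \<sigma> ^ k * real q ^ (k choose 2) / qpoch_neg q \<sigma> n"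

definition biased_measure :: "real \<Rightarrow> nat \<Rightarrow> (nat \<Rightarrow> 'a::{field,finite}) set set \<Rightarrow> real" where
  "biased_measure \<sigma> n U = (\<Sum>x\<in>U. biased_phi CARD('a) \<sigma> n (seq_space.dim x))"

definition cross_intersecting ::
  "nat \<Rightarrow> (nat \<Rightarrow> 'a::field) set set \<Rightarrow> (nat \<Rightarrow> 'a) set set \<Rightarrow> bool" where
  "cross_intersecting t U W \<longleftrightarrow> (\<forall>x\<in>U. \<forall>y\<in>W. seq_space.dim (x \<inter> y) \<ge> t)"

text \<open>
  The set below is finite and nonempty (lemmas \<open>cross_values_finite\<close>, \<open>cross_values_nonempty\<close>), so the
  maximum is attained. The value at \<open>n = 0\<close>, where \<open>1/n\<close> is \<open>0\<close>, is a dummy.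
\<close>

definition cross_values ::
  "'a::{field,finite} itself \<Rightarrow> nat \<Rightarrow> nat \<Rightarrow> real \<Rightarrow> real \<Rightarrow> real set" where
  "cross_values _ n t \<sigma>1 \<sigma>2 =
     {(biased_measure \<sigma>1 n U * biased_measure \<sigma>2 n W) powr (1 / real n) | U W :: (nat \<Rightarrow> 'a) set set.
        U \<subseteq> subspaces n \<and> W \<subseteq> subspaces n \<and> cross_intersecting t U W}"

definition cross_max ::
  "'a::{field,finite} itself \<Rightarrow> nat \<Rightarrow> nat \<Rightarrow> real \<Rightarrow> real \<Rightarrow> real" where
  "cross_max F n t \<sigma>1 \<sigma>2 = Max (cross_values F n t \<sigma>1 \<sigma>2)"

definition sigma_theta :: "nat \<Rightarrow> real \<Rightarrow> nat \<Rightarrow> real" where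
  "sigma_theta q \<theta> n = real q powr (- (1 - \<theta>) * real n)"

lemma finite_coord_space: "finite (coord_space n :: (nat \<Rightarrow> 'a::{field,finite}) set)"
proof -
  have "finite {f :: nat \<Rightarrow> 'a. \<forall>i. (i \<in> {..<n} \<longrightarrow> f i \<in> UNIV) \<and> (i \<notin> {..<n} \<longrightarrow> f i = 0)}"
    by (rule finite_set_of_finite_funs) auto
  then show ?thesis
    by (rule rev_finite_subset) (auto simp: coord_space_def)
qed

lemma finite_subspaces: "finite (subspaces n :: (nat \<Rightarrow> 'a::{field,finite}) set set)"
  by (rule finite_subset[of _ "Pow (coord_space n)"])
     (auto simp: subspaces_def finite_coord_space)

lemma cross_values_finite: "finite (cross_values (F :: 'a::{field,finite} itself) n t \<sigma>1 \<sigma>2)"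
proof (rule finite_subset)
  show "cross_values F n t \<sigma>1 \<sigma>2 \<subseteq>
    (\<lambda>(U, W). (biased_measure \<sigma>1 n U * biased_measure \<sigma>2 n W) powr (1 / real n)) `
      (Pow (subspaces n :: (nat \<Rightarrow> 'a) set set) \<times> Pow (subspaces n :: (nat \<Rightarrow> 'a) set set))"
    by (auto simp: cross_values_def)
qed (simp add: finite_subspaces)

lemma cross_values_nonempty: "cross_values F n t \<sigma>1 \<sigma>2 \<noteq> {}"
  by (auto simp: cross_values_def cross_intersecting_def intro!: exI[of _ "{}"])

end

theory Submission
  imports Defs "HOL-Library.FuncSet" "HOL-Computational_Algebra.Polynomial" "HOL-Computational_Algebra.Primes"
begin

text \<open>
  Put \<open>\<sigma> = q powr (- (1 - \<theta>) n)\<close>. Up to bounded factors there are \<open>q ^ (k (n - k))\<close> subspaces of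
  dimension \<open>k\<close>, so the layer \<open>k\<close> has measure about \<open>q powr (- d (d + 1) / 2)\<close> where \<open>d = k - \<theta> n\<close>:
  the measure sits near \<open>k = \<theta> n\<close>, with Gaussian tails.

  Lower bound. Take for \<open>U\<close> and \<open>W\<close> the star of all subspaces that contain a fixed
  \<open>t\<close>-dimensional one. The layer \<open>k = \<lfloor>\<theta> n\<rfloor>\<close> has measure bounded below
  (\<open>biased_phi_peak\<close>), and the star has proportion about \<open>q ^ (- t (n - k))\<close> of it, which gives
  \<open>q powr (- (1 - \<theta>) t n)\<close> (\<open>star_measure_lower\<close>).

  Upper bound. The central fact, \<open>layer_bound\<close>, is that if \<open>k + l \<le> n\<close> then the parts \<open>U\<^sub>k\<close>, \<open>W\<^sub>l\<close>
  of a cross \<open>t\<close>-intersecting pair in the layers \<open>k\<close> and \<open>l\<close> occupy proportions of these layers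
  whose product is at most \<open>q ^ (- t (2 n - k - l))\<close> up to a factor \<open>O(n)\<close>. Summed against the
  weights, the factor \<open>q ^ (t (k + l))\<close> costs \<open>q powr (t (\<theta>1 + \<theta>2) n)\<close>, because the exponential
  moments of the dimension are ratios of the products \<open>qpoch_neg\<close>
  (\<open>biased_phi_exponential_moment\<close>). The layers with \<open>k + l > n\<close> are negligible by
  Chernoff's inequality with the same moments. Together this is \<open>cross_measure_upper\<close>, and the
  factors that are polynomial in \<open>n\<close> disappear under the \<open>n\<close>-th root.

  For \<open>layer_bound\<close> let \<open>l \<le> k\<close> and \<open>m = n - k\<close>. Some \<open>m\<close>-dimensional \<open>E\<close> meets a positive
  proportion of all \<open>x \<in> U\<^sub>k\<close> and \<open>y \<in> W\<^sub>l\<close> only in \<open>0\<close> (\<open>transversal_exists\<close>). Relative to a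
  complement of \<open>E\<close>, such an \<open>x\<close> is the graph of a \<open>k \<times> m\<close> matrix \<open>A\<close>, and a basis of such a \<open>y\<close>
  is a pair of matrices \<open>(C, D)\<close> where the rows of \<open>C\<close> are independent; \<open>x \<inter> y\<close> is isomorphic to
  the space of row relations of \<open>R = D - C A\<close>. Thus \<open>R\<close> always has at least \<open>t\<close> independent row
  relations.

  This is contradicted, for large families, by a Hoffman type argument. Let \<open>h(R)\<close> be a weighted
  count of the ways to append \<open>j < t\<close> columns to \<open>R\<close> such that the rows become independent; it
  vanishes on all the \<open>R\<close> above. The Fourier coefficients of \<open>h\<close> depend only on the rank \<open>s\<close> of the
  frequency and are explicit (\<open>indep_char_sum_rank\<close>), and the \<open>t\<close> weights can be chosen such that
  the coefficients of rank \<open>1, \<dots>, t - 1\<close> vanish while those of rank \<open>s \<ge> t\<close> are at most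
  \<open>q ^ (s (s - 1) / 2 - m s)\<close> times the mean, up to a constant (\<open>spectral_weights\<close>). The sum of \<open>h (D - C A)\<close>
  over all \<open>A\<close> in the family is then so close to its mean, in mean square over \<open>(C, D)\<close>, that it can
  vanish only on few pairs. Averaging over \<open>C\<close> gains a further factor \<open>q ^ (- s (k - l))\<close>, since a
  frequency of rank \<open>s\<close> is seen only by those \<open>C\<close> whose row space contains a given
  \<open>s\<close>-dimensional space (\<open>card_preimage_tprod\<close>); the worst rank is \<open>s = t\<close>
  (\<open>card_matrix_pairs_bound\<close>).
\<close>

section \<open>A nontrivial additive character\<close>

text \<open>
  Let \<open>H\<close> be maximal among the additive subgroups that do not contain \<open>1\<close>. By maximality, every
  element is congruent modulo \<open>H\<close> to an integer multiple \<open>i\<close> of \<open>1\<close>, and \<open>i\<close> is unique modulo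
  the characteristic \<open>p\<close>; the character sends it to the \<open>i\<close>-th power of a primitive \<open>p\<close>-th root
  of unity.
\<close>

lemma exists_nontrivial_character:
  "\<exists>\<psi> :: 'a::{field,finite} \<Rightarrow> complex.
     (\<forall>x y. \<psi> (x + y) = \<psi> x * \<psi> y) \<and> (\<forall>x. norm (\<psi> x) = 1) \<and> (\<exists>a. \<psi> a \<noteq> 1)"
proof -
  define p where "p = CHAR('a)"
  have "CHAR('a) > 0" by (rule finite_imp_CHAR_pos) auto
  then have pr: "prime p" unfolding p_def by (rule prime_CHAR_semidom)
  define sg where "sg H \<longleftrightarrow> 0 \<in> H \<and> (\<forall>x\<in>H. \<forall>y\<in>H. x - y \<in> H) \<and> 1 \<notin> H" for H :: "'a set"
  have ex: "sg {0}" by (auto simp: sg_def)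
  define Hs where "Hs = {H. sg H}"
  have "finite Hs" by (rule finite_subset[of _ UNIV]) auto
  moreover have "Hs \<noteq> {}" using ex by (auto simp: Hs_def)
  ultimately obtain H where H: "H \<in> Hs" and Hmax: "\<And>H'. H' \<in> Hs \<Longrightarrow> H \<subseteq> H' \<Longrightarrow> H = H'"
    using finite_has_maximal[of Hs] by blast
  have H0: "0 \<in> H" and Hm: "\<And>x y. x \<in> H \<Longrightarrow> y \<in> H \<Longrightarrow> x - y \<in> H" and H1: "1 \<notin> H"
    using H by (auto simp: Hs_def sg_def)
  have Hneg: "- x \<in> H" if "x \<in> H" for x using Hm[OF H0 that] by simp
  have Hp: "x + y \<in> H" if "x \<in> H" "y \<in> H" for x y using Hm[OF that(1) Hneg[OF that(2)]] by simp
  have Hn: "of_nat n * x \<in> H" if "x \<in> H" for n x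
    by (induction n) (auto simp: algebra_simps H0 intro: Hp that)
  have Hi: "of_int n * x \<in> H" if "x \<in> H" for n x
    by (cases n) (use Hn[OF that] Hneg[OF Hn[OF that]] in \<open>auto simp del: of_nat_Suc\<close>)
  have of_int_p: "of_int (int p * k) = (0::'a)" for k
    by (simp add: p_def)
  have inv: "\<exists>u. of_int u * of_int d = (1::'a)" if "\<not> int p dvd d" for d
  proof -
    have "coprime d (int p)" using pr that
      by (metis coprime_commute prime_imp_coprime prime_nat_int_transfer)
    then obtain u v where "u * d + v * int p = 1"
      using bezout_int[of d "int p"] by auto
    then have "of_int (u * d + v * int p) = (1::'a)" by simp
    then have "of_int u * of_int d + of_int (int p * v) = (1::'a)" by (simp add: mult.commute)
    then show ?thesis by (auto simp: of_int_p simp del: of_int_mult)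
  qed
  have Hint: "int p dvd d" if "of_int d \<in> H" for d
  proof (rule ccontr)
    assume "\<not> int p dvd d"
    then obtain u where "of_int u * of_int d = (1::'a)" using inv by blast
    then show False using Hi[OF that, of u] H1 by simp
  qed
  have rep: "\<exists>i::int. x - of_int i \<in> H" for x
  proof (cases "x \<in> H")
    case True then show ?thesis by (intro exI[of _ 0]) simp
  next
    case False
    define H' where "H' = {h + of_int j * x | h j. h \<in> H}"
    have sub: "H \<subseteq> H'" unfolding H'_def by (force intro: exI[of _ "0::int"])
    have xH': "x \<in> H'" unfolding H'_def using H0 by (auto intro!: exI[of _ 0] exI[of _ "1::int"])
    have "\<not> sg H'" using Hmax[of H'] sub xH' False by (auto simp: Hs_def)
    moreover have "0 \<in> H'" using sub H0 by auto
    moreover have "a - b \<in> H'" if ab: "a \<in> H'" "b \<in> H'" for a b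
    proof -
      obtain h1 j1 h2 j2 where "a = h1 + of_int j1 * x" "b = h2 + of_int j2 * x" "h1 \<in> H" "h2 \<in> H"
        using ab unfolding H'_def by blast
      then have "a - b = (h1 - h2) + of_int (j1 - j2) * x" "h1 - h2 \<in> H"
        by (auto simp: algebra_simps Hm)
      then show ?thesis unfolding H'_def by blast
    qed
    ultimately have "1 \<in> H'" by (auto simp: sg_def)
    then obtain h j where hj: "1 = h + of_int j * x" "h \<in> H" unfolding H'_def by blast
    have "\<not> int p dvd j"
    proof
      assume "int p dvd j"
      then have "of_int j = (0::'a)" using of_int_p by (auto simp: dvd_def simp del: of_int_mult)
      then show False using hj H1 by simp
    qed
    then obtain u where u: "of_int u * of_int j = (1::'a)" using inv by blast
    have "x = (of_int u * of_int j) * x" by (simp add: u)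
    also have "\<dots> = of_int u * (of_int j * x)" by (simp add: mult.assoc)
    also have "of_int j * x = 1 - h" using hj(1) by (metis add_diff_cancel_left')
    finally have "x - of_int u = - (of_int u * h)" by (simp add: algebra_simps)
    then have "x - of_int u \<in> H" using Hneg[OF Hi[OF hj(2), of u]] by simp
    then show ?thesis by blast
  qed
  define r where "r x = (SOME i::int. x - of_int i \<in> H)" for x
  have r: "x - of_int (r x) \<in> H" for x unfolding r_def by (rule someI_ex[OF rep])
  define \<psi> where "\<psi> x = cis (2 * pi * of_int (r x) / of_nat p)" for x
  have p0: "p > 0" using pr by (simp add: prime_gt_0_nat)
  have cis_eq: "cis (2 * pi * of_int a / of_nat p) = cis (2 * pi * of_int b / of_nat p)"
    if dv: "int p dvd a - b" for a b
  proof -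
    obtain k where "a - b = int p * k" using dv by (auto simp: dvd_def)
    then have "a = b + int p * k" by simp
    then have "2 * pi * of_int a / of_nat p = 2 * pi * of_int b / of_nat p + 2 * pi * of_int k"
      using p0 by (simp add: field_simps)
    then show ?thesis by (simp add: cis_mult[symmetric] cis_multiple_2pi)
  qed
  have add: "\<psi> (x + y) = \<psi> x * \<psi> y" for x y
  proof -
    have "(x - of_int (r x)) + (y - of_int (r y)) - (x + y - of_int (r (x + y))) \<in> H"
      by (intro Hm Hp r)
    then have "of_int (r (x + y) - (r x + r y)) \<in> H" by (simp add: algebra_simps)
    then have "int p dvd r (x + y) - (r x + r y)" by (rule Hint)
    then have "\<psi> (x + y) = cis (2 * pi * of_int (r x + r y) / of_nat p)"
      unfolding \<psi>_def by (rule cis_eq)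
    also have "\<dots> = \<psi> x * \<psi> y" unfolding \<psi>_def
      by (simp add: cis_mult algebra_simps add_divide_distrib)
    finally show ?thesis .
  qed
  have "\<psi> 1 \<noteq> 1"
  proof
    assume "\<psi> 1 = 1"
    then obtain n :: int where "2 * pi * of_int (r 1) / of_nat p = of_int n * 2 * pi"
      unfolding \<psi>_def using cos_one_2pi_int by (metis cis.sel(1) one_complex.sel(1))
    then have "of_int (r 1) = (of_int (n * int p) :: real)" using p0 by (simp add: field_simps)
    then have "r 1 = n * int p" by linarith
    then have "of_int (r 1) = (0 :: 'a)" using of_int_p[of n] by (simp add: mult.commute)
    then show False using r[of 1] H1 by simp
  qed
  moreover have "norm (\<psi> x) = 1" for x by (simp add: \<psi>_def)
  ultimately show ?thesis using add by blast
qed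

section \<open>Tuples and linear combinations over a finite field\<close>

type_synonym 'a vec = "nat \<Rightarrow> 'a"

type_synonym 'a matrix = "nat \<Rightarrow> nat \<Rightarrow> 'a"

text \<open>
  Tuples are total functions that vanish outside their index set. In this way they form a
  subgroup for the pointwise addition, so that a sum over all tuples can be translated.
\<close>

definition tuples :: "'i set \<Rightarrow> 'b::zero set \<Rightarrow> ('i \<Rightarrow> 'b) set" where
  "tuples J S = {r. (\<forall>j\<in>J. r j \<in> S) \<and> (\<forall>j. j \<notin> J \<longrightarrow> r j = 0)}"

lemma tuples_empty [simp]: "tuples {} S = {0}"
  by (auto simp: tuples_def fun_eq_iff)

lemma tuples_insert:
  assumes "j \<notin> J"
  shows "bij_betw (\<lambda>(r, x). r(j := x)) (tuples J S \<times> S) (tuples (insert j J) S)"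
  using assms
  by (intro bij_betwI[where g = "\<lambda>r. (r(j := 0), r j)"])
     (auto simp: tuples_def fun_eq_iff)

lemma sum_tuples_insert:
  assumes "j \<notin> J"
  shows "sum g (tuples (insert j J) S) = (\<Sum>r\<in>tuples J S. \<Sum>x\<in>S. g (r(j := x)))"
  using sum.reindex_bij_betw[OF tuples_insert[OF assms], of g S]
  by (simp add: sum.cartesian_product case_prod_unfold)

lemma card_tuples: "finite J \<Longrightarrow> card (tuples J S) = card S ^ card J"
proof (induction J rule: finite_induct)
  case (insert j J)
  then show ?case
    using bij_betw_same_card[OF tuples_insert[OF insert(2), of S]]
    by (simp add: card_cartesian_product mult.commute)
qed simp

lemma finite_tuples: "finite J \<Longrightarrow> finite S \<Longrightarrow> finite (tuples J S)"
proof (induction J rule: finite_induct)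
  case (insert j J)
  then show ?case
    using bij_betw_finite[OF tuples_insert[OF insert(2), of S]] by simp
qed simp

lemma card_field_ge_2: "2 \<le> CARD('a::{field,finite})"
  using card_mono[of UNIV "{0, 1 :: 'a}"] by simp

lemma coord_space_tuples: "coord_space n = tuples {..<n} UNIV"
  by (auto simp: coord_space_def tuples_def not_less)

lemma card_coord_space: "card (coord_space n :: 'a::{field,finite} vec set) = CARD('a) ^ n"
  by (simp add: coord_space_tuples card_tuples)

lemma subspace_coord_space: "seq_space.subspace (coord_space n)"
  by (auto simp: seq_space.subspace_def coord_space_def seq_scale_def)

lemma coord_space_mono: "m \<le> n \<Longrightarrow> coord_space m \<subseteq> coord_space n"
  by (auto simp: coord_space_def)

lemma sum_seq_apply: "(\<Sum>j\<in>J. f j) i = (\<Sum>j\<in>J. (f j :: 'a::field vec) i)"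
  by (induction J rule: infinite_finite_induct) auto

definition lc :: "'i set \<Rightarrow> ('i \<Rightarrow> 'a::field) \<Rightarrow> ('i \<Rightarrow> 'a vec) \<Rightarrow> 'a vec" where
  "lc J c r = (\<Sum>j\<in>J. seq_scale (c j) (r j))"

lemma lc_apply: "lc J c r i = (\<Sum>j\<in>J. c j * r j i)"
  by (simp add: lc_def sum_seq_apply seq_scale_def)

lemma lc_cong: "(\<And>j. j \<in> J \<Longrightarrow> c j = c' j) \<Longrightarrow> (\<And>j. j \<in> J \<Longrightarrow> r j = r' j) \<Longrightarrow> lc J c r = lc J c' r'"
  by (simp add: lc_def)

lemma lc_in_subspace: "seq_space.subspace S \<Longrightarrow> (\<And>j. j \<in> J \<Longrightarrow> r j \<in> S) \<Longrightarrow> lc J c r \<in> S"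
  unfolding lc_def by (intro seq_space.subspace_sum seq_space.subspace_scale)

lemma lc_diff: "lc J c r - lc J d r = lc J (\<lambda>j. c j - d j) r"
  by (auto simp: fun_eq_iff lc_apply algebra_simps sum_subtractf)

lemma lc_add: "lc J c r + lc J d r = lc J (\<lambda>j. c j + d j) r"
  by (auto simp: fun_eq_iff lc_apply algebra_simps sum.distrib)

lemma lc_insert: "finite J \<Longrightarrow> j \<notin> J \<Longrightarrow> lc (insert j J) c r = seq_scale (c j) (r j) + lc J c r"
  by (simp add: lc_def)

lemma lc_mono: "finite J \<Longrightarrow> B \<subseteq> J \<Longrightarrow> lc B c r = lc J (\<lambda>j. if j \<in> B then c j else 0) r"
  unfolding lc_def by (rule sum.mono_neutral_cong_left) (auto simp: seq_scale_def fun_eq_iff)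

text \<open>
  Independence of a family rather than of the set of its members: a repeated vector
  makes the family dependent.
\<close>

definition indep :: "'i set \<Rightarrow> ('i \<Rightarrow> 'a::field vec) \<Rightarrow> bool" where
  "indep J r \<longleftrightarrow> (\<forall>c. lc J c r = 0 \<longrightarrow> (\<forall>j\<in>J. c j = 0))"

lemma indepD: "indep J r \<Longrightarrow> lc J c r = 0 \<Longrightarrow> j \<in> J \<Longrightarrow> c j = 0"
  by (auto simp: indep_def)

lemma indep_unique: "indep J r \<Longrightarrow> lc J c r = lc J d r \<Longrightarrow> j \<in> J \<Longrightarrow> c j = d j"
  using indepD[of J r "\<lambda>j. c j - d j" j] by (simp add: lc_diff[symmetric])

lemma indep_cong: "(\<And>j. j \<in> J \<Longrightarrow> r j = r' j) \<Longrightarrow> indep J r = indep J r'"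
  unfolding indep_def by (metis lc_cong)

lemma indep_empty [simp]: "indep {} r"
  by (simp add: indep_def)

definition lspan :: "'i set \<Rightarrow> ('i \<Rightarrow> 'a::field vec) \<Rightarrow> 'a vec set" where
  "lspan J r = (\<lambda>c. lc J c r) ` tuples J UNIV"

lemma lc_in_lspan: "lc J c r \<in> lspan J r"
proof -
  have "lc J c r = lc J (\<lambda>j. if j \<in> J then c j else 0) r" by (rule lc_cong) auto
  moreover have "(\<lambda>j. if j \<in> J then c j else 0) \<in> tuples J UNIV" by (auto simp: tuples_def)
  ultimately show ?thesis by (auto simp: lspan_def)
qed

lemma lspan_iff: "x \<in> lspan J r \<longleftrightarrow> (\<exists>c. x = lc J c r)"
  using lc_in_lspan by (auto simp: lspan_def)

lemma inj_on_lc: "indep J r \<Longrightarrow> inj_on (\<lambda>c. lc J c r) (tuples J UNIV)"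
proof (rule inj_onI)
  fix c d assume "indep J r" "c \<in> tuples J UNIV" "d \<in> tuples J UNIV" "lc J c r = lc J d r"
  then have "c j = d j" for j
    by (cases "j \<in> J") (auto simp: tuples_def intro: indep_unique)
  then show "c = d" by auto
qed

lemma card_lspan:
  fixes r :: "'i \<Rightarrow> 'a::{field,finite} vec"
  shows "indep J r \<Longrightarrow> finite J \<Longrightarrow> card (lspan J r) = CARD('a) ^ card J"
  unfolding lspan_def by (simp add: card_image inj_on_lc card_tuples)

lemma indep_insert:
  assumes "finite J" "j \<notin> J"
  shows "indep (insert j J) r \<longleftrightarrow> indep J r \<and> r j \<notin> lspan J r"
proof safe
  assume ind: "indep (insert j J) r"
  show "indep J r"
    unfolding indep_def
  proof (intro allI impI ballI)
    fix c i assume c: "lc J c r = 0" and i: "i \<in> J"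
    have "lc (insert j J) (c(j := 0)) r = lc J (c(j := 0)) r"
      using assms by (simp add: lc_insert seq_scale_def zero_fun_def[symmetric])
    also have "\<dots> = lc J c r" using assms by (intro lc_cong) auto
    finally have "(c(j := 0)) i = 0" using indepD[OF ind, of "c(j := 0)" i] c i by simp
    then show "c i = 0" using i assms by (auto split: if_splits)
  qed
  assume "r j \<in> lspan J r"
  then obtain c where c: "r j = lc J c r" by (auto simp: lspan_iff)
  have "lc (insert j J) (c(j := -1)) r = seq_scale (-1) (r j) + lc J (c(j := -1)) r"
    using assms by (simp add: lc_insert)
  also have "lc J (c(j := -1)) r = lc J c r" using assms by (intro lc_cong) auto
  also have "seq_scale (-1) (r j) + lc J c r = 0" by (simp add: c[symmetric] seq_scale_def fun_eq_iff)
  finally have "(c(j := -1)) j = 0" using indepD[OF ind] by blast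
  then show False by simp
next
  assume ind: "indep J r" and nin: "r j \<notin> lspan J r"
  show "indep (insert j J) r"
    unfolding indep_def
  proof (intro allI impI)
    fix c assume "lc (insert j J) c r = 0"
    then have e: "seq_scale (c j) (r j) + lc J c r = 0" using assms by (simp add: lc_insert)
    have "c j = 0"
    proof (rule ccontr)
      assume "c j \<noteq> 0"
      have "r j i = lc J (\<lambda>k. - c k / c j) r i" for i
      proof -
        have "c j * r j i + lc J c r i = 0" using fun_cong[OF e, of i] by (simp add: seq_scale_def)
        then have "r j i = - lc J c r i / c j" using \<open>c j \<noteq> 0\<close> by (simp add: field_simps add_eq_0_iff)
        also have "\<dots> = lc J (\<lambda>k. - c k / c j) r i"
          by (simp add: lc_apply sum_negf sum_divide_distrib)
        finally show ?thesis .
      qed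
      then have "r j = lc J (\<lambda>k. - c k / c j) r" by (simp add: fun_eq_iff)
      then show False using nin by (auto simp: lspan_iff)
    qed
    moreover from this have "lc J c r = 0" using e by (simp add: seq_scale_def zero_fun_def)
    ultimately show "\<forall>k\<in>insert j J. c k = 0" using ind by (auto simp: indep_def)
  qed
qed

lemma lspan_subset: "seq_space.subspace S \<Longrightarrow> (\<And>j. j \<in> J \<Longrightarrow> r j \<in> S) \<Longrightarrow> lspan J r \<subseteq> S"
  by (auto simp: lspan_iff intro!: lc_in_subspace)

lemma lspan_cong: "(\<And>j. j \<in> J \<Longrightarrow> r j = r' j) \<Longrightarrow> lspan J r = lspan J r'"
  unfolding lspan_def by (intro image_cong lc_cong) auto

lemma subspace_lspan: "seq_space.subspace (lspan J r)"
  unfolding seq_space.subspace_def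
proof (intro conjI ballI allI)
  have "0 = lc J (\<lambda>_. 0) r" by (simp add: fun_eq_iff lc_apply)
  then show "0 \<in> lspan J r" using lspan_iff by blast
  show "x + y \<in> lspan J r" if "x \<in> lspan J r" "y \<in> lspan J r" for x y
    using that by (auto simp: lspan_iff lc_add)
  show "seq_scale c x \<in> lspan J r" if "x \<in> lspan J r" for c x
  proof -
    obtain d where "x = lc J d r" using \<open>x \<in> lspan J r\<close> by (auto simp: lspan_iff)
    then have "seq_scale c x = lc J (\<lambda>j. c * d j) r"
      by (auto simp: fun_eq_iff seq_scale_def lc_apply sum_distrib_left mult.assoc)
    then show ?thesis by (auto simp: lspan_iff)
  qed
qed

lemma lspan_subset_coord_space:
  "r \<in> tuples J (coord_space M) \<Longrightarrow> lspan J r \<subseteq> coord_space M"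
  by (intro lspan_subset subspace_coord_space) (auto simp: tuples_def)

lemma indep_fun_upd:
  assumes "finite J" "j \<notin> J"
  shows "indep (insert j J) (r(j := x)) \<longleftrightarrow> indep J r \<and> x \<notin> lspan J r"
proof -
  have "indep J (r(j := x)) = indep J r" "lspan J (r(j := x)) = lspan J r"
    using assms by (auto intro!: indep_cong lspan_cong)
  then show ?thesis using assms by (simp add: indep_insert)
qed

section \<open>Matrices and the trace pairing\<close>

definition dot :: "nat \<Rightarrow> 'a::field vec \<Rightarrow> 'a vec \<Rightarrow> 'a" where
  "dot m x y = (\<Sum>i<m. x i * y i)"

lemma dot_add_left: "dot m (x + y) z = dot m x z + dot m y z"
  by (simp add: dot_def algebra_simps sum.distrib)

lemma dot_add_right: "dot m z (x + y) = dot m z x + dot m z y"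
  by (simp add: dot_def algebra_simps sum.distrib)

lemma dot_diff_right: "dot m z (x - y) = dot m z x - dot m z y"
  by (simp add: dot_def algebra_simps sum_subtractf)

lemma dot_scale_left: "dot m (seq_scale c x) z = c * dot m x z"
  by (simp add: dot_def seq_scale_def sum_distrib_left mult.assoc)

lemma dot_scale_right: "dot m z (seq_scale c x) = c * dot m z x"
  by (simp add: dot_def seq_scale_def sum_distrib_left algebra_simps)

lemma dot_lc_left: "dot m (lc J c r) z = (\<Sum>j\<in>J. c j * dot m (r j) z)"
  by (simp add: dot_def lc_apply sum_distrib_left sum_distrib_right mult.assoc) (rule sum.swap)

lemma dot_lc_right: "dot m z (lc J c r) = (\<Sum>j\<in>J. c j * dot m z (r j))"
  by (simp add: dot_def lc_apply sum_distrib_left sum_distrib_right algebra_simps)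
     (subst sum.swap, simp)

text \<open>
  Matrices are stored by rows and vanish outside their format, so that a matrix with \<open>m\<close>
  columns is also one with \<open>m + j\<close> columns.
\<close>

definition mat :: "nat \<Rightarrow> nat \<Rightarrow> 'a::field matrix set" where
  "mat l m = tuples {..<l} (coord_space m)"

lemma finite_mat: "finite (mat l m :: 'a::{field,finite} matrix set)"
  by (simp add: mat_def finite_tuples finite_coord_space)

lemma card_mat: "card (mat l m :: 'a::{field,finite} matrix set) = CARD('a) ^ (l * m)"
  by (simp add: mat_def card_tuples card_coord_space power_mult[symmetric] mult.commute)

lemma mat_iff: "X \<in> mat l m \<longleftrightarrow> (\<forall>i j. (l \<le> i \<or> m \<le> j) \<longrightarrow> X i j = 0)"
  unfolding mat_def tuples_def coord_space_def by (auto simp: fun_eq_iff) (meson not_less)?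

lemma mat_add: "X \<in> mat l m \<Longrightarrow> Y \<in> mat l m \<Longrightarrow> X + Y \<in> mat l m"
  by (auto simp: mat_iff)

lemma mat_diff: "X \<in> mat l m \<Longrightarrow> Y \<in> mat l m \<Longrightarrow> X - Y \<in> mat l m"
  by (auto simp: mat_iff)

lemma mat_row: "X \<in> mat l m \<Longrightarrow> X i \<in> coord_space m"
  by (auto simp: mat_iff coord_space_def)

text \<open>
  The trace form; it identifies the dual of the space of matrices with the space itself.
\<close>

definition pair :: "nat \<Rightarrow> nat \<Rightarrow> 'a::field matrix \<Rightarrow> 'a matrix \<Rightarrow> 'a" where
  "pair l m X Y = (\<Sum>i<l. dot m (X i) (Y i))"

lemma pair_add_left: "pair l m (X + Y) Z = pair l m X Z + pair l m Y Z"
  by (simp add: pair_def dot_add_left sum.distrib)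

lemma pair_add_right: "pair l m Z (X + Y) = pair l m Z X + pair l m Z Y"
  by (simp add: pair_def dot_add_right sum.distrib)

lemma pair_diff_right: "pair l m Z (X - Y) = pair l m Z X - pair l m Z Y"
  by (simp add: pair_def dot_diff_right sum_subtractf)

lemma pair_commute: "pair l m X Y = pair l m Y X"
  by (simp add: pair_def dot_def mult.commute)

section \<open>Orthogonality of characters\<close>

locale additive_character =
  fixes \<psi> :: "'a::{field,finite} \<Rightarrow> complex"
  assumes psi_add: "\<psi> (x + y) = \<psi> x * \<psi> y"
    and norm_psi: "norm (\<psi> x) = 1"
    and psi_nontrivial: "\<exists>a. \<psi> a \<noteq> 1"
begin

lemma psi_0 [simp]: "\<psi> 0 = 1"
  using psi_add[of 0 0] norm_psi[of 0] by auto

lemma psi_neg: "\<psi> (- x) = cnj (\<psi> x)"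
proof -
  have "\<psi> x * \<psi> (- x) = 1" using psi_add[of x "- x"] by simp
  moreover have "\<psi> x * cnj (\<psi> x) = 1" using norm_psi[of x] by (simp add: complex_norm_square[symmetric])
  moreover have "\<psi> x \<noteq> 0" using norm_psi[of x] by auto
  ultimately show ?thesis by (metis mult_left_cancel)
qed

lemma psi_diff: "\<psi> (x - y) = \<psi> x * cnj (\<psi> y)"
  using psi_add[of x "- y"] by (simp add: psi_neg)

lemma psi_scaled_nontrivial: "b \<noteq> 0 \<Longrightarrow> \<exists>a. \<psi> (a * b) \<noteq> 1"
  using psi_nontrivial by (metis nonzero_divide_eq_eq)

text \<open>
  Translation by \<open>x0\<close> permutes the summands and multiplies each by \<open>\<psi> (B x0)\<close>.
\<close>

lemma sum_psi_eq_0: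
  fixes G :: "'b::ab_group_add set"
  assumes fin: "finite G" and tr: "\<And>x. x \<in> G \<Longrightarrow> x + x0 \<in> G"
    and add: "\<And>x. x \<in> G \<Longrightarrow> B (x + x0) = B x + B x0" and nt: "\<psi> (B x0) \<noteq> 1"
  shows "(\<Sum>x\<in>G. \<psi> (B x)) = 0"
proof -
  have inj: "inj_on (\<lambda>x. x + x0) G" by (auto simp: inj_on_def)
  have im: "(\<lambda>x. x + x0) ` G = G"
    by (rule endo_inj_surj[OF fin _ inj]) (use tr in auto)
  have "(\<Sum>x\<in>G. \<psi> (B x)) = (\<Sum>x\<in>(\<lambda>x. x + x0) ` G. \<psi> (B x))" using im by simp
  also have "\<dots> = (\<Sum>x\<in>G. \<psi> (B (x + x0)))" by (simp add: sum.reindex[OF inj])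
  also have "\<dots> = (\<Sum>x\<in>G. \<psi> (B x) * \<psi> (B x0))" by (intro sum.cong) (auto simp: add psi_add)
  also have "\<dots> = (\<Sum>x\<in>G. \<psi> (B x)) * \<psi> (B x0)" by (simp add: sum_distrib_right)
  finally show ?thesis using nt by (metis mult_cancel_left2)
qed

lemma sum_psi_dot:
  assumes "x \<in> coord_space m" "x \<noteq> 0"
  shows "(\<Sum>y\<in>coord_space m. \<psi> (dot m x y)) = 0"
proof -
  obtain i where i: "x i \<noteq> 0" using assms(2) by (auto simp: fun_eq_iff)
  then have im: "i < m" using assms(1) i unfolding coord_space_def by (metis (mono_tags) mem_Collect_eq not_less)
  obtain a where a: "\<psi> (a * x i) \<noteq> 1" using psi_scaled_nontrivial[OF i] by blast
  define e where "e = (\<lambda>j. if j = i then a else 0)"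
  have "dot m x e = a * x i" using im by (simp add: dot_def e_def if_distrib sum.delta cong: if_cong)
  moreover have "y + e \<in> coord_space m" if "y \<in> coord_space m" for y
    using that im by (auto simp: coord_space_def e_def)
  ultimately show ?thesis using a
    by (intro sum_psi_eq_0[where ?x0.0 = e]) (auto simp: finite_coord_space dot_add_right)
qed

lemma sum_psi_pair:
  assumes D: "D \<in> mat l m"
  shows "(\<Sum>X\<in>mat l m. \<psi> (pair l m X D)) = (if D = 0 then of_nat (CARD('a) ^ (l * m)) else 0)"
proof (cases "D = 0")
  case True
  then show ?thesis by (simp add: pair_def dot_def card_mat)
next
  case False
  then obtain i j where ij: "D i j \<noteq> 0" by (auto simp: fun_eq_iff)
  then have lt: "i < l" "j < m" using D unfolding mat_iff by (metis not_less)+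
  obtain a where a: "\<psi> (a * D i j) \<noteq> 1" using psi_scaled_nontrivial[OF ij] by blast
  define E where "E = (\<lambda>i' j'. if i' = i \<and> j' = j then a else 0)"
  have "dot m (E i') (D i') = (if i' = i then a * D i j else 0)" for i'
    using lt by (auto simp: dot_def E_def if_distrib if_distribR sum.delta cong: if_cong)
  then have "pair l m E D = a * D i j" using lt by (simp add: pair_def)
  moreover have "E \<in> mat l m" using lt by (auto simp: mat_iff E_def)
  ultimately have "(\<Sum>X\<in>mat l m. \<psi> (pair l m X D)) = 0" using a
    by (intro sum_psi_eq_0[where ?x0.0 = E]) (auto simp: finite_mat pair_add_left intro: mat_add)
  then show ?thesis using False by simp
qed

lemma parseval_mat:
  fixes g :: "'a matrix \<Rightarrow> complex"
  shows "(\<Sum>X\<in>mat l m. (norm (\<Sum>D\<in>mat l m. g D * \<psi> (pair l m X D)))\<^sup>2)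
    = CARD('a) ^ (l * m) * (\<Sum>D\<in>mat l m. (norm (g D))\<^sup>2)"
proof -
  let ?M = "mat l m :: 'a matrix set"
  let ?Q = "of_nat (CARD('a) ^ (l * m)) :: complex"
  have "complex_of_real (\<Sum>X\<in>?M. (norm (\<Sum>D\<in>?M. g D * \<psi> (pair l m X D)))\<^sup>2)
      = (\<Sum>X\<in>?M. (\<Sum>D\<in>?M. g D * \<psi> (pair l m X D)) * cnj (\<Sum>D\<in>?M. g D * \<psi> (pair l m X D)))"
    by (simp only: of_real_sum complex_norm_square)
  also have "\<dots> = (\<Sum>X\<in>?M. \<Sum>D\<in>?M. \<Sum>D'\<in>?M. g D * cnj (g D') * \<psi> (pair l m X (D - D')))"
    by (intro sum.cong refl)
       (simp add: sum_product pair_diff_right psi_diff algebra_simps)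
  also have "\<dots> = (\<Sum>D\<in>?M. \<Sum>D'\<in>?M. \<Sum>X\<in>?M. g D * cnj (g D') * \<psi> (pair l m X (D - D')))"
    by (rule trans[OF sum.swap sum.cong[OF refl sum.swap]])
  also have "\<dots> = (\<Sum>D\<in>?M. \<Sum>D'\<in>?M. if D' = D then ?Q * (g D * cnj (g D)) else 0)"
    by (intro sum.cong refl)
       (auto simp: sum_distrib_left[symmetric] sum_psi_pair mat_diff)
  also have "\<dots> = (\<Sum>D\<in>?M. ?Q * (g D * cnj (g D)))"
    by (intro sum.cong refl) (simp add: finite_mat)
  also have "\<dots> = complex_of_real (CARD('a) ^ (l * m) * (\<Sum>D\<in>?M. (norm (g D))\<^sup>2))"
    by (simp add: complex_norm_square[symmetric] sum_distrib_left)
  finally show ?thesis by (simp only: of_real_eq_iff)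
qed

end

section \<open>Character sums over independent tuples\<close>

context additive_character
begin

text \<open>
  The Fourier coefficient at \<open>\<xi>\<close> of the indicator function of the independent tuples.
\<close>

definition indep_char_sum :: "'i set \<Rightarrow> nat \<Rightarrow> ('i \<Rightarrow> 'a vec) \<Rightarrow> complex" where
  "indep_char_sum J M \<xi> = (\<Sum>r\<in>tuples J (coord_space M).
     if indep J r then \<psi> (\<Sum>j\<in>J. dot M (\<xi> j) (r j)) else 0)"

lemma indep_char_sum_insert:
  assumes "finite J" "j \<notin> J"
  shows "indep_char_sum (insert j J) M \<xi> = (\<Sum>r\<in>tuples J (coord_space M). \<Sum>x\<in>coord_space M.
    if indep J r \<and> x \<notin> lspan J r
    then \<psi> ((\<Sum>i\<in>J. dot M (\<xi> i) (r i)) + dot M (\<xi> j) x) else 0)"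
proof -
  have "(\<Sum>i\<in>insert j J. dot M (\<xi> i) ((r(j := x)) i)) = (\<Sum>i\<in>J. dot M (\<xi> i) (r i)) + dot M (\<xi> j) x" for r x
  proof -
    have "(\<Sum>i\<in>J. dot M (\<xi> i) ((r(j := x)) i)) = (\<Sum>i\<in>J. dot M (\<xi> i) (r i))"
      using assms by (intro sum.cong) auto
    then show ?thesis using assms by (simp add: add.commute)
  qed
  then show ?thesis
    unfolding indep_char_sum_def sum_tuples_insert[OF assms(2)] by (simp only: indep_fun_upd[OF assms])
qed

text \<open>
  Adding the multiple \<open>c i\<close> of the last vector \<open>x\<close> to each \<open>r i\<close> keeps the tuple independent and
  absorbs the term of \<open>\<xi> j\<close> in the exponent. After this substitution \<open>x\<close> ranges freely over the
  vectors outside the span of the others.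
\<close>

lemma indep_char_sum_insert_dependent:
  assumes J: "finite J" "j \<notin> J" and dep: "\<xi> j = lc J c \<xi>"
  shows "indep_char_sum (insert j J) M \<xi> = (of_nat CARD('a) ^ M - of_nat CARD('a) ^ card J) * indep_char_sum J M \<xi>"
proof -
  let ?V = "coord_space M :: 'a vec set"
  let ?T = "tuples J ?V"
  let ?S = "\<lambda>r. \<Sum>i\<in>J. dot M (\<xi> i) (r i)"
  define sh where "sh x r = (\<lambda>i. if i \<in> J then r i + seq_scale (c i) x else 0)" for x and r :: "'b \<Rightarrow> 'a vec"
  have bij: "bij_betw (sh x) ?T ?T" if "x \<in> ?V" for x
  proof (rule bij_betwI[where g = "\<lambda>r i. if i \<in> J then r i - seq_scale (c i) x else 0"])
    have sc: "seq_scale a x \<in> ?V" for a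
      using that subspace_coord_space seq_space.subspace_scale by blast
    show "sh x \<in> ?T \<rightarrow> ?T"
      using sc by (auto simp: tuples_def sh_def intro!: seq_space.subspace_add[OF subspace_coord_space])
    show "(\<lambda>r i. if i \<in> J then r i - seq_scale (c i) x else 0) \<in> ?T \<rightarrow> ?T"
      using sc by (auto simp: tuples_def intro!: seq_space.subspace_diff[OF subspace_coord_space])
  qed (auto simp: sh_def tuples_def fun_eq_iff)
  have indep_sh: "indep J (sh x r) \<and> x \<notin> lspan J (sh x r) \<longleftrightarrow> indep J r \<and> x \<notin> lspan J r" for x r
  proof -
    have fwd: "indep (insert j J) r' \<Longrightarrow> indep (insert j J) r"
      if "\<And>i. i \<in> J \<Longrightarrow> r' i = r i + seq_scale (d i) x" "r' j = x" "r j = x" for r r' d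
      unfolding indep_def
    proof (intro allI impI)
      fix e assume ind: "\<forall>c. lc (insert j J) c r' = 0 \<longrightarrow> (\<forall>k\<in>insert j J. c k = 0)"
        and e: "lc (insert j J) e r = 0"
      \<comment> \<open>The relation \<open>e\<close> among the old vectors, rewritten for the new ones.\<close>
      define e' where "e' = e(j := e j - (\<Sum>i\<in>J. e i * d i))"
      have "lc J e' r' i = (\<Sum>k\<in>J. e k * r k i) + (\<Sum>k\<in>J. e k * d k) * x i" for i
      proof -
        have "lc J e' r' i = (\<Sum>k\<in>J. e k * (r k i + d k * x i))"
          using J unfolding lc_apply by (intro sum.cong) (auto simp: e'_def that(1) seq_scale_def)
        then show ?thesis by (simp add: distrib_left sum.distrib sum_distrib_right mult.assoc)
      qed
      then have "lc (insert j J) e' r' i = lc (insert j J) e r i" for i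
        using J that(2,3) by (simp add: lc_insert seq_scale_def e'_def algebra_simps) (simp add: lc_apply)
      then have "lc (insert j J) e' r' = 0" using e by (simp add: fun_eq_iff)
      then have 0: "\<forall>k\<in>insert j J. e' k = 0" using ind by blast
      then have "e k = 0" if "k \<in> J" for k using that J by (auto simp: e'_def split: if_splits)
      moreover from this have "e j = 0" using 0 by (simp add: e'_def)
      ultimately show "\<forall>k\<in>insert j J. e k = 0" by auto
    qed
    have "indep (insert j J) ((sh x r)(j := x)) = indep (insert j J) (r(j := x))"
    proof
      assume "indep (insert j J) ((sh x r)(j := x))"
      then show "indep (insert j J) (r(j := x))"
        using fwd[of "(sh x r)(j := x)" "r(j := x)" c] J by (fastforce simp: sh_def)
    next
      assume "indep (insert j J) (r(j := x))"
      then show "indep (insert j J) ((sh x r)(j := x))"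
        using fwd[of "r(j := x)" "(sh x r)(j := x)" "\<lambda>i. - c i"] J
        by (fastforce simp: sh_def seq_scale_def fun_eq_iff)
    qed
    then show ?thesis by (simp add: indep_fun_upd[OF J])
  qed
  have S_sh: "?S (sh x r) = ?S r + dot M (\<xi> j) x" for x r
  proof -
    have "?S (sh x r) = (\<Sum>i\<in>J. dot M (\<xi> i) (r i) + c i * dot M (\<xi> i) x)"
      by (intro sum.cong) (auto simp: sh_def dot_add_right dot_scale_right)
    then show ?thesis by (simp add: sum.distrib dep dot_lc_left)
  qed
  have "indep_char_sum (insert j J) M \<xi> = (\<Sum>x\<in>?V. \<Sum>r\<in>?T.
    if indep J r \<and> x \<notin> lspan J r then \<psi> (?S r + dot M (\<xi> j) x) else 0)"
    by (simp only: indep_char_sum_insert[OF J]) (rule sum.swap)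
  also have "\<dots> = (\<Sum>x\<in>?V. \<Sum>r\<in>?T.
    if indep J (sh x r) \<and> x \<notin> lspan J (sh x r) then \<psi> (?S (sh x r)) else 0)"
    by (simp only: indep_sh S_sh)
  also have "\<dots> = (\<Sum>x\<in>?V. \<Sum>r\<in>?T. if indep J r \<and> x \<notin> lspan J r then \<psi> (?S r) else 0)"
    by (intro sum.cong refl sum.reindex_bij_betw[OF bij, where g = "\<lambda>r. if indep J r \<and> _ r then \<psi> (?S r) else 0"])
  also have "\<dots> = (\<Sum>r\<in>?T. \<Sum>x\<in>?V. if indep J r \<and> x \<notin> lspan J r then \<psi> (?S r) else 0)"
    by (rule sum.swap)
  also have "\<dots> = (\<Sum>r\<in>?T. (of_nat CARD('a) ^ M - of_nat CARD('a) ^ card J) * (if indep J r then \<psi> (?S r) else 0))"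
  proof (intro sum.cong refl)
    fix r assume r: "r \<in> ?T"
    show "(\<Sum>x\<in>?V. if indep J r \<and> x \<notin> lspan J r then \<psi> (?S r) else 0)
      = (of_nat CARD('a) ^ M - of_nat CARD('a) ^ card J) * (if indep J r then \<psi> (?S r) else 0)"
    proof (cases "indep J r")
      case True
      have "(\<Sum>x\<in>?V. if indep J r \<and> x \<notin> lspan J r then \<psi> (?S r) else 0) = (\<Sum>x\<in>?V - lspan J r. \<psi> (?S r))"
        using True by (intro sum.mono_neutral_cong_right) (auto simp: finite_coord_space)
      also have "\<dots> = of_nat (card (?V - lspan J r)) * \<psi> (?S r)" by simp
      also have "card (?V - lspan J r) = CARD('a) ^ M - CARD('a) ^ card J"
        using lspan_subset_coord_space[OF r] card_lspan[OF True J(1)]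
        by (simp add: card_Diff_subset finite_subset[OF _ finite_coord_space] card_coord_space)
      also have "of_nat (CARD('a) ^ M - CARD('a) ^ card J) = (of_nat CARD('a) ^ M - of_nat CARD('a) ^ card J :: complex)"
        using card_mono[OF finite_coord_space lspan_subset_coord_space[OF r]] card_lspan[OF True J(1)]
        by (simp add: of_nat_diff card_coord_space)
      finally show ?thesis using True by simp
    qed simp
  qed
  finally show ?thesis by (simp add: indep_char_sum_def sum_distrib_left)
qed

text \<open>
  For the last vector, the sum over all of the space is \<open>0\<close>, so the sum over the complement of a
  span is the negative of the sum over the span. Running through the span by coefficients \<open>c\<close>
  replaces \<open>\<xi> i\<close> by \<open>\<xi> i + c i \<cdot> \<xi> j\<close>, which is again an independent family; hence each step
  contributes a factor \<open>- q ^ card J\<close>.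
\<close>

lemma indep_char_sum_indep:
  assumes "finite J" "indep J \<xi>" "\<And>j. j \<in> J \<Longrightarrow> \<xi> j \<in> coord_space M"
  shows "indep_char_sum J M \<xi> = (-1) ^ card J * of_nat CARD('a) ^ (card J choose 2)"
  using assms
proof (induction J arbitrary: \<xi> rule: finite_induct)
  case empty
  then show ?case by (simp add: indep_char_sum_def numeral_2_eq_2)
next
  case (insert j J)
  let ?V = "coord_space M :: 'a vec set"
  let ?T = "tuples J ?V"
  let ?S = "\<lambda>\<xi> r. \<Sum>i\<in>J. dot M (\<xi> i) (r i)"
  let ?\<xi> = "\<lambda>c i. \<xi> i + seq_scale (c i) (\<xi> j)"
  have ind: "indep J \<xi>" "\<xi> j \<notin> lspan J \<xi>" using insert.prems(1) insert.hyps by (auto simp: indep_insert)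
  have nz: "\<xi> j \<noteq> 0" using ind(2) subspace_lspan seq_space.subspace_0 by metis
  have s0: "(\<Sum>x\<in>?V. \<psi> (dot M (\<xi> j) x)) = 0"
    using insert.prems(2) nz by (intro sum_psi_dot) auto
  have ind': "indep J (?\<xi> c)" for c
    unfolding indep_def
  proof (intro allI impI ballI)
    fix e i assume e: "lc J e (?\<xi> c) = 0" and i: "i \<in> J"
    define e' where "e' = e(j := \<Sum>k\<in>J. e k * c k)"
    have "lc J e' \<xi> = lc J e \<xi>" using insert.hyps by (intro lc_cong) (auto simp: e'_def)
    then have "lc (insert j J) e' \<xi> k = lc J e (?\<xi> c) k" for k
      using insert.hyps
      by (simp add: lc_insert seq_scale_def e'_def) (simp add: lc_apply distrib_left sum.distrib sum_distrib_right mult.assoc)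
    then have "lc (insert j J) e' \<xi> = 0" using e by (simp add: fun_eq_iff)
    from indepD[OF insert.prems(1) this, of i] show "e i = 0" using i insert.hyps by (auto simp: e'_def split: if_splits)
  qed
  have V': "?\<xi> c i \<in> ?V" if "i \<in> J" for c i
    using insert.prems(2) that
    by (intro seq_space.subspace_add seq_space.subspace_scale subspace_coord_space) auto
  have "indep_char_sum (insert j J) M \<xi> = (\<Sum>r\<in>?T. \<Sum>x\<in>?V.
    if indep J r \<and> x \<notin> lspan J r then \<psi> (?S \<xi> r + dot M (\<xi> j) x) else 0)"
    by (rule indep_char_sum_insert[OF insert.hyps])
  also have "\<dots> = (\<Sum>r\<in>?T. - (\<Sum>c\<in>tuples J UNIV. if indep J r then \<psi> (?S (?\<xi> c) r) else 0))"
  proof (intro sum.cong refl)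
    fix r assume r: "r \<in> ?T"
    show "(\<Sum>x\<in>?V. if indep J r \<and> x \<notin> lspan J r then \<psi> (?S \<xi> r + dot M (\<xi> j) x) else 0)
      = - (\<Sum>c\<in>tuples J UNIV. if indep J r then \<psi> (?S (?\<xi> c) r) else 0)"
    proof (cases "indep J r")
      case True
      have "(\<Sum>x\<in>?V. if indep J r \<and> x \<notin> lspan J r then \<psi> (?S \<xi> r + dot M (\<xi> j) x) else 0)
        = (\<Sum>x\<in>?V - lspan J r. \<psi> (?S \<xi> r) * \<psi> (dot M (\<xi> j) x))"
        using True by (intro sum.mono_neutral_cong_right) (auto simp: finite_coord_space psi_add)
      also have "\<dots> = (\<Sum>x\<in>?V. \<psi> (?S \<xi> r) * \<psi> (dot M (\<xi> j) x)) - (\<Sum>x\<in>lspan J r. \<psi> (?S \<xi> r) * \<psi> (dot M (\<xi> j) x))"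
        by (rule sum_diff[OF finite_coord_space lspan_subset_coord_space[OF r]])
      also have "(\<Sum>x\<in>?V. \<psi> (?S \<xi> r) * \<psi> (dot M (\<xi> j) x)) = 0"
        by (simp add: sum_distrib_left[symmetric] s0)
      also have "(\<Sum>x\<in>lspan J r. \<psi> (?S \<xi> r) * \<psi> (dot M (\<xi> j) x))
        = (\<Sum>c\<in>tuples J UNIV. \<psi> (?S \<xi> r) * \<psi> (dot M (\<xi> j) (lc J c r)))"
        unfolding lspan_def by (simp add: sum.reindex[OF inj_on_lc[OF True]])
      also have "\<dots> = (\<Sum>c\<in>tuples J UNIV. \<psi> (?S (?\<xi> c) r))"
        by (intro sum.cong refl)
           (simp add: psi_add[symmetric] dot_lc_right dot_add_left dot_scale_left sum.distrib)
      finally show ?thesis using True by simp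
    qed simp
  qed
  also have "\<dots> = - (\<Sum>c\<in>tuples J UNIV. indep_char_sum J M (?\<xi> c))"
    unfolding indep_char_sum_def by (simp add: sum_negf) (rule sum.swap)
  also have "\<dots> = - (\<Sum>c\<in>(tuples J UNIV :: ('b \<Rightarrow> 'a) set). (-1) ^ card J * of_nat CARD('a) ^ (card J choose 2))"
    by (intro arg_cong[where f = uminus] sum.cong refl insert.IH ind' V')
  also have "\<dots> = (-1) ^ card (insert j J) * of_nat CARD('a) ^ (card (insert j J) choose 2)"
    using insert.hyps by (simp add: card_tuples numeral_2_eq_2 power_add)
  finally show ?case .
qed

theorem indep_char_sum_rank:
  assumes "finite J" "B \<subseteq> J" "indep B \<xi>" "\<And>j. j \<in> J \<Longrightarrow> \<xi> j \<in> lspan B \<xi>"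
    "\<And>j. j \<in> B \<Longrightarrow> \<xi> j \<in> coord_space M"
  shows "indep_char_sum J M \<xi> = (-1) ^ card B * of_nat CARD('a) ^ (card B choose 2)
    * (\<Prod>i\<in>{card B..<card J}. of_nat CARD('a) ^ M - of_nat CARD('a) ^ i)"
proof -
  have fB: "finite B" using assms(1,2) finite_subset by blast
  have main: "indep_char_sum (B \<union> D) M \<xi> = (-1) ^ card B * of_nat CARD('a) ^ (card B choose 2)
    * (\<Prod>i\<in>{card B..<card (B \<union> D)}. of_nat CARD('a) ^ M - of_nat CARD('a) ^ i)"
    if "finite D" "D \<inter> B = {}" "D \<subseteq> J" for D
    using that
  proof (induction D rule: finite_induct)
    case empty
    then show ?case using indep_char_sum_indep[OF fB assms(3,5)] by simp
  next
    case (insert j D)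
    have nin: "j \<notin> B \<union> D" using insert by auto
    obtain c where "\<xi> j = lc B c \<xi>" using assms(4)[of j] insert.prems by (auto simp: lspan_iff)
    then have c: "\<xi> j = lc (B \<union> D) (\<lambda>i. if i \<in> B then c i else 0) \<xi>"
      using lc_mono[of "B \<union> D" B c \<xi>] fB insert.hyps by simp
    have fin: "finite (B \<union> D)" using fB insert.hyps by simp
    have "indep_char_sum (B \<union> insert j D) M \<xi> = (of_nat CARD('a) ^ M - of_nat CARD('a) ^ card (B \<union> D)) * indep_char_sum (B \<union> D) M \<xi>"
      using indep_char_sum_insert_dependent[where \<xi> = \<xi>, OF fin nin c] by simp
    also have "indep_char_sum (B \<union> D) M \<xi> = (-1) ^ card B * of_nat CARD('a) ^ (card B choose 2)
      * (\<Prod>i\<in>{card B..<card (B \<union> D)}. of_nat CARD('a) ^ M - of_nat CARD('a) ^ i)"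
      using insert by auto
    also have "card (B \<union> insert j D) = Suc (card (B \<union> D))" using nin fin by simp
    moreover have "card B \<le> card (B \<union> D)" by (rule card_mono[OF fin]) simp
    ultimately show ?case by (simp add: prod.atLeastLessThan_Suc algebra_simps)
  qed
  have "B \<union> (J - B) = J" using assms(2) by auto
  then show ?thesis using main[of "J - B"] assms(1) by auto
qed

end

section \<open>Products of differences of powers\<close>

lemma prod_one_minus_ge_quarter:
  assumes "2 \<le> (q :: real)"
  shows "1 / 4 \<le> (\<Prod>i<M. 1 - q ^ i / q ^ M)"
proof -
  \<comment> \<open>The summand \<open>(1 / 2) ^ (M + 2)\<close> pays for the next factor of the product.\<close>
  have "1 / 4 + (1 / 2) ^ (Suc (Suc M)) \<le> (\<Prod>i<Suc M. 1 - q ^ i / q ^ Suc M)" for M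
  proof (induction M)
    case 0
    then show ?case using assms by (simp add: field_simps)
  next
    case (Suc M)
    define y :: real where "y = (1 / 2) ^ Suc (Suc M)"
    have y: "0 \<le> y" "y \<le> 1 / 4" unfolding y_def by (auto simp: power_le_one)
    have "1 / q ^ Suc (Suc M) \<le> y"
      using power_mono[OF assms, of "Suc (Suc M)"] assms
      by (simp add: y_def power_divide divide_left_mono del: power_Suc)
    moreover have "(\<Prod>i<Suc (Suc M). 1 - q ^ i / q ^ Suc (Suc M))
        = (1 - 1 / q ^ Suc (Suc M)) * (\<Prod>i<Suc M. 1 - q ^ i / q ^ Suc M)"
      using assms by (subst prod.lessThan_Suc_shift) simp
    moreover have "(1 - y) * (1 / 4 + y) \<le> (1 - 1 / q ^ Suc (Suc M)) * (\<Prod>i<Suc M. 1 - q ^ i / q ^ Suc M)"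
      using Suc.IH y \<open>1 / q ^ Suc (Suc M) \<le> y\<close> by (intro mult_mono) (auto simp: y_def)
    moreover have "1 / 4 + y / 2 \<le> (1 - y) * (1 / 4 + y)"
    proof -
      have "y * y \<le> y / 4" using mult_left_mono[OF y(2) y(1)] by simp
      moreover have "(1 - y) * (1 / 4 + y) = 1 / 4 + 3 / 4 * y - y * y" by (simp add: field_simps)
      ultimately show ?thesis by linarith
    qed
    ultimately show ?case by (simp add: y_def)
  qed
  note main = this
  show ?thesis
  proof (cases M)
    case (Suc N)
    have "(0::real) \<le> (1 / 2) ^ Suc (Suc N)" by simp
    then show ?thesis using main[of N] unfolding Suc by linarith
  qed simp
qed

lemma prod_one_minus_interval_ge_quarter:
  assumes "2 \<le> (q :: real)" "s \<le> M"
  shows "1 / 4 \<le> (\<Prod>i\<in>{a..<s}. 1 - q ^ i / q ^ M)"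
proof -
  have le1: "0 \<le> 1 - q ^ i / q ^ M \<and> 1 - q ^ i / q ^ M \<le> 1" if "i < M" for i
    using that assms power_increasing[of i M q] by simp
  have "1 / 4 \<le> (\<Prod>i<M. 1 - q ^ i / q ^ M)" by (rule prod_one_minus_ge_quarter[OF assms(1)])
  also have "\<dots> = (\<Prod>i\<in>{..<M} - {a..<s}. 1 - q ^ i / q ^ M) * (\<Prod>i\<in>{a..<s}. 1 - q ^ i / q ^ M)"
    using assms(2) by (intro prod.subset_diff) auto
  also have "\<dots> \<le> 1 * (\<Prod>i\<in>{a..<s}. 1 - q ^ i / q ^ M)"
    using assms(2) by (intro mult_right_mono prod_le_1 prod_nonneg) (use le1 in auto)
  finally show ?thesis by simp
qed

lemma prod_diff_powers_ge:
  assumes "2 \<le> (q :: real)" "s \<le> M"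
  shows "(q ^ M) ^ (s - a) / 4 \<le> (\<Prod>i\<in>{a..<s}. q ^ M - q ^ i)"
proof -
  have "(q ^ M) ^ (s - a) / 4 \<le> (q ^ M) ^ (s - a) * (\<Prod>i\<in>{a..<s}. 1 - q ^ i / q ^ M)"
    using assms(1) prod_one_minus_interval_ge_quarter[OF assms, of a] by simp
  also have "\<dots> = (\<Prod>i\<in>{a..<s}. q ^ M * (1 - q ^ i / q ^ M))"
    by (simp add: prod.distrib)
  also have "\<dots> = (\<Prod>i\<in>{a..<s}. q ^ M - q ^ i)"
    using assms(1) by (intro prod.cong) (auto simp: field_simps)
  finally show ?thesis .
qed

section \<open>Weights at geometric nodes that extract a leading coefficient\<close>

lemma poly_sum_le:
  fixes p :: "real poly"
  assumes "degree p \<le> N"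
  shows "poly p x = (\<Sum>i\<le>N. coeff p i * x ^ i)"
  unfolding poly_altdef using assms
  by (intro sum.mono_neutral_left) (auto simp: coeff_eq_0)

text \<open>
  Take for \<open>\<beta>\<close> the coefficients of \<open>R = (\<Prod>i<N. S - q ^ i)\<close>. The functional sends the monomial of
  degree \<open>i\<close> to \<open>X ^ i\<close> times the value of \<open>R\<close> at \<open>q ^ i\<close>, which vanishes for \<open>i < N\<close>. The
  point is that \<open>\<beta>\<close> and \<open>Q\<close> do not depend on the scale \<open>X\<close>.
\<close>

lemma leading_coeff_functional:
  fixes q :: real
  assumes q: "1 < q"
  shows "\<exists>\<beta> :: nat \<Rightarrow> real. \<exists>Q>0. \<forall>P X. degree P \<le> N \<longrightarrow>
    (\<Sum>j\<le>N. \<beta> j * poly P (X * q ^ j)) = Q * coeff P N * X ^ N"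
proof -
  define R where "R = (\<Prod>i<N. [:- (q ^ i), 1:])"
  have degR: "degree R \<le> N"
  proof -
    have "degree R \<le> (\<Sum>i<N. degree [:- (q ^ i), 1:])" unfolding R_def
      by (rule degree_prod_sum_le[unfolded o_def]) simp
    then show ?thesis by simp
  qed
  have polyR: "poly R x = (\<Prod>i<N. x - q ^ i)" for x by (simp add: R_def poly_prod)
  have "poly R (q ^ N) > 0"
    unfolding polyR using q by (intro prod_pos) (auto simp: power_strict_increasing)
  moreover have "(\<Sum>j\<le>N. coeff R j * poly P (X * q ^ j)) = poly R (q ^ N) * coeff P N * X ^ N"
    if "degree P \<le> N" for P X
  proof -
    have "(\<Sum>j\<le>N. coeff R j * poly P (X * q ^ j))
        = (\<Sum>j\<le>N. \<Sum>i\<le>N. coeff P i * X ^ i * (coeff R j * (q ^ i) ^ j))"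
      by (simp add: poly_sum_le[OF that] sum_distrib_left power_mult_distrib mult_ac power_mult[symmetric])
    also have "\<dots> = (\<Sum>i\<le>N. coeff P i * X ^ i * poly R (q ^ i))"
      by (subst sum.swap) (simp add: sum_distrib_left poly_sum_le[OF degR])
    also have "\<dots> = (\<Sum>i\<in>{N}. coeff P i * X ^ i * poly R (q ^ i))"
    proof (rule sum.mono_neutral_right)
      show "\<forall>i\<in>{..N} - {N}. coeff P i * X ^ i * poly R (q ^ i) = 0"
        by (auto simp: polyR)
    qed auto
    finally show ?thesis by simp
  qed
  ultimately show ?thesis by blast
qed

section \<open>Rank\<close>

lemma lspan_mono: "finite J \<Longrightarrow> B \<subseteq> J \<Longrightarrow> lspan B r \<subseteq> lspan J r"
  unfolding lspan_iff subset_iff using lc_mono by blast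

lemma in_lspan: "finite J \<Longrightarrow> j \<in> J \<Longrightarrow> r j \<in> lspan J r"
proof -
  assume a: "finite J" "j \<in> J"
  have "lc J (\<lambda>i. if i = j then 1 else 0) r = (\<Sum>i\<in>J. if i = j then r i else 0)"
    unfolding lc_def by (intro sum.cong) (auto simp: seq_scale_def fun_eq_iff)
  also have "\<dots> = r j" using a by simp
  finally show ?thesis using lc_in_lspan by metis
qed

definition basis_of :: "'i set \<Rightarrow> ('i \<Rightarrow> 'a::field vec) \<Rightarrow> 'i set \<Rightarrow> bool" where
  "basis_of J r B \<longleftrightarrow> B \<subseteq> J \<and> indep B r \<and> (\<forall>j\<in>J. r j \<in> lspan B r)"

lemma basis_of_exists: "finite J \<Longrightarrow> \<exists>B. basis_of J r B"
proof (induction J rule: finite_induct)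
  case empty
  show ?case by (auto simp: basis_of_def)
next
  case (insert j J)
  then obtain B where B: "basis_of J r B" by blast
  have fB: "finite B" and jB: "j \<notin> B" using B insert.hyps finite_subset by (auto simp: basis_of_def)
  show ?case
  proof (cases "r j \<in> lspan B r")
    case True
    then have "basis_of (insert j J) r B" using B by (auto simp: basis_of_def)
    then show ?thesis by blast
  next
    case False
    have "basis_of (insert j J) r (insert j B)"
      unfolding basis_of_def
      using B False indep_insert[OF fB jB] in_lspan[of "insert j B" j r] lspan_mono[of "insert j B" B r] fB
      by (auto simp: basis_of_def)
    then show ?thesis by blast
  qed
qed

lemma basis_of_lspan: "finite J \<Longrightarrow> basis_of J r B \<Longrightarrow> lspan J r = lspan B r"
  by (intro equalityI lspan_subset subspace_lspan lspan_mono) (auto simp: basis_of_def)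

definition rank :: "'i set \<Rightarrow> ('i \<Rightarrow> 'a::field vec) \<Rightarrow> nat" where
  "rank J r = card (SOME B. basis_of J r B)"

lemma obtain_basis:
  assumes "finite J"
  obtains B where "basis_of J r B" "card B = rank J r"
  unfolding rank_def using someI_ex[OF basis_of_exists[OF assms]] by blast

lemma card_lspan_rank:
  fixes r :: "'i \<Rightarrow> 'a::{field,finite} vec"
  assumes "finite J"
  shows "card (lspan J r) = CARD('a) ^ rank J r"
proof -
  obtain B where B: "basis_of J r B" "card B = rank J r" using obtain_basis[OF assms] .
  then show ?thesis
    using basis_of_lspan[OF assms B(1)] card_lspan[of B r] finite_subset[of B J] assms
    by (auto simp: basis_of_def)
qed

lemma rank_le: "finite J \<Longrightarrow> rank J r \<le> card J"
  by (metis basis_of_def card_mono obtain_basis)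

lemma rank_eq_0D: "finite J \<Longrightarrow> rank J r = 0 \<Longrightarrow> j \<in> J \<Longrightarrow> r j = 0"
proof -
  assume a: "finite J" "rank J r = 0" "j \<in> J"
  obtain B where B: "basis_of J r B" "card B = rank J r" using obtain_basis[OF a(1)] .
  then have "B = {}" using a finite_subset[of B J] by (auto simp: basis_of_def)
  then show ?thesis using B a by (auto simp: basis_of_def lspan_iff lc_def)
qed

section \<open>Matrix products\<close>

definition mprod :: "nat \<Rightarrow> 'a::field matrix \<Rightarrow> 'a matrix \<Rightarrow> 'a matrix" where
  "mprod k C A = (\<lambda>j. lc {..<k} (C j) A)"

definition tprod :: "nat \<Rightarrow> 'a::field matrix \<Rightarrow> 'a matrix \<Rightarrow> 'a matrix" where
  "tprod l C X = (\<lambda>i. lc {..<l} (\<lambda>j. C j i) X)"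

lemma mprod_mat: "C \<in> mat l k \<Longrightarrow> A \<in> mat k m \<Longrightarrow> mprod k C A \<in> mat l m"
  by (auto simp: mat_iff mprod_def lc_apply)

lemma tprod_mat: "C \<in> mat l k \<Longrightarrow> X \<in> mat l m \<Longrightarrow> tprod l C X \<in> mat k m"
  by (auto simp: mat_iff tprod_def lc_apply)

lemma pair_mprod: "pair l m X (mprod k C A) = pair k m (tprod l C X) A"
  unfolding pair_def mprod_def tprod_def dot_lc_left dot_lc_right by (rule sum.swap)

definition trunc :: "nat \<Rightarrow> 'a::zero matrix \<Rightarrow> 'a matrix" where
  "trunc m r = (\<lambda>i j. if j < m then r i j else 0)"

text \<open>
  A solution \<open>C\<close> is determined by its rows whose indices lie outside a basis of the rows of
  \<open>X\<close>: two solutions that agree there differ by coefficients of a relation among basis rows.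
\<close>

lemma card_extension_fibre:
  fixes M :: "'a::{field,finite} matrix"
  shows "card {C \<in> mat l k. tprod l C X = M} \<le> CARD('a) ^ (k * (l - rank {..<l} X))"
proof -
  obtain B where B: "basis_of {..<l} X B" "card B = rank {..<l} X"
    using obtain_basis[of "{..<l}" X] by auto
  have sub: "B \<subseteq> {..<l}" and ind: "indep B X" using B(1) by (auto simp: basis_of_def)
  have fB: "finite B" using sub finite_subset by blast
  define J where "J = {..<l} - B"
  let ?f = "\<lambda>C :: 'a matrix. (\<lambda>j. if j \<in> J then C j else 0)"
  have inj: "inj_on ?f {C \<in> mat l k. tprod l C X = M}"
  proof (rule inj_onI)
    fix C C' assume C: "C \<in> {C \<in> mat l k. tprod l C X = M}" and C': "C' \<in> {C \<in> mat l k. tprod l C X = M}"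
      and eq: "?f C = ?f C'"
    have eqJ: "C j = C' j" if "j \<in> J" for j using fun_cong[OF eq, of j] that by simp
    have "C j i = C' j i" if "j \<in> B" for j i
    proof -
      have "lc {..<l} (\<lambda>j. C j i) X = lc {..<l} (\<lambda>j. C' j i) X"
        using C C' by (auto simp: tprod_def fun_eq_iff)
      then have "0 = lc {..<l} (\<lambda>j. C j i - C' j i) X" by (simp add: lc_diff[symmetric])
      also have "\<dots> = lc {..<l} (\<lambda>j. if j \<in> B then C j i - C' j i else 0) X"
        by (intro lc_cong) (auto simp: eqJ J_def)
      also have "\<dots> = lc B (\<lambda>j. C j i - C' j i) X"
        using lc_mono[OF finite_lessThan sub, of "\<lambda>j. C j i - C' j i" X] by simp
      finally have "lc B (\<lambda>j. C j i - C' j i) X = 0" by simp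
      from indepD[OF ind this that] show ?thesis by simp
    qed
    moreover have "C j i = C' j i" if "j \<notin> {..<l}" for j i
      using C C' that by (auto simp: mat_iff)
    ultimately show "C = C'" using eqJ
      by (intro ext) (metis DiffI J_def)
  qed
  have "card {C \<in> mat l k. tprod l C X = M} \<le> card (tuples J (coord_space k :: 'a vec set))"
  proof (rule card_inj_on_le[OF inj])
    show "finite (tuples J (coord_space k :: 'a vec set))"
      by (intro finite_tuples finite_coord_space) (simp add: J_def)
  qed (auto simp: tuples_def mat_row)
  also have "\<dots> = (CARD('a) ^ k) ^ card J" by (simp add: card_tuples card_coord_space J_def)
  also have "card J = l - rank {..<l} X" unfolding J_def using sub fB B(2) by (simp add: card_Diff_subset)
  finally show ?thesis by (simp add: power_mult)
qed

context additive_character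
begin

text \<open>
  If no \<open>g\<close> existed, then for every \<open>g\<close> the sum over \<open>e\<close> of the characters
  \<open>\<psi> (\<Sum>i<l. e i * (dot k (C i) g - b i))\<close> would be \<open>0\<close>. In the other order of summation only
  \<open>e = 0\<close> contributes, because the rows are independent, and it contributes \<open>q ^ k\<close>.
\<close>

lemma dual_vectors:
  fixes b :: "'a vec"
  assumes C: "C \<in> mat l k" and ind: "indep {..<l} C"
  shows "\<exists>g. \<forall>i<l. dot k (C i) g = b i"
proof (rule ccontr)
  assume none: "\<not> ?thesis"
  define x where "x g = (\<lambda>i. if i < l then dot k (C i) g - b i else 0)" for g
  let ?Vl = "coord_space l :: 'a vec set" and ?Vk = "coord_space k :: 'a vec set"
  have "(\<Sum>e\<in>?Vl. \<psi> (dot l (x g) e)) = 0" for g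
  proof (rule sum_psi_dot)
    show "x g \<in> coord_space l" by (auto simp: x_def coord_space_def)
    show "x g \<noteq> 0"
    proof
      assume "x g = 0"
      then have "dot k (C i) g = b i" if "i < l" for i
        using that by (auto simp: x_def fun_eq_iff split: if_splits)
      then show False using none by blast
    qed
  qed
  then have "0 = (\<Sum>g\<in>?Vk. \<Sum>e\<in>?Vl. \<psi> (dot l (x g) e))" by simp
  also have "\<dots> = (\<Sum>e\<in>?Vl. \<Sum>g\<in>?Vk. \<psi> (dot k (lc {..<l} e C) g) * cnj (\<psi> (\<Sum>i<l. e i * b i)))"
  proof (subst sum.swap, intro sum.cong refl)
    fix e g :: "'a vec"
    have "dot l (x g) e = (\<Sum>i<l. e i * dot k (C i) g - e i * b i)"
      by (simp add: dot_def[of l] x_def algebra_simps)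
    also have "\<dots> = dot k (lc {..<l} e C) g - (\<Sum>i<l. e i * b i)"
      by (simp add: sum_subtractf dot_lc_left)
    finally show "\<psi> (dot l (x g) e) = \<psi> (dot k (lc {..<l} e C) g) * cnj (\<psi> (\<Sum>i<l. e i * b i))"
      by (simp add: psi_diff)
  qed
  also have "\<dots> = (\<Sum>e\<in>?Vl. if e = 0 then of_nat (CARD('a) ^ k) else 0)"
  proof (intro sum.cong refl)
    fix e :: "'a vec" assume e: "e \<in> ?Vl"
    have "(\<Sum>g\<in>?Vk. \<psi> (dot k (lc {..<l} e C) g)) = 0" if "e \<noteq> 0"
    proof (rule sum_psi_dot)
      show "lc {..<l} e C \<in> coord_space k"
        by (intro lc_in_subspace subspace_coord_space mat_row[OF C])
      show "lc {..<l} e C \<noteq> 0"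
        using indepD[OF ind, of e] e that by (auto simp: coord_space_def fun_eq_iff not_less[symmetric])
    qed
    then show "(\<Sum>g\<in>?Vk. \<psi> (dot k (lc {..<l} e C) g) * cnj (\<psi> (\<Sum>i<l. e i * b i)))
        = (if e = 0 then of_nat (CARD('a) ^ k) else 0)"
      by (auto simp: sum_distrib_right[symmetric] lc_def seq_scale_def dot_def card_coord_space zero_fun_def[symmetric])
  qed
  also have "\<dots> = of_nat (CARD('a) ^ k)"
    using seq_space.subspace_0[OF subspace_coord_space] by (simp add: finite_coord_space)
  finally show False by simp
qed

lemma rows_in_lspan_tprod:
  fixes C :: "'a matrix"
  assumes C: "C \<in> mat l k" and ind: "indep {..<l} C" and j: "j < l"
  shows "X j \<in> lspan {..<k} (tprod l C X)"
proof -
  obtain g where g: "\<And>i. i < l \<Longrightarrow> dot k (C i) g = (if i = j then 1 else 0)"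
    using dual_vectors[OF C ind, of "\<lambda>i. if i = j then 1 else 0"] by auto
  have "lc {..<k} g (tprod l C X) p = X j p" for p
  proof -
    have "lc {..<k} g (tprod l C X) p = (\<Sum>i<k. \<Sum>n<l. g i * (C n i * X n p))"
      by (simp add: lc_apply tprod_def sum_distrib_left)
    also have "\<dots> = (\<Sum>n<l. dot k (C n) g * X n p)"
      by (subst sum.swap) (simp add: dot_def sum_distrib_right sum_distrib_left mult_ac)
    also have "\<dots> = (\<Sum>n<l. if n = j then X n p else 0)" by (intro sum.cong) (auto simp: g)
    also have "\<dots> = X j p" using j by simp
    finally show ?thesis .
  qed
  then have "X j = lc {..<k} g (tprod l C X)" by (simp add: fun_eq_iff)
  then show ?thesis by (auto simp: lspan_iff)
qed

text \<open>
  If there is any such pair, then \<open>M\<close> and \<open>X\<close> have the same row space, with \<open>q ^ s\<close> elements; this leaves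
  \<open>q ^ (s * l)\<close> possibilities for \<open>X\<close>. For each of them, \<open>card_extension_fibre\<close> bounds the number
  of \<open>C\<close>.
\<close>

lemma card_preimage_tprod:
  fixes M :: "'a matrix"
  shows
  "card {(C, X). C \<in> mat l k \<and> indep {..<l} C \<and> X \<in> mat l m \<and> rank {..<l} X = s \<and> tprod l C X = M}
    \<le> CARD('a) ^ (s * l + k * (l - s))" (is "card ?P \<le> _")
proof (cases "?P = {}")
  case False
  then obtain C0 X0 where 0: "rank {..<l} X0 = s" "tprod l C0 X0 = M" by auto
  have "lspan {..<k} M \<subseteq> lspan {..<l} X0"
    using 0(2) by (intro lspan_subset subspace_lspan) (auto simp: tprod_def lc_in_lspan)
  moreover have "finite (lspan {..<l} X0)" unfolding lspan_def by (intro finite_imageI finite_tuples) auto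
  ultimately have cs: "card (lspan {..<k} M) \<le> CARD('a) ^ s"
    using card_mono card_lspan_rank[of "{..<l}" X0] 0(1) by (metis finite_lessThan)
  have finM: "finite (lspan {..<k} M)" unfolding lspan_def by (intro finite_imageI finite_tuples) auto
  let ?X = "tuples {..<l} (lspan {..<k} M) \<inter> {X. rank {..<l} X = s}"
  let ?F = "\<lambda>X. {C \<in> mat l k. tprod l C X = M}"
  have sub: "?P \<subseteq> (\<lambda>(X, C). (C, X)) ` (SIGMA X:?X. ?F X)"
  proof
    fix z assume "z \<in> ?P"
    then obtain C X where a: "C \<in> mat l k" "indep {..<l} C" "X \<in> mat l m" "rank {..<l} X = s"
      "tprod l C X = M" "z = (C, X)" by auto
    have "X \<in> ?X"
      using a rows_in_lspan_tprod[OF a(1,2), of _ X] by (auto simp: tuples_def mat_def)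
    then have "(X, C) \<in> (SIGMA X:?X. ?F X)" using a by auto
    then have "(\<lambda>(X, C). (C, X)) (X, C) \<in> (\<lambda>(X, C). (C, X)) ` (SIGMA X:?X. ?F X)" by (rule imageI)
    then show "z \<in> (\<lambda>(X, C). (C, X)) ` (SIGMA X:?X. ?F X)" using a(6) by simp
  qed
  have finX: "finite ?X" using finM by (auto intro: finite_tuples)
  have finS: "finite (SIGMA X:?X. ?F X)" using finX by (intro finite_SigmaI) (auto simp: finite_mat)
  have "card ?P \<le> card (SIGMA X:?X. ?F X)"
    using card_mono[OF finite_imageI[OF finS] sub] card_image_le[OF finS, of "\<lambda>(X, C). (C, X)"] by linarith
  also have "\<dots> = (\<Sum>X\<in>?X. card (?F X))" using finX by (intro card_SigmaI) (auto simp: finite_mat)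
  also have "\<dots> \<le> (\<Sum>X\<in>?X. CARD('a) ^ (k * (l - s)))"
    by (intro sum_mono) (use card_extension_fibre in auto)
  also have "\<dots> = card ?X * CARD('a) ^ (k * (l - s))" by simp
  also have "card ?X \<le> card (tuples {..<l} (lspan {..<k} M))"
    by (intro card_mono) (auto intro: finite_tuples finM)
  also have "\<dots> = card (lspan {..<k} M) ^ l" by (simp add: card_tuples)
  also have "\<dots> \<le> (CARD('a) ^ s) ^ l" by (intro power_mono cs) simp
  finally show ?thesis by (simp add: power_mult power_add)
next
  case True
  then show ?thesis by (metis card.empty le0)
qed

end

section \<open>A weight on matrices with a spectral gap\<close>

text \<open>
  By \<open>indep_char_sum_rank\<close>, this is the Fourier coefficient of \<open>extension_weight\<close> (defined below) at a
  matrix of rank \<open>s\<close>.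
\<close>

definition spectrum :: "real \<Rightarrow> nat \<Rightarrow> nat \<Rightarrow> nat \<Rightarrow> (nat \<Rightarrow> real) \<Rightarrow> nat \<Rightarrow> real" where
  "spectrum q t l m w s = (-1) ^ s * q ^ (s choose 2) *
     (\<Sum>j<t. w j * (\<Prod>i\<in>{s..<l}. q ^ (m + j) - q ^ i))"

text \<open>
  Divide the weights by \<open>\<Prod>i\<in>{t - 1..<l}. q ^ (m + j) - q ^ i\<close>. For \<open>s < t\<close> the sum then runs over
  the values at the nodes \<open>q ^ m * q ^ j\<close> of a monic polynomial of degree \<open>t - 1 - s\<close>, and the
  functional of \<open>leading_coeff_functional\<close> is \<open>0\<close> on it except for \<open>s = 0\<close>. For \<open>s \<ge> t\<close> the
  quotients are at most of order \<open>(q ^ m) ^ (t - 1 - s)\<close>, and the value at \<open>0\<close> is of order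
  \<open>(q ^ m) ^ (t - 1)\<close>.
\<close>

lemma spectral_weights:
  fixes q :: real
  assumes q: "2 \<le> q" and t: "1 \<le> t"
  shows "\<exists>K>0. \<forall>l m. t \<le> l \<longrightarrow> l \<le> m \<longrightarrow> (\<exists>w. 0 < spectrum q t l m w 0 \<and>
    (\<forall>s. 1 \<le> s \<longrightarrow> s < t \<longrightarrow> spectrum q t l m w s = 0) \<and>
    (\<forall>s. t \<le> s \<longrightarrow> s \<le> l \<longrightarrow>
      \<bar>spectrum q t l m w s\<bar> \<le> K * q ^ (s choose 2) / (q ^ m) ^ s * spectrum q t l m w 0))"
proof -
  define N where "N = t - 1"
  have tN: "t = Suc N" using t by (simp add: N_def)
  obtain \<beta> Q where Q: "Q > 0" and
    \<beta>: "\<And>P X. degree P \<le> N \<Longrightarrow> (\<Sum>j\<le>N. \<beta> j * poly P (X * q ^ j)) = Q * coeff P N * X ^ N"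
    using leading_coeff_functional[of q N] q by auto
  define B where "B = 1 + (\<Sum>j\<le>N. \<bar>\<beta> j\<bar>)"
  have B: "B > 0" unfolding B_def by (intro add_pos_nonneg sum_nonneg) auto
  define K where "K = 4 * B / Q"
  have "\<exists>w. 0 < spectrum q t l m w 0 \<and>
    (\<forall>s. 1 \<le> s \<longrightarrow> s < t \<longrightarrow> spectrum q t l m w s = 0) \<and>
    (\<forall>s. t \<le> s \<longrightarrow> s \<le> l \<longrightarrow>
      \<bar>spectrum q t l m w s\<bar> \<le> K * q ^ (s choose 2) / (q ^ m) ^ s * spectrum q t l m w 0)"
    if l: "t \<le> l" "l \<le> m" for l m
  proof -
    define w where "w j = \<beta> j / (\<Prod>i\<in>{N..<l}. q ^ (m + j) - q ^ i)" for j
    have pos: "0 < q ^ (m + j) - q ^ i" if "i < l" for i j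
      using that l q by (simp add: power_strict_increasing)
    have pos_prod: "0 < (\<Prod>i\<in>{a..<b}. q ^ (m + j) - q ^ i)" if "b \<le> l" for a b j
      using that by (intro prod_pos ballI pos) auto
    have cancel1: "b / Y * (Z * Y) = b * Z" and cancel2: "b / (Z * Y) * Y = b / Z" if "0 < Y" for b Y Z :: real
      using that by auto
    have low: "(\<Sum>j<t. w j * (\<Prod>i\<in>{s..<l}. q ^ (m + j) - q ^ i))
      = Q * (if s = 0 then 1 else 0) * (q ^ m) ^ N" if s: "s \<le> N" for s
    proof -
      define P where "P = (\<Prod>i\<in>{s..<N}. [:- (q ^ i), 1:])"
      have "degree P = (\<Sum>i\<in>{s..<N}. degree [:- (q ^ i), 1:])"
        unfolding P_def by (rule degree_prod_eq_sum_degree) auto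
      then have deg: "degree P = N - s" by simp
      have "lead_coeff P = (\<Prod>i\<in>{s..<N}. lead_coeff [:- (q ^ i), 1:])"
        unfolding P_def by (rule lead_coeff_prod)
      then have lead: "coeff P (N - s) = 1" using deg by simp
      have "coeff P N = (if s = 0 then 1 else 0)"
        using lead deg s by (auto intro!: coeff_eq_0)
      moreover have "w j * (\<Prod>i\<in>{s..<l}. q ^ (m + j) - q ^ i) = \<beta> j * poly P (q ^ m * q ^ j)" for j
      proof -
        have "(\<Prod>i\<in>{s..<l}. q ^ (m + j) - q ^ i)
            = (\<Prod>i\<in>{s..<N}. q ^ (m + j) - q ^ i) * (\<Prod>i\<in>{N..<l}. q ^ (m + j) - q ^ i)"
          using s l tN by (intro prod.atLeastLessThan_concat[symmetric]) auto
        then have "w j * (\<Prod>i\<in>{s..<l}. q ^ (m + j) - q ^ i) = \<beta> j * (\<Prod>i\<in>{s..<N}. q ^ (m + j) - q ^ i)"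
          by (simp only: w_def cancel1[OF pos_prod[of l j N, OF order_refl]])
        then show ?thesis by (simp add: P_def poly_prod power_add)
      qed
      ultimately show ?thesis
        using \<beta>[of P "q ^ m"] deg by (simp add: tN lessThan_Suc_atMost)
    qed
    have s0: "spectrum q t l m w 0 = Q * (q ^ m) ^ N"
      using low[of 0] by (simp add: spectrum_def numeral_2_eq_2)
    have "\<bar>spectrum q t l m w s\<bar> \<le> K * q ^ (s choose 2) / (q ^ m) ^ s * spectrum q t l m w 0"
      if s: "t \<le> s" "s \<le> l" for s
    proof -
      have eq: "w j * (\<Prod>i\<in>{s..<l}. q ^ (m + j) - q ^ i) = \<beta> j / (\<Prod>i\<in>{N..<s}. q ^ (m + j) - q ^ i)" for j
      proof -
        have "(\<Prod>i\<in>{N..<l}. q ^ (m + j) - q ^ i)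
            = (\<Prod>i\<in>{N..<s}. q ^ (m + j) - q ^ i) * (\<Prod>i\<in>{s..<l}. q ^ (m + j) - q ^ i)"
          using s tN by (intro prod.atLeastLessThan_concat[symmetric]) auto
        then show ?thesis
          by (simp only: w_def cancel2[OF pos_prod[of l j s, OF order_refl]])
      qed
      have ge: "(q ^ m) ^ (s - N) / 4 \<le> (\<Prod>i\<in>{N..<s}. q ^ (m + j) - q ^ i)" for j
      proof -
        have "(q ^ m) ^ (s - N) / 4 \<le> (\<Prod>i\<in>{N..<s}. q ^ m - q ^ i)"
          by (rule prod_diff_powers_ge) (use q s l in auto)
        also have "\<dots> \<le> (\<Prod>i\<in>{N..<s}. q ^ (m + j) - q ^ i)"
          using pos[of _ 0] s q by (intro prod_mono) (auto simp: less_imp_le intro!: power_increasing)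
        finally show ?thesis .
      qed
      have "\<bar>\<Sum>j<t. w j * (\<Prod>i\<in>{s..<l}. q ^ (m + j) - q ^ i)\<bar>
          \<le> (\<Sum>j<t. \<bar>\<beta> j / (\<Prod>i\<in>{N..<s}. q ^ (m + j) - q ^ i)\<bar>)"
        unfolding eq by (rule sum_abs)
      also have "\<dots> \<le> (\<Sum>j<t. \<bar>\<beta> j\<bar> * (4 / (q ^ m) ^ (s - N)))"
      proof (rule sum_mono)
        fix j
        have "1 / (\<Prod>i\<in>{N..<s}. q ^ (m + j) - q ^ i) \<le> 1 / ((q ^ m) ^ (s - N) / 4)"
          by (rule divide_left_mono[OF ge]) (use q pos_prod[of s j N] s in \<open>auto intro!: mult_pos_pos\<close>)
        then show "\<bar>\<beta> j / (\<Prod>i\<in>{N..<s}. q ^ (m + j) - q ^ i)\<bar> \<le> \<bar>\<beta> j\<bar> * (4 / (q ^ m) ^ (s - N))"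
          using pos_prod[of s j N] s mult_left_mono[of _ _ "\<bar>\<beta> j\<bar>"] by (fastforce simp: abs_divide)
      qed
      also have "\<dots> = (\<Sum>j\<le>N. \<bar>\<beta> j\<bar>) * (4 / (q ^ m) ^ (s - N))"
        by (simp only: tN lessThan_Suc_atMost sum_distrib_right)
      also have "\<dots> \<le> B * (4 / (q ^ m) ^ (s - N))"
        using q by (intro mult_right_mono) (auto simp: B_def)
      also have "\<dots> = K / (q ^ m) ^ s * (Q * (q ^ m) ^ N)"
        using Q q s tN by (simp add: K_def power_diff)
      finally have "\<bar>\<Sum>j<t. w j * (\<Prod>i\<in>{s..<l}. q ^ (m + j) - q ^ i)\<bar> \<le> K / (q ^ m) ^ s * (Q * (q ^ m) ^ N)" .
      then have "q ^ (s choose 2) * \<bar>\<Sum>j<t. w j * (\<Prod>i\<in>{s..<l}. q ^ (m + j) - q ^ i)\<bar>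
          \<le> q ^ (s choose 2) * (K / (q ^ m) ^ s * (Q * (q ^ m) ^ N))"
        using q by (intro mult_left_mono) auto
      then show ?thesis
        unfolding s0 using q by (simp add: spectrum_def abs_mult power_abs mult_ac)
    qed
    moreover have "spectrum q t l m w s = 0" if "1 \<le> s" "s < t" for s
      using low[of s] that tN by (simp add: spectrum_def)
    moreover have "0 < spectrum q t l m w 0" using Q q by (simp add: s0)
    ultimately show ?thesis by blast
  qed
  moreover have "K > 0" using B Q by (simp add: K_def)
  ultimately show ?thesis by blast
qed

text \<open>
  A weighted count of the ways to append \<open>j < t\<close> columns to \<open>R\<close> that make its rows independent. It
  is \<open>0\<close> when \<open>R\<close> has \<open>t\<close> independent row relations, because \<open>j\<close> columns destroy at most \<open>j\<close>
  of them.
\<close>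

definition extension_weight :: "nat \<Rightarrow> nat \<Rightarrow> nat \<Rightarrow> (nat \<Rightarrow> real) \<Rightarrow> 'a::{field,finite} matrix \<Rightarrow> real" where
  "extension_weight t l m w R = (\<Sum>j<t. w j * card {r \<in> mat l (m + j). indep {..<l} r \<and> trunc m r = R})"

text \<open>
  Equivalent to the existence of \<open>t\<close> independent row relations of \<open>R\<close>; in this form it is visible
  that \<open>extension_weight\<close> vanishes at \<open>R\<close>.
\<close>

abbreviation inextensible :: "nat \<Rightarrow> nat \<Rightarrow> nat \<Rightarrow> 'a::field matrix \<Rightarrow> bool" where
  "inextensible t l m R \<equiv> \<forall>j<t. \<forall>r\<in>mat l (m + j). trunc m r = R \<longrightarrow> \<not> indep {..<l} r"

lemma trunc_mat: "r \<in> mat l (m + j) \<Longrightarrow> trunc m r \<in> mat l m"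
  by (auto simp: mat_iff trunc_def)

context additive_character
begin

lemma fourier_extension_weight:
  assumes X: "X \<in> mat l m"
  shows "(\<Sum>R\<in>mat l m. of_real (extension_weight t l m w R) * \<psi> (pair l m X R))
    = of_real (spectrum (real CARD('a)) t l m w (rank {..<l} X))"
proof -
  have pair_trunc: "pair l m X (trunc m r) = pair l (m + j) X r" for r j
  proof -
    have "dot m (X i) (trunc m r i) = dot (m + j) (X i) (r i)" for i
      unfolding dot_def using X by (intro sum.mono_neutral_cong_left) (auto simp: trunc_def mat_iff)
    then show ?thesis by (simp add: pair_def)
  qed
  have coefficient_eq: "(\<Sum>R\<in>mat l m. of_nat (card {r \<in> mat l (m + j). indep {..<l} r \<and> trunc m r = R}) * \<psi> (pair l m X R))
      = indep_char_sum {..<l} (m + j) X" for j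
  proof -
    let ?S = "{r \<in> mat l (m + j). indep {..<l} r} :: 'a matrix set"
    have "(\<Sum>R\<in>mat l m. of_nat (card {r \<in> mat l (m + j). indep {..<l} r \<and> trunc m r = R}) * \<psi> (pair l m X R))
        = (\<Sum>R\<in>mat l m. \<Sum>r\<in>{r \<in> ?S. trunc m r = R}. \<psi> (pair l (m + j) X r))"
    proof (intro sum.cong refl)
      fix R
      have "(\<Sum>r\<in>{r \<in> ?S. trunc m r = R}. \<psi> (pair l (m + j) X r)) = (\<Sum>r\<in>{r \<in> ?S. trunc m r = R}. \<psi> (pair l m X R))"
        by (intro sum.cong) (auto simp: pair_trunc[symmetric])
      then show "of_nat (card {r \<in> mat l (m + j). indep {..<l} r \<and> trunc m r = R}) * \<psi> (pair l m X R)
          = (\<Sum>r\<in>{r \<in> ?S. trunc m r = R}. \<psi> (pair l (m + j) X r))"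
        by (simp add: conj_assoc)
    qed
    also have "\<dots> = (\<Sum>r\<in>?S. \<psi> (pair l (m + j) X r))"
      by (rule sum.group) (auto simp: finite_mat intro: trunc_mat)
    also have "\<dots> = indep_char_sum {..<l} (m + j) X"
      unfolding indep_char_sum_def pair_def mat_def[symmetric]
      by (intro sum.mono_neutral_cong_left) (auto simp: finite_mat)
    finally show ?thesis .
  qed
  obtain B where B: "basis_of {..<l} X B" "card B = rank {..<l} X" using obtain_basis[of "{..<l}" X] by auto
  have rank_eq: "indep_char_sum {..<l} (m + j) X = of_real ((-1) ^ rank {..<l} X * real CARD('a) ^ (rank {..<l} X choose 2)
      * (\<Prod>i\<in>{rank {..<l} X..<l}. real CARD('a) ^ (m + j) - real CARD('a) ^ i))" for j
  proof -
    have "indep_char_sum {..<l} (m + j) X = (-1) ^ card B * of_nat CARD('a) ^ (card B choose 2)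
      * (\<Prod>i\<in>{card B..<card {..<l}}. of_nat CARD('a) ^ (m + j) - of_nat CARD('a) ^ i)"
      using B(1) mat_row[OF X] coord_space_mono[of m "m + j"]
      by (intro indep_char_sum_rank) (auto simp: basis_of_def)
    then show ?thesis by (simp add: B(2))
  qed
  have "(\<Sum>R\<in>mat l m. of_real (extension_weight t l m w R) * \<psi> (pair l m X R))
      = (\<Sum>R\<in>mat l m. \<Sum>j<t. of_real (w j) * (of_nat (card {r \<in> mat l (m + j). indep {..<l} r \<and> trunc m r = R}) * \<psi> (pair l m X R)))"
    by (simp add: extension_weight_def sum_distrib_right mult.assoc)
  also have "\<dots> = (\<Sum>j<t. of_real (w j) * indep_char_sum {..<l} (m + j) X)"
    by (subst sum.swap) (simp only: sum_distrib_left[symmetric] coefficient_eq)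
  also have "\<dots> = of_real (spectrum (real CARD('a)) t l m w (rank {..<l} X))"
    unfolding rank_eq spectrum_def by (simp add: sum_distrib_left mult_ac)
  finally show ?thesis .
qed

end

section \<open>Pairs of matrix families without small corank\<close>

context additive_character
begin

text \<open>
  Let \<open>S D\<close> be the sum of the weights of \<open>D - C A\<close> over \<open>A \<in> \<A>\<close>. On \<open>W\<close> it is \<open>0\<close>, so that
  its squared distance from its mean \<open>\<mu>\<close>, summed over all \<open>D\<close>, is at least \<open>card W * \<mu>\<^sup>2\<close>. By
  Parseval's identity this sum is given by the coefficients of \<open>S\<close> at nonzero frequencies, which are
  products of a coefficient of the weight and a character sum over \<open>\<A>\<close>.
\<close>

lemma mean_square_bound:
  fixes \<A> :: "'a matrix set"
    and H :: "nat \<Rightarrow> real"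
  assumes A: "\<A> \<subseteq> mat k m" and C: "C \<in> mat l k"
    and W: "W \<subseteq> mat l m"
    and zero: "\<And>A D. A \<in> \<A> \<Longrightarrow> D \<in> W \<Longrightarrow> extension_weight t l m w (D - mprod k C A) = 0"
  defines "H \<equiv> spectrum (real CARD('a)) t l m w"
  shows "card W * (card \<A> * H 0)\<^sup>2 \<le> CARD('a) ^ (l * m) *
    (\<Sum>X\<in>mat l m - {0}. (H (rank {..<l} X))\<^sup>2 * (norm (\<Sum>A\<in>\<A>. \<psi> (pair k m (tprod l C X) A)))\<^sup>2)"
proof -
  let ?M = "mat l m :: 'a matrix set"
  let ?q = "real CARD('a) ^ (l * m)"
  have qpos: "?q > 0" by simp
  have finA: "finite \<A>" using A finite_mat finite_subset by blast
  have finW: "finite W" using W finite_mat finite_subset by blast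
  define S where "S D = (\<Sum>A\<in>\<A>. extension_weight t l m w (D - mprod k C A))" for D
  define \<mu> where "\<mu> = card \<A> * H 0 / ?q"
  define F where "F X = (\<Sum>A\<in>\<A>. \<psi> (pair k m (tprod l C X) A))" for X
  have hat_S: "(\<Sum>D\<in>?M. of_real (S D) * \<psi> (pair l m X D)) = of_real (H (rank {..<l} X)) * F X"
    if X: "X \<in> ?M" for X
  proof -
    have "(\<Sum>D\<in>?M. of_real (S D) * \<psi> (pair l m X D))
        = (\<Sum>A\<in>\<A>. \<Sum>D\<in>?M. of_real (extension_weight t l m w (D - mprod k C A)) * \<psi> (pair l m X D))"
      unfolding S_def of_real_sum sum_distrib_right by (rule sum.swap)
    also have "\<dots> = (\<Sum>A\<in>\<A>. of_real (H (rank {..<l} X)) * \<psi> (pair k m (tprod l C X) A))"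
    proof (intro sum.cong refl)
      fix A assume "A \<in> \<A>"
      then have P: "mprod k C A \<in> ?M" using mprod_mat[OF C] A by auto
      have "bij_betw (\<lambda>R. R + mprod k C A) ?M ?M"
        by (rule bij_betwI[where g = "\<lambda>R. R - mprod k C A"]) (use P in \<open>auto intro: mat_add mat_diff\<close>)
      from sum.reindex_bij_betw[OF this, of "\<lambda>D. of_real (extension_weight t l m w (D - mprod k C A)) * \<psi> (pair l m X D)"]
      have "(\<Sum>D\<in>?M. of_real (extension_weight t l m w (D - mprod k C A)) * \<psi> (pair l m X D))
          = (\<Sum>R\<in>?M. (of_real (extension_weight t l m w R) * \<psi> (pair l m X R)) * \<psi> (pair l m X (mprod k C A)))"
        by (simp add: pair_add_right psi_add mult.assoc)
      also have "\<dots> = of_real (H (rank {..<l} X)) * \<psi> (pair k m (tprod l C X) A)"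
        by (simp only: sum_distrib_right[symmetric] fourier_extension_weight[OF X] H_def pair_mprod)
      finally show "(\<Sum>D\<in>?M. of_real (extension_weight t l m w (D - mprod k C A)) * \<psi> (pair l m X D))
          = of_real (H (rank {..<l} X)) * \<psi> (pair k m (tprod l C X) A)" .
    qed
    finally show ?thesis by (simp add: F_def sum_distrib_left)
  qed
  have rank0: "rank {..<l} (0 :: 'a matrix) = 0"
  proof -
    have "lc {..<l} c (0 :: 'a matrix) = 0" for c
      by (auto simp: fun_eq_iff lc_apply)
    then have "lspan {..<l} (0 :: 'a matrix) = {0}"
      by (auto simp: lspan_iff)
    then have "CARD('a) ^ rank {..<l} (0 :: 'a matrix) = 1"
      using card_lspan_rank[of "{..<l}" "0 :: 'a matrix"] by simp
    then show ?thesis using card_field_ge_2[where 'a = 'a] by simp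
  qed
  have hat: "(\<Sum>D\<in>?M. of_real (S D - \<mu>) * \<psi> (pair l m X D))
      = (if X = 0 then 0 else of_real (H (rank {..<l} X)) * F X)" if X: "X \<in> ?M" for X
  proof -
    have "(\<Sum>D\<in>?M. of_real (S D - \<mu>) * \<psi> (pair l m X D))
        = (\<Sum>D\<in>?M. of_real (S D) * \<psi> (pair l m X D)) - of_real \<mu> * (\<Sum>D\<in>?M. \<psi> (pair l m D X))"
      by (simp add: algebra_simps sum_subtractf sum_distrib_left pair_commute[of l m X])
    also have "\<dots> = of_real (H (rank {..<l} X)) * F X - of_real \<mu> * (if X = 0 then of_real ?q else 0)"
      by (simp add: hat_S[OF X] sum_psi_pair[OF X])
    also have "\<dots> = (if X = 0 then 0 else of_real (H (rank {..<l} X)) * F X)"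
    proof (cases "X = 0")
      case True
      have "tprod l C 0 = 0" by (auto simp: fun_eq_iff tprod_def lc_apply)
      then have "F 0 = of_nat (card \<A>)" by (simp add: F_def pair_def dot_def)
      then show ?thesis using True qpos by (simp add: rank0 \<mu>_def)
    qed simp
    finally show ?thesis .
  qed
  have "card W * \<mu>\<^sup>2 = (\<Sum>D\<in>W. (S D - \<mu>)\<^sup>2)"
    using zero by (simp add: S_def)
  also have "\<dots> \<le> (\<Sum>D\<in>?M. (S D - \<mu>)\<^sup>2)"
    by (rule sum_mono2[OF finite_mat W]) auto
  finally have "?q * (card W * \<mu>\<^sup>2) \<le> ?q * (\<Sum>D\<in>?M. (norm (complex_of_real (S D - \<mu>)))\<^sup>2)"
    using qpos by (simp only: norm_of_real power2_abs) (rule mult_left_mono, assumption, rule less_imp_le)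
  also have "\<dots> = (\<Sum>X\<in>?M. (norm (\<Sum>D\<in>?M. of_real (S D - \<mu>) * \<psi> (pair l m X D)))\<^sup>2)"
    using parseval_mat[of "\<lambda>D. of_real (S D - \<mu>)" l m] by simp
  also have "\<dots> = (\<Sum>X\<in>?M. if X = 0 then 0 else (H (rank {..<l} X))\<^sup>2 * (norm (F X))\<^sup>2)"
    by (intro sum.cong refl, subst hat) (auto simp: norm_mult power_mult_distrib)
  also have "\<dots> = (\<Sum>X\<in>?M - {0}. (H (rank {..<l} X))\<^sup>2 * (norm (F X))\<^sup>2)"
    by (intro sum.mono_neutral_cong_right) (auto simp: finite_mat)
  finally have "?q * (card W * \<mu>\<^sup>2) \<le> (\<Sum>X\<in>?M - {0}. (H (rank {..<l} X))\<^sup>2 * (norm (F X))\<^sup>2)" .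
  from mult_left_mono[OF this, of ?q]
  have "?q * (?q * (card W * \<mu>\<^sup>2)) \<le> ?q * (\<Sum>X\<in>?M - {0}. (H (rank {..<l} X))\<^sup>2 * (norm (F X))\<^sup>2)" by simp
  moreover have "?q * (?q * (card W * \<mu>\<^sup>2)) = card W * (card \<A> * H 0)\<^sup>2"
    using qpos by (simp add: \<mu>_def power2_eq_square)
  ultimately show ?thesis by (simp add: F_def)
qed

lemma sum_character_sums:
  fixes \<A> :: "'a matrix set"
  assumes A: "\<A> \<subseteq> mat k m"
  shows "(\<Sum>M\<in>mat k m. (norm (\<Sum>A\<in>\<A>. \<psi> (pair k m M A)))\<^sup>2) = CARD('a) ^ (k * m) * card \<A>"
proof -
  have "(\<Sum>D\<in>mat k m. (if D \<in> \<A> then 1 else 0) * \<psi> (pair k m M D)) = (\<Sum>A\<in>\<A>. \<psi> (pair k m M A))" for M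
    using A by (intro sum.mono_neutral_cong_right) (auto simp: finite_mat)
  moreover have "(\<Sum>D\<in>mat k m. (norm (if D \<in> \<A> then 1 else 0 :: complex))\<^sup>2) = (\<Sum>D\<in>\<A>. 1)"
    using A by (intro sum.mono_neutral_cong_right) (auto simp: finite_mat)
  ultimately show ?thesis
    using parseval_mat[of "\<lambda>D. if D \<in> \<A> then 1 else 0" k m] by simp
qed

text \<open>
  Sum \<open>mean_square_bound\<close> over all \<open>C\<close> and collect the pairs \<open>(C, X)\<close> with the same rank of \<open>X\<close> and
  the same transposed product \<open>M\<close>. There are few pairs in each class, and the character
  sums at all \<open>M\<close> together are given by Parseval's identity.
\<close>

theorem card_avoiding_bound:
  fixes \<A> :: "'a matrix set" and W :: "('a matrix \<times> 'a matrix) set"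
    and H :: "nat \<Rightarrow> real"
  assumes A: "\<A> \<subseteq> mat k m"
    and W: "W \<subseteq> {C \<in> mat l k. indep {..<l} C} \<times> mat l m"
    and zero: "\<And>A C D. A \<in> \<A> \<Longrightarrow> (C, D) \<in> W \<Longrightarrow> extension_weight t l m w (D - mprod k C A) = 0"
  defines "H \<equiv> spectrum (real CARD('a)) t l m w"
  assumes low: "\<And>s. 1 \<le> s \<Longrightarrow> s < t \<Longrightarrow> H s = 0"
  shows "card W * (card \<A> * H 0)\<^sup>2 \<le> CARD('a) ^ (l * m + k * m) * card \<A> *
    (\<Sum>s\<in>{t..l}. (H s)\<^sup>2 * CARD('a) ^ (s * l + k * (l - s)))"
proof -
  let ?q = "real CARD('a) ^ (l * m)"
  define Cs :: "'a matrix set" where "Cs = {C \<in> mat l k. indep {..<l} C}"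
  define F where "F M = (norm (\<Sum>A\<in>\<A>. \<psi> (pair k m M A)))\<^sup>2" for M
  have finCs: "finite Cs" by (simp add: Cs_def finite_mat)
  have finW: "finite W" by (rule finite_subset[OF W]) (simp add: finite_mat)
  let ?X = "mat l m :: 'a matrix set"
  have "card W = (\<Sum>C\<in>Cs. card (W `` {C}))"
  proof -
    have "W = (SIGMA C:Cs. W `` {C})" using W by (auto simp: Cs_def)
    moreover have "card (SIGMA C:Cs. W `` {C}) = (\<Sum>C\<in>Cs. card (W `` {C}))"
      using finCs finW by (intro card_SigmaI) auto
    ultimately show ?thesis by metis
  qed
  then have "card W * (card \<A> * H 0)\<^sup>2 = (\<Sum>C\<in>Cs. card (W `` {C}) * (card \<A> * H 0)\<^sup>2)"
    by (simp add: sum_distrib_right)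
  also have "\<dots> \<le> (\<Sum>C\<in>Cs. ?q * (\<Sum>X\<in>?X - {0}. (H (rank {..<l} X))\<^sup>2 * F (tprod l C X)))"
  proof (rule sum_mono)
    fix C assume "C \<in> Cs"
    then have "card (W `` {C}) * (card \<A> * spectrum (real CARD('a)) t l m w 0)\<^sup>2 \<le> CARD('a) ^ (l * m) *
      (\<Sum>X\<in>mat l m - {0}. (spectrum (real CARD('a)) t l m w (rank {..<l} X))\<^sup>2 *
         (norm (\<Sum>A\<in>\<A>. \<psi> (pair k m (tprod l C X) A)))\<^sup>2)"
      by (intro mean_square_bound[OF A]) (use W zero in \<open>auto simp: Cs_def\<close>)
    then show "card (W `` {C}) * (card \<A> * H 0)\<^sup>2 \<le> ?q * (\<Sum>X\<in>?X - {0}. (H (rank {..<l} X))\<^sup>2 * F (tprod l C X))"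
      by (simp add: H_def F_def)
  qed
  also have "\<dots> = ?q * (\<Sum>(C, X)\<in>Cs \<times> (?X - {0}). (H (rank {..<l} X))\<^sup>2 * F (tprod l C X))"
    by (simp add: sum_distrib_left[symmetric] sum.cartesian_product)
  also have "(\<Sum>(C, X)\<in>Cs \<times> (?X - {0}). (H (rank {..<l} X))\<^sup>2 * F (tprod l C X))
      \<le> (\<Sum>s\<in>{t..l}. \<Sum>M\<in>mat k m. (H s)\<^sup>2 * F M * CARD('a) ^ (s * l + k * (l - s)))"
  proof -
    let ?P = "\<lambda>s M. {(C, X). C \<in> mat l k \<and> indep {..<l} C \<and> X \<in> mat l m \<and> rank {..<l} X = s \<and> tprod l C X = M}"
    let ?g = "\<lambda>(C, X). (H (rank {..<l} X))\<^sup>2 * F (tprod l C X)"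
    let ?G = "{(C, X). C \<in> Cs \<and> X \<in> ?X \<and> t \<le> rank {..<l} X}"
    let ?f = "\<lambda>(C, X). (rank {..<l} X, tprod l C X)"
    have fin: "finite (Cs \<times> ?X)" by (simp add: finCs finite_mat)
    have G: "?G \<subseteq> Cs \<times> ?X" by auto
    have finG: "finite ?G" by (rule finite_subset[OF G fin])
    have g0: "0 \<le> ?g x" for x by (auto simp: F_def split: prod.split)
    have "sum ?g (Cs \<times> (?X - {0})) = sum ?g (Cs \<times> (?X - {0}) \<inter> ?G)"
    proof (rule sum.mono_neutral_right)
      show "\<forall>x\<in>Cs \<times> (?X - {0}) - Cs \<times> (?X - {0}) \<inter> ?G. ?g x = 0"
      proof
        fix x assume x: "x \<in> Cs \<times> (?X - {0}) - Cs \<times> (?X - {0}) \<inter> ?G"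
        obtain C X where [simp]: "x = (C, X)" by (cases x)
        have X: "X \<in> ?X" "X \<noteq> 0" "rank {..<l} X < t" using x by auto
        have "rank {..<l} X \<noteq> 0"
        proof
          assume "rank {..<l} X = 0"
          then have "X i = 0" for i
            using rank_eq_0D[of "{..<l}" X i] X(1) by (cases "i < l") (auto simp: mat_iff fun_eq_iff)
          then show False using X(2) by (simp add: fun_eq_iff)
        qed
        then have "H (rank {..<l} X) = 0" using X(3) by (intro low) auto
        then show "?g x = 0" by simp
      qed
    qed (use finCs in \<open>auto simp: finite_mat\<close>)
    also have "\<dots> \<le> sum ?g ?G" by (rule sum_mono2[OF finG]) (use g0 in auto)
    also have "\<dots> = (\<Sum>p\<in>{t..l} \<times> mat k m. sum ?g {x \<in> ?G. ?f x = p})"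
      by (rule sum.group[symmetric, OF finG])
         (use rank_le[of "{..<l}"] in \<open>auto simp: finite_mat Cs_def intro: tprod_mat\<close>)
    also have "\<dots> \<le> (\<Sum>p\<in>{t..l} \<times> mat k m. case p of (s, M) \<Rightarrow> (H s)\<^sup>2 * F M * CARD('a) ^ (s * l + k * (l - s)))"
    proof (rule sum_mono)
      fix p assume "p \<in> {t..l} \<times> (mat k m :: 'a matrix set)"
      obtain s M where p: "p = (s, M)" by (cases p)
      have finP: "finite (?P s M)"
        by (rule finite_subset[of _ "mat l k \<times> mat l m"]) (auto simp: finite_mat)
      have "sum ?g {x \<in> ?G. ?f x = p} = (\<Sum>x\<in>{x \<in> ?G. ?f x = p}. (H s)\<^sup>2 * F M)"
        by (intro sum.cong) (auto simp: p)
      also have "\<dots> = (H s)\<^sup>2 * F M * card {x \<in> ?G. ?f x = p}" by simp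
      also have "\<dots> \<le> (H s)\<^sup>2 * F M * CARD('a) ^ (s * l + k * (l - s))"
      proof (rule mult_left_mono)
        have "card {x \<in> ?G. ?f x = p} \<le> card (?P s M)"
          by (rule card_mono[OF finP]) (auto simp: p Cs_def)
        then have "card {x \<in> ?G. ?f x = p} \<le> CARD('a) ^ (s * l + k * (l - s))"
          by (rule order_trans[OF _ card_preimage_tprod])
        then show "real (card {x \<in> ?G. ?f x = p}) \<le> CARD('a) ^ (s * l + k * (l - s))"
          by (simp only: of_nat_le_iff)
      qed (simp add: F_def)
      finally show "sum ?g {x \<in> ?G. ?f x = p} \<le> (case p of (s, M) \<Rightarrow> (H s)\<^sup>2 * F M * CARD('a) ^ (s * l + k * (l - s)))"
        by (simp add: p)
    qed
    finally show ?thesis by (simp add: sum.cartesian_product)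
  qed
  also have "(\<Sum>s\<in>{t..l}. \<Sum>M\<in>mat k m. (H s)\<^sup>2 * F M * CARD('a) ^ (s * l + k * (l - s)))
      = (\<Sum>s\<in>{t..l}. (H s)\<^sup>2 * CARD('a) ^ (s * l + k * (l - s))) * (CARD('a) ^ (k * m) * card \<A>)"
  proof -
    have "(\<Sum>M\<in>mat k m. (H s)\<^sup>2 * F M * CARD('a) ^ (s * l + k * (l - s)))
        = (H s)\<^sup>2 * CARD('a) ^ (s * l + k * (l - s)) * (CARD('a) ^ (k * m) * card \<A>)" for s
    proof -
      have "(\<Sum>M\<in>mat k m. (H s)\<^sup>2 * F M * CARD('a) ^ (s * l + k * (l - s)))
          = (H s)\<^sup>2 * CARD('a) ^ (s * l + k * (l - s)) * (\<Sum>M\<in>mat k m. F M)"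
        unfolding sum_distrib_left by (intro sum.cong) (simp_all add: mult_ac)
      then show ?thesis by (simp only: F_def sum_character_sums[OF A])
    qed
    then show ?thesis by (simp only: sum_distrib_right)
  qed
  finally show ?thesis by (simp add: power_add mult_ac)
qed

text \<open>
  The right side exceeds the left one by \<open>(s - t) * (2 * m + k - l - (s + t - 1))\<close>.
\<close>

lemma exponent_bound:
  fixes t s l k m :: nat
  assumes "1 \<le> t" "t \<le> s" "s \<le> l" "l \<le> k" "l \<le> m"
  shows "s * (s - 1) + (s * l + k * (l - s)) + t * (2 * m + k - l) \<le> t * (t - 1) + k * l + 2 * m * s"
proof -
  obtain u where t: "t = Suc u" using assms(1) by (cases t) auto
  obtain e where s: "s = t + e" using assms(2) le_Suc_ex by blast
  obtain d where l: "l = s + d" using assms(3) le_Suc_ex by blast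
  obtain a where k: "k = l + a" using assms(4) le_Suc_ex by blast
  obtain b where m: "m = l + b" using assms(5) le_Suc_ex by blast
  have "2 * m + k - l = 2 * m + a" by (simp add: k)
  then show ?thesis unfolding k m l s t by (simp add: algebra_simps)
qed

text \<open>
  Among the terms of \<open>card_avoiding_bound\<close> for the weights of \<open>spectral_weights\<close>, the one of rank
  \<open>s = t\<close> is largest up to a constant; at most \<open>l\<close> ranks occur.
\<close>

theorem card_matrix_pairs_bound:
  assumes t: "1 \<le> t"
  shows "\<exists>K>0. \<forall>k l m (\<A> :: 'a matrix set) W. t \<le> l \<longrightarrow> l \<le> k \<longrightarrow> l \<le> m \<longrightarrow>
    \<A> \<subseteq> mat k m \<longrightarrow> W \<subseteq> {C \<in> mat l k. indep {..<l} C} \<times> mat l m \<longrightarrow>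
    (\<forall>A\<in>\<A>. \<forall>(C, D)\<in>W. inextensible t l m (D - mprod k C A)) \<longrightarrow>
    real (card W) * real (card \<A>) * real CARD('a) ^ (t * (2 * m + k - l))
      \<le> K * real l * real CARD('a) ^ (k * m + k * l + l * m)"
proof -
  define q where "q = real CARD('a)"
  have q: "2 \<le> q" using card_field_ge_2[where 'a = 'a] unfolding q_def by linarith
  obtain K where K: "K > 0" and w: "\<And>l m. t \<le> l \<Longrightarrow> l \<le> m \<Longrightarrow> \<exists>w. 0 < spectrum q t l m w 0 \<and>
    (\<forall>s. 1 \<le> s \<longrightarrow> s < t \<longrightarrow> spectrum q t l m w s = 0) \<and>
    (\<forall>s. t \<le> s \<longrightarrow> s \<le> l \<longrightarrow>
      \<bar>spectrum q t l m w s\<bar> \<le> K * q ^ (s choose 2) / (q ^ m) ^ s * spectrum q t l m w 0)"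
    using spectral_weights[OF q t] by auto
  have "real (card W) * real (card \<A>) * q ^ (t * (2 * m + k - l)) \<le> (K\<^sup>2 * q ^ (t * (t - 1))) * l * q ^ (k * m + k * l + l * m)"
    if l: "t \<le> l" "l \<le> k" "l \<le> m" and A: "\<A> \<subseteq> mat k m"
      and W: "W \<subseteq> {C \<in> mat l k. indep {..<l} C} \<times> mat l m"
      and dep: "\<forall>A\<in>\<A>. \<forall>(C, D)\<in>W. inextensible t l m (D - mprod k C A)"
    for k l m W and \<A> :: "'a matrix set"
  proof (cases "\<A> = {}")
    case True
    then show ?thesis using q by simp
  next
    case False
    then have cA: "card \<A> > 0" using finite_subset[OF A finite_mat] by (simp add: card_gt_0_iff)
    obtain w where pos: "0 < spectrum q t l m w 0"
      and low: "\<And>s. 1 \<le> s \<Longrightarrow> s < t \<Longrightarrow> spectrum q t l m w s = 0"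
      and high: "\<And>s. t \<le> s \<Longrightarrow> s \<le> l \<Longrightarrow>
        \<bar>spectrum q t l m w s\<bar> \<le> K * q ^ (s choose 2) / (q ^ m) ^ s * spectrum q t l m w 0"
      using w[OF l(1,3)] by blast
    define H where "H = spectrum q t l m w"
    let ?T = "t * (2 * m + k - l)"
    have zero: "extension_weight t l m w (D - mprod k C A) = 0" if "A \<in> \<A>" "(C, D) \<in> W" for A C D
    proof -
      have e: "{r \<in> mat l (m + j). indep {..<l} r \<and> trunc m r = D - mprod k C A} = {}" if "j < t" for j
        using bspec[OF bspec[OF dep \<open>A \<in> \<A>\<close>] \<open>(C, D) \<in> W\<close>] that by auto
      have "real (card {r \<in> mat l (m + j). indep {..<l} r \<and> trunc m r = D - mprod k C A}) = 0"
        if "j < t" for j unfolding e[OF that] by simp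
      then show ?thesis unfolding extension_weight_def
        by (intro sum.neutral ballI) (simp only: lessThan_iff mult_zero_right)
    qed
    have main: "card W * (card \<A> * H 0)\<^sup>2 \<le> CARD('a) ^ (l * m + k * m) * card \<A> *
      (\<Sum>s\<in>{t..l}. (H s)\<^sup>2 * CARD('a) ^ (s * l + k * (l - s)))"
      unfolding H_def q_def
      by (rule card_avoiding_bound[OF A W zero[unfolded q_def]]) (use low[unfolded q_def] in auto)
    have summand_le: "(H s)\<^sup>2 * q ^ (s * l + k * (l - s)) * q ^ ?T \<le> K\<^sup>2 * q ^ (t * (t - 1)) * q ^ (k * l) * (H 0)\<^sup>2"
      if s: "t \<le> s" "s \<le> l" for s
    proof -
      have "(H s)\<^sup>2 \<le> (K * q ^ (s choose 2) / (q ^ m) ^ s * H 0)\<^sup>2"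
        using high[OF s] power_mono[of "\<bar>H s\<bar>" _ 2] by (simp add: H_def)
      also have "\<dots> = K\<^sup>2 * (H 0)\<^sup>2 * (q ^ (s * (s - 1)) / q ^ (2 * m * s))"
      proof -
        have "2 * (s choose 2) = s * (s - 1)"
          unfolding choose_two by (cases s) auto
        then have "(q ^ (s choose 2))\<^sup>2 = q ^ (s * (s - 1))" by (simp only: power_mult[symmetric] mult.commute[of _ "2::nat"])
        moreover have "((q ^ m) ^ s)\<^sup>2 = q ^ (2 * m * s)" by (simp add: power_mult[symmetric] mult_ac)
        ultimately show ?thesis by (simp add: power_mult_distrib power_divide)
      qed
      finally have "(H s)\<^sup>2 * (q ^ (s * l + k * (l - s)) * q ^ ?T)
          \<le> K\<^sup>2 * (H 0)\<^sup>2 * (q ^ (s * (s - 1)) / q ^ (2 * m * s)) * (q ^ (s * l + k * (l - s)) * q ^ ?T)"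
        using q by (intro mult_right_mono) auto
      also have "\<dots> = K\<^sup>2 * (H 0)\<^sup>2 * (q ^ (s * (s - 1) + (s * l + k * (l - s)) + ?T) / q ^ (2 * m * s))"
        by (simp add: power_add mult_ac)
      also have "\<dots> \<le> K\<^sup>2 * (H 0)\<^sup>2 * (q ^ (t * (t - 1) + k * l + 2 * m * s) / q ^ (2 * m * s))"
        using q by (intro mult_left_mono divide_right_mono power_increasing exponent_bound t s l) auto
      also have "\<dots> = K\<^sup>2 * q ^ (t * (t - 1)) * q ^ (k * l) * (H 0)\<^sup>2"
        using q by (simp add: power_add)
      finally show ?thesis by (simp add: mult_ac)
    qed
    have "(real (card W) * real (card \<A>) * q ^ ?T) * (card \<A> * (H 0)\<^sup>2) = card W * (card \<A> * H 0)\<^sup>2 * q ^ ?T"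
      by (simp add: power2_eq_square)
    also have "\<dots> \<le> q ^ (l * m + k * m) * card \<A> * (\<Sum>s\<in>{t..l}. (H s)\<^sup>2 * q ^ (s * l + k * (l - s))) * q ^ ?T"
      using main q by (intro mult_right_mono) (auto simp: q_def)
    also have "\<dots> = q ^ (l * m + k * m) * card \<A> * (\<Sum>s\<in>{t..l}. (H s)\<^sup>2 * q ^ (s * l + k * (l - s)) * q ^ ?T)"
      by (simp only: sum_distrib_right mult.assoc)
    also have "\<dots> \<le> q ^ (l * m + k * m) * card \<A> * (\<Sum>s\<in>{t..l}. K\<^sup>2 * q ^ (t * (t - 1)) * q ^ (k * l) * (H 0)\<^sup>2)"
      using q by (intro mult_left_mono sum_mono summand_le) auto
    also have "\<dots> \<le> q ^ (l * m + k * m) * card \<A> * (l * (K\<^sup>2 * q ^ (t * (t - 1)) * q ^ (k * l) * (H 0)\<^sup>2))"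
    proof -
      have "real (card {t..l}) \<le> real l" using t by simp
      then show ?thesis using q by (simp only: sum_constant) (intro mult_left_mono mult_right_mono, auto)
    qed
    also have "\<dots> = ((K\<^sup>2 * q ^ (t * (t - 1))) * l * q ^ (k * m + k * l + l * m)) * (card \<A> * (H 0)\<^sup>2)"
      by (simp add: power_add mult_ac)
    finally show ?thesis
      by (rule mult_right_le_imp_le) (use cA pos in \<open>simp add: H_def\<close>)
  qed
  moreover have "K\<^sup>2 * q ^ (t * (t - 1)) > 0" using K q by simp
  ultimately show ?thesis unfolding q_def
    by (intro exI[of _ "K\<^sup>2 * q ^ (t * (t - 1))"] conjI allI impI) (simp_all only: q_def)
qed

end

section \<open>Subspaces and their cardinalities\<close>

abbreviation layer :: "nat \<Rightarrow> nat \<Rightarrow> 'a::field vec set set" where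
  "layer n k \<equiv> {x \<in> subspaces n. seq_space.dim x = k}"

lemma subspaces_finite: "x \<in> subspaces n \<Longrightarrow> finite (x :: 'a::{field,finite} vec set)"
  using finite_coord_space finite_subset by (auto simp: subspaces_def)

lemma subspaces_basis:
  fixes x :: "'a::{field,finite} vec set"
  assumes x: "x \<in> subspaces n"
  shows "\<exists>u. indep {..<seq_space.dim x} u \<and> x = lspan {..<seq_space.dim x} u"
proof -
  let ?k = "seq_space.dim x"
  have sub: "seq_space.subspace x" using x by (simp add: subspaces_def)
  obtain B where B: "B \<subseteq> x" "seq_space.independent B" "x \<subseteq> seq_space.span B" "card B = seq_space.dim x"
    using seq_space.basis_exists[of x] by blast
  have fB: "finite B" using B(1) subspaces_finite[OF x] finite_subset by blast
  obtain h where h: "bij_betw h {..<?k} B"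
    using ex_bij_betw_nat_finite[OF fB] B(4) by (auto simp: atLeast0LessThan)
  have lc_h: "lc {..<?k} (\<lambda>i. c (h i)) h = (\<Sum>v\<in>B. seq_scale (c v) v)" for c
    unfolding lc_def by (rule sum.reindex_bij_betw[OF h])
  have ex_c: "\<exists>d. \<forall>i<?k. d (h i) = c i" for c :: "'a vec"
    using bij_betw_inv_into_left[OF h] by (intro exI[of _ "\<lambda>v. c (inv_into {..<?k} h v)"]) auto
  have "indep {..<?k} h"
    unfolding indep_def
  proof (intro allI impI ballI)
    fix c i assume 0: "lc {..<?k} c h = 0" and i: "i \<in> {..<?k}"
    obtain d where d: "\<And>i. i < ?k \<Longrightarrow> d (h i) = c i" using ex_c by blast
    have "lc {..<?k} (\<lambda>i. d (h i)) h = lc {..<?k} c h"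
      by (rule lc_cong) (use d in auto)
    then have "lc {..<?k} (\<lambda>i. d (h i)) h = 0" using 0 by simp
    then have "(\<Sum>v\<in>B. seq_scale (d v) v) = 0" by (simp add: lc_h)
    then have "d (h i) = 0"
      using B(2) seq_space.dependent_finite[OF fB] bij_betwE[OF h] i by blast
    then show "c i = 0" using d i by simp
  qed
  moreover have "x = lspan {..<?k} h"
  proof
    show "lspan {..<?k} h \<subseteq> x"
      using B(1) bij_betwE[OF h] by (intro lspan_subset sub) auto
    show "x \<subseteq> lspan {..<?k} h"
    proof
      fix z assume "z \<in> x"
      then obtain c where "z = (\<Sum>v\<in>B. seq_scale (c v) v)"
        using B(3) by (auto simp: seq_space.span_finite[OF fB])
      then show "z \<in> lspan {..<?k} h" by (auto simp: lc_h[symmetric] lc_in_lspan)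
    qed
  qed
  ultimately show ?thesis by blast
qed

lemma card_subspaces: "x \<in> subspaces n \<Longrightarrow> card (x :: 'a::{field,finite} vec set) = CARD('a) ^ seq_space.dim x"
proof -
  assume "x \<in> subspaces n"
  then obtain u where u: "indep {..<seq_space.dim x} u" "x = lspan {..<seq_space.dim x} u"
    using subspaces_basis by blast
  show ?thesis using card_lspan[OF u(1)] u(2) by simp
qed

lemma lc_lc: "lc J e (\<lambda>j. lc K (C j) u) = lc K (lc J e C) u"
proof
  fix p
  have "lc J e (\<lambda>j. lc K (C j) u) p = (\<Sum>j\<in>J. \<Sum>i\<in>K. e j * (C j i * u i p))"
    by (simp add: lc_apply sum_distrib_left)
  also have "\<dots> = lc K (lc J e C) u p"
    by (subst sum.swap) (simp add: lc_apply sum_distrib_right mult.assoc)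
  finally show "lc J e (\<lambda>j. lc K (C j) u) p = lc K (lc J e C) u p" .
qed

lemma lc_add_right: "lc J e (\<lambda>j. r j + s j) = lc J e r + lc J e s"
  by (auto simp: fun_eq_iff lc_apply algebra_simps sum.distrib)

lemma lc_diff_right: "lc J e (\<lambda>j. r j - s j) = lc J e r - lc J e s"
  by (auto simp: fun_eq_iff lc_apply algebra_simps sum_subtractf)

lemma card_indep_tuples:
  fixes Y :: "'a::{field,finite} vec set"
  assumes Y: "seq_space.subspace Y" "finite Y" and J: "finite J"
  shows "real (card {r \<in> tuples J Y. indep J r}) = (\<Prod>i<card J. real (card Y) - real CARD('a) ^ i)"
  using J
proof (induction J rule: finite_induct)
  case empty
  have "{r \<in> tuples {} Y. indep {} r} = {0}" by auto
  then show ?case by simp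
next
  case (insert j J)
  have cnt: "real (card {r \<in> tuples J Y. P r}) = (\<Sum>r\<in>tuples J Y. if P r then 1 else 0)" if "finite J" for J and P :: "('b \<Rightarrow> 'a vec) \<Rightarrow> bool"
    using finite_tuples[OF that Y(2)] by (simp add: sum.If_cases Int_def)
  have "real (card {r \<in> tuples (insert j J) Y. indep (insert j J) r})
      = (\<Sum>r\<in>tuples J Y. \<Sum>x\<in>Y. if indep J r \<and> x \<notin> lspan J r then 1 else 0)"
    using insert.hyps by (subst cnt) (simp_all only: finite_insert sum_tuples_insert[OF insert.hyps(2)] indep_fun_upd[OF insert.hyps])
  also have "\<dots> = (\<Sum>r\<in>tuples J Y. if indep J r then real (card Y) - real CARD('a) ^ card J else 0)"
  proof (intro sum.cong refl)
    fix r assume r: "r \<in> tuples J Y"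
    have sub: "lspan J r \<subseteq> Y" using r by (intro lspan_subset Y(1)) (auto simp: tuples_def)
    show "(\<Sum>x\<in>Y. if indep J r \<and> x \<notin> lspan J r then 1 else 0)
      = (if indep J r then real (card Y) - real CARD('a) ^ card J else 0)"
    proof (cases "indep J r")
      case True
      have "(\<Sum>x\<in>Y. if indep J r \<and> x \<notin> lspan J r then 1 else (0::real)) = real (card (Y - lspan J r))"
        using True Y(2) by (simp add: sum.If_cases Int_def set_diff_eq)
      also have "\<dots> = real (card Y) - real (card (lspan J r))"
        using sub Y(2) by (simp add: card_Diff_subset finite_subset of_nat_diff card_mono)
      finally show ?thesis using True insert.hyps by (simp add: card_lspan)
    qed simp
  qed
  also have "\<dots> = (real (card Y) - real CARD('a) ^ card J) * real (card {r \<in> tuples J Y. indep J r})"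
    using insert.hyps by (simp add: cnt sum_distrib_left if_distrib cong: if_cong)
  finally show ?case using insert by (simp add: mult.commute)
qed

lemma card_sum_subspaces:
  fixes S T :: "'a::{field,finite} vec set"
  assumes S: "seq_space.subspace S" and T: "seq_space.subspace T" and int: "S \<inter> T = {0}"
  shows "card {a + b | a b. a \<in> S \<and> b \<in> T} = card S * card T"
proof -
  have "inj_on (\<lambda>(a, b). a + b) (S \<times> T)"
  proof (rule inj_onI, clarify)
    fix a b a' b' assume m: "a \<in> S" "b \<in> T" "a' \<in> S" "b' \<in> T" and eq: "a + b = a' + b'"
    have d: "a - a' = b' - b" using eq by (simp add: algebra_simps)
    have "a - a' \<in> S \<inter> T"
      using seq_space.subspace_diff[OF S m(1,3)] seq_space.subspace_diff[OF T m(4,2)] d by auto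
    then have "a - a' = 0" using int by blast
    then show "a = a' \<and> b = b'" using d by simp
  qed
  moreover have "{a + b | a b. a \<in> S \<and> b \<in> T} = (\<lambda>(a, b). a + b) ` (S \<times> T)" by auto
  ultimately show ?thesis by (simp add: card_image card_cartesian_product)
qed

text \<open>
  The differences of elements of \<open>S\<close> and \<open>T\<close> lie in \<open>V\<close>, and each fibre of the difference map is
  a translate of a copy of \<open>S \<inter> T\<close> or empty.
\<close>

lemma card_inter_subspaces:
  fixes S T V :: "'a::{field,finite} vec set"
  assumes S: "seq_space.subspace S" "S \<subseteq> V" and T: "seq_space.subspace T" "T \<subseteq> V"
    and V: "seq_space.subspace V" "finite V"
  shows "card S * card T \<le> card V * card (S \<inter> T)"
proof -
  have fin: "finite S" "finite T" using S T V finite_subset by auto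
  have "card (S \<times> T) = (\<Sum>v\<in>V. card {p \<in> S \<times> T. fst p - snd p = v})"
  proof -
    have "(\<lambda>p. fst p - snd p) ` (S \<times> T) \<subseteq> V"
      using subsetD[OF S(2)] subsetD[OF T(2)] seq_space.subspace_diff[OF V(1)] by auto
    from sum.group[OF _ V(2) this, of "\<lambda>_. 1::nat"] show ?thesis using fin by simp
  qed
  also have "\<dots> \<le> (\<Sum>v\<in>V. card (S \<inter> T))"
  proof (rule sum_mono)
    fix v
    let ?F = "{p \<in> S \<times> T. fst p - snd p = v}"
    show "card ?F \<le> card (S \<inter> T)"
    proof (cases "?F = {}")
      case False
      then obtain a0 b0 where 0: "a0 \<in> S" "b0 \<in> T" "a0 - b0 = v" by auto
      show ?thesis
      proof (rule card_inj_on_le[where f = "\<lambda>p. fst p - a0"])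
        show "inj_on (\<lambda>p. fst p - a0) ?F"
        proof (rule inj_onI)
          fix p p' assume "p \<in> ?F" "p' \<in> ?F" "fst p - a0 = fst p' - a0"
          then have "fst p = fst p'" "fst p - snd p = fst p' - snd p'" by auto
          then show "p = p'" by (simp add: prod_eq_iff)
        qed
        show "(\<lambda>p. fst p - a0) ` ?F \<subseteq> S \<inter> T"
        proof
          fix z assume "z \<in> (\<lambda>p. fst p - a0) ` ?F"
          then obtain a b where ab: "a \<in> S" "b \<in> T" "a - b = v" "z = a - a0" by auto
          then have e: "a - a0 = b - b0" using 0(3) by (auto simp: algebra_simps)
          have "a - a0 \<in> S" using ab 0 seq_space.subspace_diff[OF S(1)] by auto
          moreover have "a - a0 \<in> T" unfolding e using ab 0 seq_space.subspace_diff[OF T(1)] by auto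
          ultimately show "z \<in> S \<inter> T" using ab(4) by simp
        qed
      qed (use fin in auto)
    qed (metis card.empty le0)
  qed
  finally show ?thesis by (simp add: card_cartesian_product)
qed

text \<open>
  For \<open>q = 2\<close> two hyperplanes have together as many elements as \<open>V\<close>, so that the union bound
  says nothing; the elements of \<open>S \<inter> T\<close>, counted twice there, make the difference.
\<close>

lemma card_avoiding_two_subspaces:
  fixes S T V :: "'a::{field,finite} vec set"
  assumes S: "seq_space.subspace S" "S \<subseteq> V" and T: "seq_space.subspace T" "T \<subseteq> V"
    and V: "seq_space.subspace V" "finite V"
  shows "(real (card V) - card S) * (real (card V) - card T) \<le> card V * real (card (V - (S \<union> T)))"
proof -
  have fin: "finite S" "finite T" using S T V finite_subset by auto
  have "card (S \<union> T) + card (S \<inter> T) = card S + card T" using card_Un_Int[OF fin] by simp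
  then have un: "real (card (S \<union> T)) = real (card S) + card T - card (S \<inter> T)" by linarith
  have "S \<union> T \<subseteq> V" using S T by auto
  then have "real (card (V - (S \<union> T))) = real (card V) - card (S \<union> T)"
    using V(2) fin by (simp add: card_Diff_subset of_nat_diff card_mono)
  then have c: "real (card (V - (S \<union> T))) = real (card V) - (real (card S) + card T - card (S \<inter> T))"
    using un by simp
  have "card V * real (card (V - (S \<union> T)))
      = real (card V) * card V - card V * real (card S) - card V * real (card T) + real (card V * card (S \<inter> T))"
    unfolding c by (simp add: algebra_simps)
  moreover have "real (card S * card T) \<le> real (card V * card (S \<inter> T))"
    using card_inter_subspaces[OF S T V] by (simp only: of_nat_le_iff)
  ultimately show ?thesis by (simp add: algebra_simps)
qed


section \<open>A common transversal\<close>

definition transversal :: "'a::zero vec set \<Rightarrow> 'a vec set \<Rightarrow> bool" where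
  "transversal x E \<longleftrightarrow> x \<inter> E = {0}"

text \<open>
  Build \<open>E\<close> one dimension at a time. Adding a vector \<open>v\<close> to \<open>E\<close> keeps \<open>x\<close> and \<open>y\<close> transversal if
  \<open>v\<close> lies in neither of \<open>x + E\<close> and \<open>y + E\<close>. By \<open>card_avoiding_two_subspaces\<close> every pair is kept
  by at least a proportion \<open>(1 - q ^ (k + i) / q ^ n)\<^sup>2\<close> of all vectors, so some \<open>v\<close>
  keeps this proportion of all pairs. It is essential that one \<open>E\<close> serves both families.
\<close>

lemma transversal_exists:
  fixes U W :: "'a::{field,finite} vec set set"
  assumes U: "U \<subseteq> layer n k"
    and W: "W \<subseteq> layer n l"
    and lk: "l \<le> k" and "k + i \<le> n"
  shows "\<exists>E \<in> subspaces n. card E = CARD('a) ^ i \<and>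
    (\<Prod>a\<in>{k..<k + i}. 1 - real CARD('a) ^ a / real CARD('a) ^ n)\<^sup>2 * (card U * card W)
      \<le> card {x \<in> U. transversal x E} * card {y \<in> W. transversal y E}"
  using \<open>k + i \<le> n\<close>
proof (induction i)
  case 0
  have z: "{0} \<in> subspaces n" by (auto simp: subspaces_def coord_space_def seq_space.subspace_def seq_scale_def)
  have eqs: "{x \<in> U. transversal x {0}} = U" "{x \<in> W. transversal x {0}} = W"
    using U W seq_space.subspace_0 by (fastforce simp: subspaces_def transversal_def)+
  show ?case by (rule bexI[OF _ z]) (simp only: eqs, simp)
next
  case (Suc i)
  define q where "q = real CARD('a)"
  have q2: "2 \<le> q" using card_field_ge_2[where 'a = 'a] unfolding q_def by linarith
  define V where "V = (coord_space n :: 'a vec set)"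
  have V: "seq_space.subspace V" "finite V" and cardV: "real (card V) = q ^ n"
    by (auto simp: V_def subspace_coord_space finite_coord_space card_coord_space q_def)
  obtain E where E: "E \<in> subspaces n" "card E = CARD('a) ^ i" and
    le: "(\<Prod>a\<in>{k..<k + i}. 1 - q ^ a / q ^ n)\<^sup>2 * (card U * card W)
      \<le> card {x \<in> U. transversal x E} * card {y \<in> W. transversal y E}"
    using Suc unfolding q_def by auto
  have subE: "seq_space.subspace E" and EV: "E \<subseteq> V" using E(1) by (auto simp: subspaces_def V_def)
  define ext where "ext v = {e + seq_scale a v | e a. e \<in> E}" for v
  have ext_sub: "ext v \<in> subspaces n" if "v \<in> V" for v
  proof -
    have "ext v = {e + z | e z. e \<in> E \<and> z \<in> seq_space.span {v}}"
      unfolding ext_def seq_space.span_singleton by auto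
    then have "seq_space.subspace (ext v)"
      using seq_space.subspace_sums[OF subE seq_space.subspace_span] by simp
    moreover have "ext v \<subseteq> V"
      using EV that by (auto simp: ext_def intro!: seq_space.subspace_add[OF V(1)] seq_space.subspace_scale[OF V(1)])
    ultimately show ?thesis by (simp add: subspaces_def V_def)
  qed
  have ext_card: "card (ext v) = CARD('a) ^ Suc i" if "v \<notin> E" for v
  proof -
    have "inj_on (\<lambda>(e, a). e + seq_scale a v) (E \<times> UNIV)"
    proof (rule inj_onI, clarify)
      fix e a e' a' assume e: "e \<in> E" "e' \<in> E" and eq: "e + seq_scale a v = e' + seq_scale a' v"
      have d: "seq_scale (a - a') v = e' - e"
        using eq by (simp add: seq_space.scale_left_diff_distrib algebra_simps)
      have "a = a'"
      proof (rule ccontr)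
        assume "a \<noteq> a'"
        then have "v = seq_scale (1 / (a - a')) (e' - e)" by (simp add: d[symmetric])
        then show False
          using that seq_space.subspace_scale[OF subE seq_space.subspace_diff[OF subE e(2,1)]] by auto
      qed
      then show "e = e' \<and> a = a'" using d by simp
    qed
    moreover have "ext v = (\<lambda>(e, a). e + seq_scale a v) ` (E \<times> UNIV)" by (auto simp: ext_def)
    ultimately show ?thesis by (simp add: card_image card_cartesian_product E(2))
  qed
  define add where "add x = {p + e | p e. p \<in> x \<and> e \<in> E}" for x
  have add_sub: "seq_space.subspace (add x)" "add x \<subseteq> V" "transversal x E \<Longrightarrow> card (add x) = card x * CARD('a) ^ i"
    if "x \<in> subspaces n" for x
  proof -
    have x: "seq_space.subspace x" "x \<subseteq> V" using that by (auto simp: subspaces_def V_def)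
    show "seq_space.subspace (add x)" unfolding add_def by (rule seq_space.subspace_sums[OF x(1) subE])
    show "add x \<subseteq> V" using subsetD[OF x(2)] subsetD[OF EV] seq_space.subspace_add[OF V(1)] by (auto simp: add_def)
    show "transversal x E \<Longrightarrow> card (add x) = card x * CARD('a) ^ i"
      unfolding add_def transversal_def by (simp add: card_sum_subspaces[OF x(1) subE] E(2))
  qed
  have meet: "transversal x (ext v)" if x: "x \<in> subspaces n" "transversal x E" and v: "v \<notin> add x" for x v
  proof -
    have sx: "seq_space.subspace x" using x by (simp add: subspaces_def)
    have "w = 0" if w: "w \<in> x" "w \<in> ext v" for w
    proof -
      obtain e a where ea: "e \<in> E" "w = e + seq_scale a v" using w(2) by (auto simp: ext_def)
      have "a = 0"
      proof (rule ccontr)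
        assume "a \<noteq> 0"
        then have "v = seq_scale (1 / a) w + seq_scale (- 1 / a) e"
          by (auto simp: ea(2) seq_scale_def fun_eq_iff field_simps)
        moreover have "seq_scale (1 / a) w \<in> x" "seq_scale (- 1 / a) e \<in> E"
          by (rule seq_space.subspace_scale[OF sx w(1)], rule seq_space.subspace_scale[OF subE ea(1)])
        ultimately show False using v unfolding add_def by blast
      qed
      then have "w = e" using ea(2) by simp
      then show ?thesis using ea(1) w(1) x(2) unfolding transversal_def by blast
    qed
    moreover have "0 \<in> x \<inter> ext v"
      using seq_space.subspace_0[OF sx] seq_space.subspace_0[of "ext v"] subE
      by (auto simp: ext_def intro!: exI[of _ 0] seq_space.subspace_0)
    ultimately show ?thesis unfolding transversal_def by blast
  qed
  define P where "P = {x \<in> U. transversal x E} \<times> {y \<in> W. transversal y E}"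
  have finUW: "finite U" "finite W"
    by (rule finite_subset[OF _ finite_subspaces[of n]]; use U W in auto)+
  have finP: "finite P" using finUW by (simp add: P_def)
  define c where "c = (1 - q ^ (k + i) / q ^ n)\<^sup>2"
  have lt: "q ^ (k + i) < q ^ n" using Suc.prems q2 by (intro power_strict_increasing) auto
  then have cpos: "c > 0" using q2 by (simp add: c_def)
  have good: "c * q ^ n \<le> real (card (V - (add x \<union> add y)))" if xy: "(x, y) \<in> P" for x y
  proof -
    have x: "x \<in> subspaces n" "transversal x E" "seq_space.dim x = k"
      and y: "y \<in> subspaces n" "transversal y E" "seq_space.dim y = l"
      using xy U W by (auto simp: P_def)
    have cx: "real (card (add x)) = q ^ (k + i)" and cy: "real (card (add y)) = q ^ (l + i)"
      using add_sub(3)[OF x(1,2)] add_sub(3)[OF y(1,2)] card_subspaces[OF x(1)] card_subspaces[OF y(1)] x(3) y(3)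
      by (simp_all add: q_def power_add)
    have "q ^ (l + i) \<le> q ^ (k + i)" using lk q2 by (intro power_increasing) auto
    then have "(q ^ n - q ^ (k + i)) * (q ^ n - q ^ (k + i)) \<le> (q ^ n - q ^ (k + i)) * (q ^ n - q ^ (l + i))"
      using lt by (intro mult_left_mono) auto
    also have "\<dots> \<le> q ^ n * real (card (V - (add x \<union> add y)))"
      using card_avoiding_two_subspaces[OF add_sub(1,2)[OF x(1)] add_sub(1,2)[OF y(1)] V]
      by (simp add: cx cy cardV)
    finally have "(q ^ n - q ^ (k + i))\<^sup>2 / q ^ n \<le> real (card (V - (add x \<union> add y)))"
      using q2 by (simp add: power2_eq_square field_simps)
    moreover have "(q ^ n - q ^ (k + i))\<^sup>2 / q ^ n = c * q ^ n"
      using q2 by (simp add: c_def power2_eq_square field_simps)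
    ultimately show ?thesis by simp
  qed
  have "\<exists>v\<in>V. v \<notin> E \<and> c * card P \<le> card {(x, y) \<in> P. v \<notin> add x \<and> v \<notin> add y}"
  proof (cases "P = {}")
    case True
    have "card E < card V"
      using Suc.prems q2 power_strict_increasing[of i n q] E(2) cardV
      by (simp add: q_def flip: of_nat_power)
    then have "\<exists>v\<in>V. v \<notin> E" using card_mono[OF _ subsetI, of E V] subspaces_finite[OF E(1)] by force
    then show ?thesis using True by auto
  next
    case False
    have V0: "V \<noteq> {}" using seq_space.subspace_0[OF V(1)] by auto
    let ?N = "\<lambda>v. real (card {(x, y) \<in> P. v \<notin> add x \<and> v \<notin> add y})"
    have "(\<Sum>v\<in>V. ?N v) = (\<Sum>v\<in>V. \<Sum>p\<in>P. if v \<notin> add (fst p) \<and> v \<notin> add (snd p) then 1 else 0)"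
      using finP by (intro sum.cong refl) (simp add: sum.If_cases Int_def case_prod_unfold)
    also have "\<dots> = (\<Sum>p\<in>P. \<Sum>v\<in>V. if v \<notin> add (fst p) \<and> v \<notin> add (snd p) then 1 else 0)"
      by (rule sum.swap)
    also have "\<dots> = (\<Sum>p\<in>P. real (card (V - (add (fst p) \<union> add (snd p)))))"
      using V(2) by (intro sum.cong refl) (simp add: sum.If_cases Int_def set_diff_eq)
    finally have tot: "(\<Sum>v\<in>V. ?N v) = (\<Sum>p\<in>P. real (card (V - (add (fst p) \<union> add (snd p)))))" .
    have "(\<Sum>p\<in>P. c * q ^ n) \<le> (\<Sum>v\<in>V. ?N v)" unfolding tot
      by (intro sum_mono) (use good in auto)
    then have ge: "(\<Sum>v\<in>V. c * card P) \<le> (\<Sum>v\<in>V. ?N v)" by (simp add: cardV mult_ac)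
    have "\<exists>v\<in>V. c * card P \<le> ?N v"
    proof (rule ccontr)
      assume "\<not> (\<exists>v\<in>V. c * card P \<le> ?N v)"
      then have "\<forall>v\<in>V. ?N v < c * card P" by (simp only: not_le bex_simps ball_simps)
      then have "(\<Sum>v\<in>V. ?N v) < (\<Sum>v\<in>V. c * card P)" using V(2) V0 by (intro sum_strict_mono) blast+
      then show False using ge by linarith
    qed
    then obtain v where v: "v \<in> V" "c * card P \<le> ?N v" by blast
    have "0 < c * card P" using cpos False finP by (simp add: card_gt_0_iff)
    then have "0 < ?N v" using v(2) by linarith
    then have "card {(x, y) \<in> P. v \<notin> add x \<and> v \<notin> add y} > 0" by simp
    then have "{(x, y) \<in> P. v \<notin> add x \<and> v \<notin> add y} \<noteq> {}" unfolding card_gt_0_iff by (rule conjunct1)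
    then obtain x y where xy: "(x, y) \<in> P" "v \<notin> add x" by blast
    have "0 \<in> x" using xy(1) U seq_space.subspace_0 by (auto simp: P_def subspaces_def)
    then have "E \<subseteq> add x" unfolding add_def by force
    then have "v \<notin> E" using xy(2) by auto
    then show ?thesis using v by blast
  qed
  then obtain v where v: "v \<in> V" "v \<notin> E" "c * card P \<le> card {(x, y) \<in> P. v \<notin> add x \<and> v \<notin> add y}" by blast
  have "{(x, y) \<in> P. v \<notin> add x \<and> v \<notin> add y} \<subseteq> {x \<in> U. transversal x (ext v)} \<times> {y \<in> W. transversal y (ext v)}"
    using U W by (auto simp: P_def meet)
  from card_mono[OF _ this] have "card {(x, y) \<in> P. v \<notin> add x \<and> v \<notin> add y}
      \<le> card {x \<in> U. transversal x (ext v)} * card {y \<in> W. transversal y (ext v)}"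
    using finUW by (simp add: card_cartesian_product)
  then have "c * card P \<le> card {x \<in> U. transversal x (ext v)} * card {y \<in> W. transversal y (ext v)}"
    using v(3) by linarith
  moreover have "(\<Prod>a\<in>{k..<k + Suc i}. 1 - q ^ a / q ^ n)\<^sup>2 * (card U * card W) \<le> c * card P"
  proof -
    have "(\<Prod>a\<in>{k..<k + Suc i}. 1 - q ^ a / q ^ n) = (\<Prod>a\<in>{k..<k + i}. 1 - q ^ a / q ^ n) * (1 - q ^ (k + i) / q ^ n)"
      by simp
    then have "(\<Prod>a\<in>{k..<k + Suc i}. 1 - q ^ a / q ^ n)\<^sup>2 * (card U * card W)
        = c * ((\<Prod>a\<in>{k..<k + i}. 1 - q ^ a / q ^ n)\<^sup>2 * (card U * card W))"
      by (simp only: power_mult_distrib c_def mult_ac)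
    also have "\<dots> \<le> c * card P"
      using le cpos by (intro mult_left_mono) (auto simp: P_def card_cartesian_product)
    finally show ?thesis .
  qed
  ultimately show ?case
    using ext_sub[OF v(1)] ext_card[OF v(2)] unfolding q_def by (intro bexI[of _ "ext v"]) auto
qed

section \<open>Cross-intersecting layers\<close>

lemma complement_decomposition:
  fixes x E :: "'a::{field,finite} vec set"
  assumes x: "x \<in> subspaces n" and E: "E \<in> subspaces n" and tr: "transversal x E"
    and dims: "seq_space.dim x + seq_space.dim E = n" and z: "z \<in> coord_space n"
  shows "\<exists>p\<in>x. \<exists>e\<in>E. z = p + e"
proof -
  have sub: "seq_space.subspace x" "seq_space.subspace E" "x \<subseteq> coord_space n" "E \<subseteq> coord_space n"
    using x E by (auto simp: subspaces_def)
  let ?S = "{p + e | p e. p \<in> x \<and> e \<in> E}"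
  have "?S \<subseteq> coord_space n"
    using subsetD[OF sub(3)] subsetD[OF sub(4)] seq_space.subspace_add[OF subspace_coord_space] by blast
  moreover have "card ?S = card (coord_space n :: 'a vec set)"
    using card_sum_subspaces[OF sub(1,2)] tr
    by (simp add: transversal_def card_subspaces[OF x] card_subspaces[OF E] card_coord_space dims flip: power_add)
  ultimately have "?S = coord_space n" by (intro card_subset_eq finite_coord_space)
  then show ?thesis using z by blast
qed

lemma lspan_coefficients:
  "z \<in> lspan {..<m} v \<Longrightarrow> \<exists>c\<in>coord_space m. z = lc {..<m} c v"
  by (auto simp: lspan_def coord_space_tuples)

definition bases :: "nat \<Rightarrow> 'a::field vec set \<Rightarrow> 'a matrix set" where
  "bases l y = {r \<in> tuples {..<l} y. indep {..<l} r}"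

lemma lspan_bases:
  fixes y :: "'a::{field,finite} vec set"
  assumes y: "y \<in> subspaces n" and r: "r \<in> bases (seq_space.dim y) y"
  shows "lspan {..<seq_space.dim y} r = y"
proof (rule card_subset_eq)
  show "finite y" using subspaces_finite[OF y] .
  show "lspan {..<seq_space.dim y} r \<subseteq> y"
    using r y by (intro lspan_subset) (auto simp: bases_def tuples_def subspaces_def)
  show "card (lspan {..<seq_space.dim y} r) = card y"
    using r card_subspaces[OF y] by (simp add: bases_def card_lspan)
qed

text \<open>
  An \<open>l\<close>-dimensional space has \<open>\<Prod>i<l. q ^ l - q ^ i\<close> ordered bases, at least a quarter of
  all its \<open>l\<close>-tuples, and different spaces have different bases.
\<close>

lemma card_bases_ge:
  fixes W :: "'a::{field,finite} vec set set"
  assumes W: "W \<subseteq> layer n l"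
  shows "card W * real CARD('a) ^ (l * l) \<le> 4 * real (card (\<Union>y\<in>W. bases l y))"
proof -
  have q: "2 \<le> real CARD('a)" using card_field_ge_2[where 'a = 'a] by linarith
  have finW: "finite W" by (rule finite_subset[OF _ finite_subspaces[of n]]) (use W in auto)
  have W': "seq_space.subspace y" "y \<in> subspaces n" "seq_space.dim y = l" "finite y" if "y \<in> W" for y
    using that W subspaces_finite[of y n] by (auto simp: subspaces_def)
  have fin: "finite (bases l y)" if "y \<in> W" for y
    unfolding bases_def
    by (rule finite_subset[OF _ finite_tuples[OF finite_lessThan W'(4)[OF that]]]) auto
  have ge: "real CARD('a) ^ (l * l) / 4 \<le> real (card (bases l y))" if y: "y \<in> W" for y
  proof -
    have "real (card (bases l y)) = (\<Prod>i<l. real CARD('a) ^ l - real CARD('a) ^ i)"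
      unfolding bases_def using card_indep_tuples[OF W'(1,4)[OF y], of "{..<l}"]
      by (simp add: card_subspaces[OF W'(2)[OF y]] W'(3)[OF y])
    then show ?thesis
      using prod_diff_powers_ge[OF q order_refl, of l 0] by (simp add: atLeast0LessThan power_mult)
  qed
  have "card (\<Union>y\<in>W. bases l y) = (\<Sum>y\<in>W. card (bases l y))"
  proof (rule card_UN_disjoint)
    show "\<forall>y\<in>W. \<forall>y'\<in>W. y \<noteq> y' \<longrightarrow> bases l y \<inter> bases l y' = {}"
    proof (intro ballI impI equals0I)
      fix y y' r assume y: "y \<in> W" "y' \<in> W" "y \<noteq> y'" "r \<in> bases l y \<inter> bases l y'"
      then show False using lspan_bases[OF W'(2), of y r] lspan_bases[OF W'(2), of y' r] W'(3) by auto
    qed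
  qed (use finW fin in auto)
  moreover have "(\<Sum>y\<in>W. real CARD('a) ^ (l * l) / 4) \<le> (\<Sum>y\<in>W. real (card (bases l y)))"
    by (intro sum_mono ge)
  ultimately show ?thesis by simp
qed

text \<open>
  With a basis \<open>u\<close> of one member of \<open>U\<close> and a basis \<open>v\<close> of \<open>E\<close>, the members of \<open>U\<close> are graphs of
  maps from the span of \<open>u\<close> to \<open>E\<close>, that is, matrices \<open>A\<close>. All ordered bases of members of \<open>W\<close>
  are written in coordinates as \<open>(C, D)\<close>. If columns could be appended to \<open>D - C A\<close>, fewer than
  \<open>t\<close> of them, such that the rows become independent, these columns would give an injective linear
  map from \<open>x \<inter> y\<close> to a space of dimension less than \<open>t\<close>.
\<close>

theorem transversal_pairs_bound:
  assumes t: "1 \<le> t"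
  shows "\<exists>K>0. \<forall>n k l (U :: 'a::{field,finite} vec set set) W E.
    t \<le> l \<longrightarrow> l \<le> k \<longrightarrow> k + l \<le> n \<longrightarrow> E \<in> subspaces n \<longrightarrow> seq_space.dim E = n - k \<longrightarrow>
    U \<subseteq> {x \<in> subspaces n. seq_space.dim x = k \<and> transversal x E} \<longrightarrow>
    W \<subseteq> {y \<in> subspaces n. seq_space.dim y = l \<and> transversal y E} \<longrightarrow>
    cross_intersecting t U W \<longrightarrow>
    real (card U) * real (card W) * real CARD('a) ^ (t * (2 * n - k - l))
      \<le> K * real n * real CARD('a) ^ (k * (n - k) + l * (n - l))"
proof -
  obtain \<psi> :: "'a \<Rightarrow> complex" where "additive_character \<psi>"
    using exists_nontrivial_character[where 'a = 'a] by (auto simp: additive_character_def)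
  then interpret additive_character \<psi> .
  define q where "q = real CARD('a)"
  have q: "2 \<le> q" using card_field_ge_2[where 'a = 'a] unfolding q_def by linarith
  obtain K where K: "K > 0" and bound: "\<And>k l m (\<A> :: 'a matrix set) W. t \<le> l \<Longrightarrow> l \<le> k \<Longrightarrow> l \<le> m \<Longrightarrow>
    \<A> \<subseteq> mat k m \<Longrightarrow> W \<subseteq> {C \<in> mat l k. indep {..<l} C} \<times> mat l m \<Longrightarrow>
    (\<forall>A\<in>\<A>. \<forall>(C, D)\<in>W. inextensible t l m (D - mprod k C A)) \<Longrightarrow>
    real (card W) * real (card \<A>) * q ^ (t * (2 * m + k - l))
      \<le> K * real l * q ^ (k * m + k * l + l * m)"
    using card_matrix_pairs_bound[OF t] unfolding q_def by auto
  have "real (card U) * real (card W) * q ^ (t * (2 * n - k - l))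
      \<le> 4 * K * real n * q ^ (k * (n - k) + l * (n - l))"
    if l: "t \<le> l" "l \<le> k" "k + l \<le> n" and E: "E \<in> subspaces n" "seq_space.dim E = n - k"
      and U: "U \<subseteq> {x \<in> subspaces n. seq_space.dim x = k \<and> transversal x E}"
      and W: "W \<subseteq> {y \<in> subspaces n. seq_space.dim y = l \<and> transversal y E}"
      and cross: "cross_intersecting t U W"
    for n k l E and U W :: "'a vec set set"
  proof (cases "U = {}")
    case True
    then show ?thesis using q K by simp
  next
    case False
    define m where "m = n - k"
    have n: "n = k + m" and lm: "l \<le> m" using l by (auto simp: m_def)
    define V where "V = (coord_space n :: 'a vec set)"
    have subE: "seq_space.subspace E" and dimE: "seq_space.dim E = m"
      using E by (auto simp: subspaces_def m_def)
    obtain v where v: "indep {..<m} v" "E = lspan {..<m} v" using subspaces_basis[OF E(1)] dimE by auto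
    obtain x0 where "x0 \<in> U" using False by auto
    then have x0: "x0 \<in> subspaces n" "seq_space.dim x0 = k" "transversal x0 E" using U by auto
    obtain u where u: "indep {..<k} u" "x0 = lspan {..<k} u" using subspaces_basis[OF x0(1)] x0(2) by auto
    have U': "seq_space.subspace x" "x \<subseteq> V" "transversal x E" "x \<in> subspaces n" "seq_space.dim x = k" if "x \<in> U" for x
      using that U by (auto simp: subspaces_def V_def)
    have W': "seq_space.subspace y" "y \<subseteq> V" "transversal y E" "y \<in> subspaces n" "seq_space.dim y = l" if "y \<in> W" for y
      using that W by (auto simp: subspaces_def V_def)
    have meet0: "z = 0" if "z \<in> x" "z \<in> E" "transversal x E" for x z
      using that by (auto simp: transversal_def)
    have lcv: "lc {..<m} d v \<in> E" for d using v(2) lc_in_lspan by metis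
    have coords: "\<exists>c d. c \<in> coord_space k \<and> d \<in> coord_space m \<and> z = lc {..<k} c u + lc {..<m} d v" if zV: "z \<in> V" for z
    proof -
      obtain p e where "p \<in> x0" "e \<in> E" "z = p + e"
        using complement_decomposition[OF x0(1) E(1) x0(3), of z] zV
        unfolding V_def x0(2) dimE n[symmetric] by blast
      then show ?thesis using lspan_coefficients[of p k u] lspan_coefficients[of e m v] u(2) v(2) by blast
    qed
    then obtain cK cE where cK: "\<And>z. z \<in> V \<Longrightarrow> cK z \<in> coord_space k" and cE: "\<And>z. z \<in> V \<Longrightarrow> cE z \<in> coord_space m"
      and c_eq: "\<And>z. z \<in> V \<Longrightarrow> z = lc {..<k} (cK z) u + lc {..<m} (cE z) v" by metis
    \<comment> \<open>The members of \<open>U\<close> as graphs: row \<open>i\<close> of \<open>gr x\<close> moves \<open>u i\<close> along \<open>E\<close> into \<open>x\<close>.\<close>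
    have graph_ex: "\<exists>A\<in>mat k m. \<forall>i<k. u i + lc {..<m} (A i) v \<in> x" if x: "x \<in> U" for x
    proof -
      have "\<exists>a\<in>coord_space m. u i + lc {..<m} a v \<in> x" if i: "i < k" for i
      proof -
        have "u i \<in> V" using in_lspan[of "{..<k}" i u] i u(2) x0(1) by (auto simp: subspaces_def V_def)
        then obtain p e where pe: "p \<in> x" "e \<in> E" "u i = p + e"
          using complement_decomposition[OF U'(4)[OF x] E(1) U'(3)[OF x], of "u i"]
          unfolding V_def U'(5)[OF x] dimE n[symmetric] by blast
        have "- e \<in> E" by (rule seq_space.subspace_neg[OF subE pe(2)])
        then obtain a where a: "a \<in> coord_space m" "- e = lc {..<m} a v" using lspan_coefficients v(2) by blast
        have "u i + lc {..<m} a v = p" unfolding a(2)[symmetric] pe(3) by simp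
        then show ?thesis using pe(1) a(1) by auto
      qed
      then obtain A where A: "\<And>i. i < k \<Longrightarrow> A i \<in> coord_space m" "\<And>i. i < k \<Longrightarrow> u i + lc {..<m} (A i) v \<in> x" by metis
      define A' where "A' = (\<lambda>i. if i < k then A i else 0)"
      have "A' \<in> mat k m" using A(1) by (auto simp: A'_def mat_def tuples_def)
      then show ?thesis using A(2) by (intro bexI[of _ A']) (auto simp: A'_def)
    qed
    then obtain gr where gr: "\<And>x. x \<in> U \<Longrightarrow> gr x \<in> mat k m"
      "\<And>x i. x \<in> U \<Longrightarrow> i < k \<Longrightarrow> u i + lc {..<m} (gr x i) v \<in> x" by metis
    have gr_lc: "lc {..<k} c u + lc {..<m} (lc {..<k} c (gr x)) v \<in> x" if "x \<in> U" for x c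
    proof -
      have "lc {..<k} c (\<lambda>i. u i + lc {..<m} (gr x i) v) \<in> x"
        using gr(2)[OF that] by (intro lc_in_subspace U'(1)[OF that]) auto
      then show ?thesis by (simp add: lc_add_right lc_lc)
    qed
    have gr_eq: "w = lc {..<k} c u + lc {..<m} (lc {..<k} c (gr x)) v"
      if x: "x \<in> U" and w: "w \<in> x" "w = lc {..<k} c u + lc {..<m} d v" for x w c d
    proof -
      have "w - (lc {..<k} c u + lc {..<m} (lc {..<k} c (gr x)) v) \<in> x"
        by (intro seq_space.subspace_diff U'(1)[OF x] w(1) gr_lc[OF x])
      moreover have "w - (lc {..<k} c u + lc {..<m} (lc {..<k} c (gr x)) v) \<in> E"
        unfolding w(2) using seq_space.subspace_diff[OF subE lcv lcv] by simp
      ultimately have "w - (lc {..<k} c u + lc {..<m} (lc {..<k} c (gr x)) v) = 0"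
        using meet0 U'(3)[OF x] by blast
      then show ?thesis by simp
    qed
    have inj_gr: "inj_on gr U"
    proof (rule inj_onI)
      fix x x' assume x: "x \<in> U" "x' \<in> U" and eq: "gr x = gr x'"
      have "x1 \<subseteq> x2" if "x1 \<in> U" "x2 \<in> U" "gr x1 = gr x2" for x1 x2
      proof
        fix w assume w: "w \<in> x1"
        have "w \<in> V" using w U'(2)[OF that(1)] by auto
        from gr_eq[OF that(1) w c_eq[OF this]] gr_lc[OF that(2)] that(3) show "w \<in> x2" by metis
      qed
      then show "x = x'" using x eq by (metis subset_antisym)
    qed
    define \<A> where "\<A> = gr ` U"
    have cardA: "card \<A> = card U" by (simp add: \<A>_def card_image inj_gr)
    have A: "\<A> \<subseteq> mat k m" using gr(1) by (auto simp: \<A>_def)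
    \<comment> \<open>The ordered bases \<open>r\<close> of members of \<open>W\<close> as pairs \<open>co r\<close> of matrices.\<close>
    define R where "R = (bases l :: 'a vec set \<Rightarrow> 'a matrix set)"
    have R_iff: "r \<in> R y \<longleftrightarrow> r \<in> tuples {..<l} y \<and> indep {..<l} r" for y :: "'a vec set" and r
      by (simp add: R_def bases_def)
    have span_R: "lspan {..<l} r = y" if "y \<in> W" "r \<in> R y" for r y
      using lspan_bases[of y n r] W'[OF that(1)] that(2) by (simp add: R_def)
    define co where "co r = (\<lambda>j. if j < l then cK (r j) else 0, \<lambda>j. if j < l then cE (r j) else 0)" for r :: "'a matrix"
    have R_V: "r j \<in> V" if "y \<in> W" "r \<in> R y" "j < l" for y r j
      using that W'(2)[OF that(1)] by (auto simp: R_iff tuples_def)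
    have co_eq: "lc {..<l} e r = lc {..<k} (lc {..<l} e (fst (co r))) u + lc {..<m} (lc {..<l} e (snd (co r))) v"
      if "y \<in> W" "r \<in> R y" for y r e
    proof -
      have "lc {..<l} e r = lc {..<l} e (\<lambda>j. lc {..<k} (fst (co r) j) u + lc {..<m} (snd (co r) j) v)"
        using c_eq[OF R_V[OF that]] by (intro lc_cong) (auto simp: co_def)
      then show ?thesis by (simp add: lc_add_right lc_lc)
    qed
    define RW where "RW = (\<Union>y\<in>W. R y)"
    have card_RW: "card W * q ^ (l * l) \<le> 4 * real (card RW)"
      unfolding RW_def R_def q_def by (rule card_bases_ge[of W n]) (use W in auto)
    have inj_co: "inj_on co RW"
    proof (rule inj_onI)
      fix r r' assume r: "r \<in> RW" "r' \<in> RW" and eq: "co r = co r'"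
      obtain y y' where y: "y \<in> W" "r \<in> R y" "y' \<in> W" "r' \<in> R y'" using r by (auto simp: RW_def)
      have "r j = r' j" for j
      proof (cases "j < l")
        case True
        then have "cK (r j) = cK (r' j)" "cE (r j) = cE (r' j)"
          using eq by (auto simp: co_def fun_eq_iff dest: spec[of _ j])
        then show ?thesis using c_eq[OF R_V[OF y(1,2) True]] c_eq[OF R_V[OF y(3,4) True]] by simp
      qed (use y in \<open>auto simp: R_iff tuples_def\<close>)
      then show "r = r'" by auto
    qed
    have co_W: "co ` RW \<subseteq> {C \<in> mat l k. indep {..<l} C} \<times> mat l m"
    proof
      fix p assume "p \<in> co ` RW"
      then obtain r y where y: "y \<in> W" "r \<in> R y" "p = co r" by (auto simp: RW_def)
      have "fst (co r) \<in> mat l k" "snd (co r) \<in> mat l m"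
        using cK[OF R_V[OF y(1,2)]] cE[OF R_V[OF y(1,2)]] by (auto simp: mat_def co_def tuples_def)
      moreover have "indep {..<l} (fst (co r))"
        unfolding indep_def
      proof (intro allI impI ballI)
        fix e j assume e: "lc {..<l} e (fst (co r)) = 0" and j: "j \<in> {..<l}"
        have "lc {..<k} (0 :: 'a vec) u = 0" by (auto simp: fun_eq_iff lc_apply)
        then have "lc {..<l} e r \<in> E" using co_eq[OF y(1,2), of e] e lcv by simp
        moreover have "lc {..<l} e r \<in> y" using span_R[OF y(1,2)] lc_in_lspan by metis
        ultimately have "lc {..<l} e r = 0" using meet0 W'(3)[OF y(1)] by blast
        then show "e j = 0" using y(2) j by (auto simp: R_iff dest: indepD)
      qed
      ultimately show "p \<in> {C \<in> mat l k. indep {..<l} C} \<times> mat l m" using y(3) by (simp add: mem_Times_iff)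
    qed
    have dep: "\<not> indep {..<l} s"
      if x: "x \<in> U" and y: "y \<in> W" "r \<in> R y" and j: "j < t" and s: "s \<in> mat l (m + j)"
        and tr: "trunc m s = snd (co r) - mprod k (fst (co r)) (gr x)" for x y r j s
    proof
      assume ind: "indep {..<l} s"
      have sub_xy: "x \<inter> y \<in> subspaces n"
        using U'(1,2)[OF x] W'(1,2)[OF y(1)] seq_space.subspace_inter[of x y] by (auto simp: subspaces_def V_def)
      have "t \<le> seq_space.dim (x \<inter> y)" using cross x y(1) by (auto simp: cross_intersecting_def)
      then have big: "CARD('a) ^ t \<le> card (x \<inter> y)"
        unfolding card_subspaces[OF sub_xy] by (intro power_increasing) auto
      let ?S = "{e \<in> tuples {..<l} UNIV. lc {..<l} e r \<in> x} :: 'a vec set"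
      have "x \<inter> y \<subseteq> (\<lambda>e. lc {..<l} e r) ` ?S"
        using span_R[OF y] by (auto simp: lspan_def)
      then have "card (x \<inter> y) \<le> card ?S"
        by (rule surj_card_le[rotated]) (auto intro: finite_subset[OF _ finite_tuples[of "{..<l}" UNIV]])
      moreover have "card ?S \<le> card (tuples {m..<m + j} (UNIV :: 'a set))"
      proof (rule card_inj_on_le)
        show "inj_on (\<lambda>e. lc {..<l} e s) ?S" by (rule inj_on_subset[OF inj_on_lc[OF ind]]) auto
        show "finite (tuples {m..<m + j} (UNIV :: 'a set))" by (intro finite_tuples) auto
        show "(\<lambda>e. lc {..<l} e s) ` ?S \<subseteq> tuples {m..<m + j} UNIV"
        proof clarify
          fix e assume e: "lc {..<l} e r \<in> x"
          let ?c = "lc {..<l} e (fst (co r))"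
          have "lc {..<l} e r = lc {..<k} ?c u + lc {..<m} (lc {..<k} ?c (gr x)) v"
            by (rule gr_eq[OF x e co_eq[OF y]])
          then have "lc {..<m} (lc {..<l} e (snd (co r))) v = lc {..<m} (lc {..<k} ?c (gr x)) v"
            using co_eq[OF y, of e] by simp
          then have "lc {..<l} e (snd (co r)) i = lc {..<k} ?c (gr x) i" if "i < m" for i
            using indep_unique[OF v(1)] that by blast
          moreover have "lc {..<k} ?c (gr x) = lc {..<l} e (mprod k (fst (co r)) (gr x))"
            unfolding mprod_def by (rule lc_lc[symmetric])
          moreover have "lc {..<l} e (trunc m s) = lc {..<l} e (snd (co r)) - lc {..<l} e (mprod k (fst (co r)) (gr x))"
            unfolding tr lc_diff_right[symmetric] by (simp add: lc_def fun_diff_def minus_apply)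
          ultimately have "lc {..<l} e (trunc m s) i = 0" if "i < m" for i using that by simp
          then have low: "lc {..<l} e s i = 0" if "i < m" for i
            using that by (simp add: lc_apply trunc_def)
          have "lc {..<l} e s i = 0" if "m + j \<le> i" for i
            using s that by (simp add: lc_apply mat_iff)
          then show "lc {..<l} e s \<in> tuples {m..<m + j} UNIV" using low by (auto simp: tuples_def not_le)
        qed
      qed
      moreover have "card (tuples {m..<m + j} (UNIV :: 'a set)) = CARD('a) ^ j" by (simp add: card_tuples)
      ultimately have "CARD('a) ^ t \<le> CARD('a) ^ j" using big by linarith
      moreover have "CARD('a) ^ j < CARD('a) ^ t"
        using j card_field_ge_2[where 'a = 'a] by (intro power_strict_increasing) auto
      ultimately show False by simp
    qed
    have "real (card (co ` RW)) * real (card \<A>) * q ^ (t * (2 * m + k - l)) \<le> K * real l * q ^ (k * m + k * l + l * m)"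
    proof (rule bound[OF l(1,2) lm A co_W], intro ballI)
      fix A p assume "A \<in> \<A>" "p \<in> co ` RW"
      then obtain x y r where x: "x \<in> U" "A = gr x" and y: "y \<in> W" "r \<in> R y" "p = co r"
        by (auto simp: \<A>_def RW_def)
      show "case p of (C, D) \<Rightarrow> inextensible t l m (D - mprod k C A)"
        using dep[OF x(1) y(1,2)] unfolding x(2) y(3) case_prod_unfold by blast
    qed
    then have main: "real (card RW) * real (card U) * q ^ (t * (2 * n - k - l)) \<le> K * real l * q ^ (k * m + l * n)"
      using l by (simp add: card_image[OF inj_co] cardA n algebra_simps)
    have "(real (card U) * real (card W) * q ^ (t * (2 * n - k - l))) * q ^ (l * l)
        = (real (card W) * q ^ (l * l)) * (real (card U) * q ^ (t * (2 * n - k - l)))"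
      by (simp add: mult_ac)
    also have "\<dots> \<le> 4 * real (card RW) * (real (card U) * q ^ (t * (2 * n - k - l)))"
      using q by (intro mult_right_mono card_RW) auto
    also have "\<dots> \<le> 4 * (K * real l * q ^ (k * m + l * n))" using main by simp
    also have "\<dots> \<le> 4 * (K * real n * q ^ (k * m + l * n))"
      using q K l by (intro mult_left_mono mult_right_mono) auto
    also have "k * m + l * n = (k * (n - k) + l * (n - l)) + l * l"
    proof -
      have "l * n = l * (n - l) + l * l" using l by (simp add: add_mult_distrib2[symmetric])
      then show ?thesis by (simp add: m_def)
    qed
    finally show ?thesis using q by (simp add: power_add)
  qed
  moreover have "4 * K > 0" using K by simp
  ultimately show ?thesis unfolding q_def by (intro exI[of _ "4 * K"]) blast
qed

lemma cross_intersecting_commute: "cross_intersecting t U W \<longleftrightarrow> cross_intersecting t W U"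
  unfolding cross_intersecting_def by (subst Int_commute) blast

text \<open>
  For \<open>l \<le> k\<close>, restrict both families to the members transversal to a common \<open>E\<close>; at least a
  sixteenth of the pairs remains, and \<open>transversal_pairs_bound\<close> applies. The case \<open>k < l\<close> is
  symmetric. If \<open>l < t\<close>, one of the families is empty.
\<close>

theorem layer_bound:
  assumes t: "1 \<le> t"
  shows "\<exists>K>0. \<forall>n k l (U :: 'a::{field,finite} vec set set) W. k + l \<le> n \<longrightarrow>
    U \<subseteq> layer n k \<longrightarrow>
    W \<subseteq> layer n l \<longrightarrow>
    cross_intersecting t U W \<longrightarrow>
    real (card U) * real (card W) * real CARD('a) ^ (t * (2 * n - k - l))
      \<le> K * real n * real CARD('a) ^ (k * (n - k) + l * (n - l))"
proof -
  define q where "q = real CARD('a)"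
  have q: "2 \<le> q" using card_field_ge_2[where 'a = 'a] unfolding q_def by linarith
  obtain K where K: "K > 0" and bound: "\<And>n k l (U :: 'a vec set set) W E.
    t \<le> l \<Longrightarrow> l \<le> k \<Longrightarrow> k + l \<le> n \<Longrightarrow> E \<in> subspaces n \<Longrightarrow> seq_space.dim E = n - k \<Longrightarrow>
    U \<subseteq> {x \<in> subspaces n. seq_space.dim x = k \<and> transversal x E} \<Longrightarrow>
    W \<subseteq> {y \<in> subspaces n. seq_space.dim y = l \<and> transversal y E} \<Longrightarrow>
    cross_intersecting t U W \<Longrightarrow>
    real (card U) * real (card W) * q ^ (t * (2 * n - k - l))
      \<le> K * real n * q ^ (k * (n - k) + l * (n - l))"
    using transversal_pairs_bound[OF t, where 'a = 'a] unfolding q_def by blast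
  have ordered: "real (card U) * real (card W) * q ^ (t * (2 * n - k - l))
      \<le> 16 * K * real n * q ^ (k * (n - k) + l * (n - l))"
    if l: "l \<le> k" "k + l \<le> n"
      and U: "U \<subseteq> layer n k"
      and W: "W \<subseteq> layer n l"
      and cross: "cross_intersecting t U W" for n k l and U W :: "'a vec set set"
  proof (cases "t \<le> l")
    case False
    have "U = {} \<or> W = {}"
    proof (rule ccontr)
      assume "\<not> (U = {} \<or> W = {})"
      then obtain x y where xy: "x \<in> U" "y \<in> W" by auto
      have y: "y \<in> subspaces n" "seq_space.dim y = l" "x \<in> subspaces n" using xy U W by auto
      have "x \<inter> y \<in> subspaces n" using y seq_space.subspace_inter[of x y] by (auto simp: subspaces_def)
      from card_subspaces[OF this] have "card (x \<inter> y) = CARD('a) ^ seq_space.dim (x \<inter> y)" .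
      moreover have "card (x \<inter> y) \<le> card y" by (intro card_mono subspaces_finite[OF y(1)]) auto
      moreover have "card y < CARD('a) ^ t"
        unfolding card_subspaces[OF y(1)] y(2) using False card_field_ge_2[where 'a = 'a]
        by (intro power_strict_increasing) auto
      moreover have "CARD('a) ^ t \<le> CARD('a) ^ seq_space.dim (x \<inter> y)"
        using cross xy by (intro power_increasing) (auto simp: cross_intersecting_def)
      ultimately show False by linarith
    qed
    then have 0: "real (card U) * real (card W) = 0" by auto
    show ?thesis unfolding 0 using q K by simp
  next
    case True
    have kn: "k + (n - k) = n" using l by simp
    obtain E where E: "E \<in> subspaces n" "card E = CARD('a) ^ (n - k)"
      and le: "(\<Prod>a\<in>{k..<k + (n - k)}. 1 - q ^ a / q ^ n)\<^sup>2 * (card U * card W)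
        \<le> card {x \<in> U. transversal x E} * card {y \<in> W. transversal y E}"
      using transversal_exists[OF U W l(1), of "n - k"] kn unfolding q_def by auto
    have dimE: "seq_space.dim E = n - k"
      using E(2) card_subspaces[OF E(1)] card_field_ge_2[where 'a = 'a] by (simp add: power_inject_exp)
    have "1 / 4 \<le> (\<Prod>a\<in>{k..<n}. 1 - q ^ a / q ^ n)"
      by (rule prod_one_minus_interval_ge_quarter[OF q order_refl])
    from power_mono[OF this, of 2] have "1 / 16 \<le> (\<Prod>a\<in>{k..<n}. 1 - q ^ a / q ^ n)\<^sup>2"
      by (simp add: power2_eq_square)
    from mult_right_mono[OF this, of "card U * card W"]
    have many: "real (card U) * real (card W) \<le> 16 * (real (card {x \<in> U. transversal x E}) * real (card {y \<in> W. transversal y E}))"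
      using le unfolding kn by simp
    have "real (card {x \<in> U. transversal x E}) * real (card {y \<in> W. transversal y E}) * q ^ (t * (2 * n - k - l))
        \<le> K * real n * q ^ (k * (n - k) + l * (n - l))"
      by (rule bound[OF True l E(1) dimE]) (use U W cross in \<open>auto simp: cross_intersecting_def\<close>)
    moreover have "real (card U) * real (card W) * q ^ (t * (2 * n - k - l))
        \<le> 16 * (real (card {x \<in> U. transversal x E}) * real (card {y \<in> W. transversal y E})) * q ^ (t * (2 * n - k - l))"
      using q by (intro mult_right_mono many) auto
    ultimately show ?thesis by linarith
  qed
  have "real (card U) * real (card W) * q ^ (t * (2 * n - k - l))
      \<le> 16 * K * real n * q ^ (k * (n - k) + l * (n - l))"
    if l: "k + l \<le> n"
      and U: "U \<subseteq> layer n k"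
      and W: "W \<subseteq> layer n l"
      and cross: "cross_intersecting t U W" for n k l and U W :: "'a vec set set"
  proof (cases "l \<le> k")
    case True
    then show ?thesis using ordered that by blast
  next
    case False
    have "2 * n - l - k = 2 * n - k - l" by simp
    then show ?thesis
      using ordered[of k l n W U] False l U W cross
      by (simp add: cross_intersecting_commute add.commute mult.commute)
  qed
  moreover have "16 * K > 0" using K by simp
  ultimately show ?thesis unfolding q_def by blast
qed

lemma layer_card_le:
  fixes U :: "'a::{field,finite} vec set set"
  assumes U: "U \<subseteq> layer n k" and k: "k \<le> n"
  shows "real (card U) \<le> 4 * real CARD('a) ^ (k * (n - k))"
proof -
  let ?q = "real CARD('a)"
  have q0: "?q > 0" by simp
  have "(\<Union>y\<in>U. bases k y) \<subseteq> mat k n"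
    using U unfolding bases_def mat_def tuples_def subspaces_def by auto blast
  from card_mono[OF finite_mat this] have "real (card (\<Union>y\<in>U. bases k y)) \<le> ?q ^ (k * n)"
    unfolding card_mat by (metis of_nat_le_iff of_nat_power)
  then have "card U * ?q ^ (k * k) \<le> 4 * ?q ^ (k * n)"
    using card_bases_ge[OF U] by linarith
  also have "k * n = k * (n - k) + k * k" using k by (simp add: add_mult_distrib2[symmetric])
  finally show ?thesis using q0 by (simp add: power_add)
qed

lemma dim_subspaces_le:
  fixes x :: "'a::{field,finite} vec set"
  assumes x: "x \<in> subspaces n"
  shows "seq_space.dim x \<le> n"
proof -
  have "CARD('a) ^ seq_space.dim x \<le> CARD('a) ^ n"
    using card_mono[OF finite_coord_space, of x n] x card_subspaces[OF x]
    by (simp add: subspaces_def card_coord_space)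
  then show ?thesis using card_field_ge_2[where 'a = 'a] by (simp add: power_increasing_iff)
qed

section \<open>The biased weights\<close>

lemma qpoch_neg_pos: "0 < \<sigma> \<Longrightarrow> 0 < qpoch_neg q \<sigma> n"
  unfolding qpoch_neg_def by (intro prod_pos) (auto intro: add_pos_nonneg)

lemma qpoch_neg_shift:
  assumes "0 < \<sigma>"
  shows "qpoch_neg q (\<sigma> * real q ^ c) n \<le> (\<Prod>j<c. 1 + \<sigma> * real q ^ (n + j)) * qpoch_neg q \<sigma> n"
proof -
  have "qpoch_neg q (\<sigma> * real q ^ c) n = (\<Prod>j\<in>{c..<c + n}. 1 + \<sigma> * real q ^ j)"
    unfolding qpoch_neg_def using prod.shift_bounds_nat_ivl[of "\<lambda>j. 1 + \<sigma> * real q ^ j" 0 c n]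
    by (simp add: atLeast0LessThan power_add mult_ac add.commute)
  also have "\<dots> \<le> (\<Prod>j<c. 1 + \<sigma> * real q ^ j) * (\<Prod>j\<in>{c..<c + n}. 1 + \<sigma> * real q ^ j)"
  proof -
    have "1 \<le> (\<Prod>j<c. 1 + \<sigma> * real q ^ j)" using assms by (intro prod_ge_1) auto
    moreover have "0 \<le> (\<Prod>j\<in>{c..<c + n}. 1 + \<sigma> * real q ^ j)"
      using assms by (intro prod_nonneg) auto
    ultimately show ?thesis by (simp add: mult_le_cancel_right1)
  qed
  also have "\<dots> = (\<Prod>j<c + n. 1 + \<sigma> * real q ^ j)"
    by (simp add: prod.atLeastLessThan_concat flip: atLeast0LessThan)
  also have "\<dots> = (\<Prod>j<n. 1 + \<sigma> * real q ^ j) * (\<Prod>j\<in>{n..<n + c}. 1 + \<sigma> * real q ^ j)"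
    by (simp add: prod.atLeastLessThan_concat add.commute flip: atLeast0LessThan)
  also have "(\<Prod>j\<in>{n..<n + c}. 1 + \<sigma> * real q ^ j) = (\<Prod>j<c. 1 + \<sigma> * real q ^ (n + j))"
    using prod.shift_bounds_nat_ivl[of "\<lambda>j. 1 + \<sigma> * real q ^ j" 0 n c]
    by (simp add: atLeast0LessThan add.commute)
  finally show ?thesis by (simp add: qpoch_neg_def mult.commute)
qed

lemma prod_powers_interval: "(\<Prod>j\<in>{d..<d + k}. a * (b :: real) ^ j) = a ^ k * b ^ (k * d + (k choose 2))"
proof (induction k)
  case (Suc k)
  have "Suc k choose 2 = k + (k choose 2)" by (simp add: numeral_2_eq_2)
  then show ?case using Suc by (simp add: power_add algebra_simps)
qed (simp add: numeral_2_eq_2)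

text \<open>
  The left side, without the denominator of \<open>biased_phi\<close>, is the product of the \<open>k\<close> largest of the
  numbers \<open>\<sigma> q ^ c q ^ j\<close> with \<open>j < n\<close>, and so at most the product of all \<open>1 + \<sigma> q ^ c q ^ j\<close>. The
  latter is \<open>qpoch_neg\<close> at \<open>\<sigma> q ^ c\<close>, which by shifting the index exceeds its value at \<open>\<sigma>\<close>
  by at most \<open>c\<close> factors.
\<close>

lemma biased_phi_exponential_moment:
  assumes q: "1 \<le> q" and \<sigma>: "0 < \<sigma>" "1 \<le> \<sigma> * real q ^ n" and k: "k \<le> n"
  shows "biased_phi q \<sigma> n k * real q ^ (k * (n - k)) * real q ^ (c * k) \<le> (2 * real q ^ c) ^ c * (\<sigma> * real q ^ n) ^ c"
proof -
  let ?s = "\<sigma> * real q ^ c"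
  have "\<sigma> ^ k * real q ^ (k choose 2) * real q ^ (k * (n - k)) * real q ^ (c * k)
      = (\<Prod>j\<in>{n - k..<n - k + k}. ?s * real q ^ j)"
    unfolding prod_powers_interval by (simp add: power_mult_distrib power_add power_mult mult_ac)
  also have "\<dots> \<le> (\<Prod>j\<in>{n - k..<n}. 1 + ?s * real q ^ j)"
    using k \<sigma> by (simp only: le_add_diff_inverse2) (intro prod_mono, auto)
  also have "\<dots> \<le> (\<Prod>j<n. 1 + ?s * real q ^ j)"
    using \<sigma> by (intro prod_mono2) auto
  also have "\<dots> = qpoch_neg q ?s n" by (simp add: qpoch_neg_def)
  also have "\<dots> \<le> (\<Prod>j<c. 1 + \<sigma> * real q ^ (n + j)) * qpoch_neg q \<sigma> n"
    by (rule qpoch_neg_shift[OF \<sigma>(1)])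
  also have "\<dots> \<le> (\<Prod>j<c. 2 * real q ^ c * (\<sigma> * real q ^ n)) * qpoch_neg q \<sigma> n"
  proof (intro mult_right_mono prod_mono conjI)
    fix j assume j: "j \<in> {..<c}"
    have "real q ^ j \<le> real q ^ c" using j q by (intro power_increasing) auto
    then have "(\<sigma> * real q ^ n) * real q ^ j \<le> (\<sigma> * real q ^ n) * real q ^ c"
      using \<sigma> by (intro mult_left_mono) auto
    moreover have "1 * 1 \<le> (\<sigma> * real q ^ n) * real q ^ c"
      using \<sigma> q by (intro mult_mono) auto
    ultimately show "1 + \<sigma> * real q ^ (n + j) \<le> 2 * real q ^ c * (\<sigma> * real q ^ n)"
      by (simp add: power_add mult_ac)
    show "0 \<le> 1 + \<sigma> * real q ^ (n + j)" using \<sigma> by simp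
  qed (use qpoch_neg_pos[OF \<sigma>(1)] less_imp_le in blast)
  finally have "\<sigma> ^ k * real q ^ (k choose 2) * real q ^ (k * (n - k)) * real q ^ (c * k)
      \<le> ((2 * real q ^ c) ^ c * (\<sigma> * real q ^ n) ^ c) * qpoch_neg q \<sigma> n"
    by (simp only: prod_constant card_lessThan power_mult_distrib)
  then show ?thesis
    using qpoch_neg_pos[OF \<sigma>(1), of q n] by (simp add: biased_phi_def field_simps)
qed

lemma biased_measure_layers:
  fixes U :: "'a::{field,finite} vec set set"
  assumes U: "U \<subseteq> subspaces n"
  shows "biased_measure \<sigma> n U
    = (\<Sum>k\<le>n. biased_phi CARD('a) \<sigma> n k * card {x \<in> U. seq_space.dim x = k})"
proof -
  have fin: "finite U" using U finite_subspaces finite_subset by blast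
  have "seq_space.dim ` U \<subseteq> {..n}" using U dim_subspaces_le by auto
  from sum.group[OF fin _ this, of "\<lambda>x. biased_phi CARD('a) \<sigma> n (seq_space.dim x)"]
  have "biased_measure \<sigma> n U = (\<Sum>k\<le>n. \<Sum>x\<in>{x \<in> U. seq_space.dim x = k}. biased_phi CARD('a) \<sigma> n (seq_space.dim x))"
    by (simp add: biased_measure_def)
  also have "\<dots> = (\<Sum>k\<le>n. biased_phi CARD('a) \<sigma> n k * card {x \<in> U. seq_space.dim x = k})"
    by (intro sum.cong refl) simp
  finally show ?thesis .
qed

section \<open>The upper bound\<close>

lemma biased_phi_nonneg: "0 < \<sigma> \<Longrightarrow> 0 \<le> biased_phi q \<sigma> n k"
  unfolding biased_phi_def using qpoch_neg_pos[of \<sigma> q n] by simp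

lemma biased_measure_nonneg: "0 < \<sigma> \<Longrightarrow> 0 \<le> biased_measure \<sigma> n U"
  unfolding biased_measure_def by (intro sum_nonneg biased_phi_nonneg)

lemma sigma_theta_pos: "0 < q \<Longrightarrow> 0 < sigma_theta q \<theta> n"
  by (simp add: sigma_theta_def)

lemma sigma_theta_mult_power: "0 < q \<Longrightarrow> sigma_theta q \<theta> n * real q ^ n = real q powr (\<theta> * real n)"
  by (simp add: sigma_theta_def powr_add[symmetric] algebra_simps flip: powr_realpow)

text \<open>
  Expand both measures into layers. For \<open>k + l \<le> n\<close> use \<open>layer_bound\<close> and the moment of order
  \<open>c = t\<close>. For \<open>k + l > n\<close> bound the families by the whole layers, insert the factor
  \<open>q ^ (s (k + l - n))\<close>, and use the moment of order \<open>c = s\<close>; since \<open>\<theta>1 + \<theta>2 < 1\<close>, a large \<open>s\<close>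
  makes the result as small as required.
\<close>

theorem cross_measure_upper:
  assumes t: "1 \<le> t" and \<theta>: "0 < \<theta>1" "0 < \<theta>2" "\<theta>1 + \<theta>2 < 1"
  shows "\<exists>C>0. \<forall>n\<ge>1. \<forall>(U :: 'a::{field,finite} vec set set) W.
    U \<subseteq> subspaces n \<longrightarrow> W \<subseteq> subspaces n \<longrightarrow> cross_intersecting t U W \<longrightarrow>
    biased_measure (sigma_theta CARD('a) \<theta>1 n) n U * biased_measure (sigma_theta CARD('a) \<theta>2 n) n W
      \<le> C * real n ^ 3 * (real CARD('a) powr (- (2 - \<theta>1 - \<theta>2) * real t)) ^ n"
proof -
  define q where "q = CARD('a)"
  have q: "2 \<le> q" using card_field_ge_2[where 'a = 'a] unfolding q_def by linarith
  obtain K where K: "K > 0" and layer: "\<And>n k l (U :: 'a vec set set) W. k + l \<le> n \<Longrightarrow>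
    U \<subseteq> layer n k \<Longrightarrow>
    W \<subseteq> layer n l \<Longrightarrow>
    cross_intersecting t U W \<Longrightarrow>
    real (card U) * real (card W) * real q ^ (t * (2 * n - k - l))
      \<le> K * real n * real q ^ (k * (n - k) + l * (n - l))"
    using layer_bound[OF t, where 'a = 'a] unfolding q_def by blast
  obtain s :: nat where s: "t * (2 - \<theta>1 - \<theta>2) / (1 - \<theta>1 - \<theta>2) \<le> real s"
    using real_arch_simple by blast
  then have s': "t * (2 - \<theta>1 - \<theta>2) \<le> real s * (1 - \<theta>1 - \<theta>2)"
    using \<theta> by (simp add: field_simps)
  define D where "D = K * ((2 * real q ^ t) ^ t * (2 * real q ^ t) ^ t) + 16 * ((2 * real q ^ s) ^ s * (2 * real q ^ s) ^ s)"
  have D: "D > 0" unfolding D_def using K q by (intro add_pos_nonneg mult_pos_pos) auto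
  define L where "L n = real q powr (- (2 - \<theta>1 - \<theta>2) * real t * real n)" for n :: nat
  have "biased_measure (sigma_theta q \<theta>1 n) n U * biased_measure (sigma_theta q \<theta>2 n) n W
      \<le> (4 * D) * real n ^ 3 * L n"
    if n: "1 \<le> n" and U: "U \<subseteq> subspaces n" and W: "W \<subseteq> subspaces n" and cross: "cross_intersecting t U W"
    for n and U W :: "'a vec set set"
  proof -
    define \<sigma>1 \<sigma>2 where "\<sigma>1 = sigma_theta q \<theta>1 n" and "\<sigma>2 = sigma_theta q \<theta>2 n"
    have \<sigma>: "0 < \<sigma>1" "0 < \<sigma>2" using q by (simp_all add: \<sigma>1_def \<sigma>2_def sigma_theta_pos)
    have X: "\<sigma>1 * real q ^ n = real q powr (\<theta>1 * n)" "\<sigma>2 * real q ^ n = real q powr (\<theta>2 * n)"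
      using q by (simp_all add: \<sigma>1_def \<sigma>2_def sigma_theta_mult_power)
    have X1: "1 \<le> \<sigma>1 * real q ^ n" "1 \<le> \<sigma>2 * real q ^ n"
      unfolding X using q \<theta> by (simp_all add: ge_one_powr_ge_zero)
    have XX: "(\<sigma>1 * real q ^ n) ^ c * (\<sigma>2 * real q ^ n) ^ c = real q powr ((\<theta>1 + \<theta>2) * n * c)" for c
      unfolding X using q by (simp add: powr_power powr_add[symmetric] algebra_simps)
    define U' W' where "U' k = {x \<in> U. seq_space.dim x = k}" and "W' k = {x \<in> W. seq_space.dim x = k}" for k
    have UW': "U' k \<subseteq> layer n k" "W' k \<subseteq> layer n k"
      "cross_intersecting t (U' k) (W' l)" for k l
      using U W cross by (auto simp: U'_def W'_def cross_intersecting_def)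
    define \<phi>1 \<phi>2 where "\<phi>1 = biased_phi q \<sigma>1 n" and "\<phi>2 = biased_phi q \<sigma>2 n"
    have \<phi>0: "0 \<le> \<phi>1 k" "0 \<le> \<phi>2 k" for k using \<sigma> by (simp_all add: \<phi>1_def \<phi>2_def biased_phi_nonneg)
    have moment: "\<phi>1 k * real q ^ (k * (n - k)) * real q ^ (c * k) * (\<phi>2 l * real q ^ (l * (n - l)) * real q ^ (c * l))
        \<le> ((2 * real q ^ c) ^ c * (2 * real q ^ c) ^ c) * real q powr ((\<theta>1 + \<theta>2) * n * c)"
      if "k \<le> n" "l \<le> n" for k l c
    proof -
      have "\<phi>1 k * real q ^ (k * (n - k)) * real q ^ (c * k) * (\<phi>2 l * real q ^ (l * (n - l)) * real q ^ (c * l))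
        \<le> ((2 * real q ^ c) ^ c * (\<sigma>1 * real q ^ n) ^ c) * ((2 * real q ^ c) ^ c * (\<sigma>2 * real q ^ n) ^ c)"
        unfolding \<phi>1_def \<phi>2_def using q \<sigma> X1 that
        by (intro mult_mono biased_phi_exponential_moment mult_nonneg_nonneg biased_phi_nonneg) auto
      also have "\<dots> = ((2 * real q ^ c) ^ c * (2 * real q ^ c) ^ c) * ((\<sigma>1 * real q ^ n) ^ c * (\<sigma>2 * real q ^ n) ^ c)"
        by (simp only: mult_ac)
      finally show ?thesis by (simp only: XX)
    qed
    have entry: "(\<phi>1 k * card (U' k)) * (\<phi>2 l * card (W' l)) \<le> D * real n * L n"
      if kl: "k \<le> n" "l \<le> n" for k l
    proof (cases "k + l \<le> n")
      case True
      have ex: "t * (2 * n - k - l) + (t * k + t * l) = 2 * t * n"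
      proof -
        have "t * (2 * n - k - l) + (t * k + t * l) = t * ((2 * n - k - l) + k + l)"
          by (simp only: add_mult_distrib2 add.assoc)
        also have "(2 * n - k - l) + k + l = 2 * n" using True by simp
        finally show ?thesis by simp
      qed
      have "(\<phi>1 k * card (U' k)) * (\<phi>2 l * card (W' l)) * real q ^ (2 * t * n)
          = \<phi>1 k * \<phi>2 l * (real q ^ (t * k) * real q ^ (t * l)) *
            (real (card (U' k)) * real (card (W' l)) * real q ^ (t * (2 * n - k - l)))"
        unfolding ex[symmetric] by (simp add: power_add mult_ac)
      also have "\<dots> \<le> \<phi>1 k * \<phi>2 l * (real q ^ (t * k) * real q ^ (t * l)) *
            (K * real n * real q ^ (k * (n - k) + l * (n - l)))"
        using \<phi>0 by (intro mult_left_mono layer[OF True UW'] mult_nonneg_nonneg) auto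
      also have "\<dots> = K * real n * (\<phi>1 k * real q ^ (k * (n - k)) * real q ^ (t * k) *
            (\<phi>2 l * real q ^ (l * (n - l)) * real q ^ (t * l)))"
        by (simp add: power_add mult_ac)
      also have "\<dots> \<le> K * real n * (((2 * real q ^ t) ^ t * (2 * real q ^ t) ^ t) * real q powr ((\<theta>1 + \<theta>2) * n * t))"
        using K by (intro mult_left_mono moment kl) auto
      also have "real q powr ((\<theta>1 + \<theta>2) * n * t) = L n * real q ^ (2 * t * n)"
        using q by (simp add: L_def powr_add[symmetric] algebra_simps flip: powr_realpow)
      finally have "(\<phi>1 k * card (U' k)) * (\<phi>2 l * card (W' l)) * real q ^ (2 * t * n)
          \<le> (K * ((2 * real q ^ t) ^ t * (2 * real q ^ t) ^ t) * real n * L n) * real q ^ (2 * t * n)"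
        by (simp only: mult_ac)
      then have "(\<phi>1 k * card (U' k)) * (\<phi>2 l * card (W' l))
          \<le> K * ((2 * real q ^ t) ^ t * (2 * real q ^ t) ^ t) * real n * L n"
        by (rule mult_right_le_imp_le) (use q in simp)
      also have "\<dots> \<le> D * real n * L n"
        by (intro mult_right_mono) (auto simp: D_def L_def)
      finally show ?thesis .
    next
      case False
      have "real (card (U' k)) * real (card (W' l)) \<le> (4 * real q ^ (k * (n - k))) * (4 * real q ^ (l * (n - l)))"
        unfolding q_def by (intro mult_mono layer_card_le UW' kl) auto
      moreover have "real q ^ (s * n) \<le> real q ^ (s * k + s * l)"
        using False q by (intro power_increasing) (auto simp flip: add_mult_distrib2)
      ultimately have "(\<phi>1 k * \<phi>2 l) * ((real (card (U' k)) * real (card (W' l))) * real q ^ (s * n))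
          \<le> (\<phi>1 k * \<phi>2 l) * (((4 * real q ^ (k * (n - k))) * (4 * real q ^ (l * (n - l)))) * real q ^ (s * k + s * l))"
        using \<phi>0 q by (intro mult_left_mono mult_mono[of "real (card (U' k)) * real (card (W' l))"]) auto
      also have "\<dots> = 16 * (\<phi>1 k * real q ^ (k * (n - k)) * real q ^ (s * k) *
            (\<phi>2 l * real q ^ (l * (n - l)) * real q ^ (s * l)))"
        by (simp add: power_add mult_ac)
      also have "\<dots> \<le> 16 * (((2 * real q ^ s) ^ s * (2 * real q ^ s) ^ s) * real q powr ((\<theta>1 + \<theta>2) * n * s))"
        by (intro mult_left_mono moment kl) auto
      also have "\<dots> \<le> 16 * (((2 * real q ^ s) ^ s * (2 * real q ^ s) ^ s) * (L n * real q ^ (s * n)))"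
      proof (intro mult_left_mono)
        have "(\<theta>1 + \<theta>2) * n * s \<le> - (2 - \<theta>1 - \<theta>2) * real t * real n + real (s * n)"
          using mult_right_mono[OF s', of "real n"] by (simp add: algebra_simps)
        then have "real q powr ((\<theta>1 + \<theta>2) * n * s) \<le> real q powr (- (2 - \<theta>1 - \<theta>2) * real t * real n + real (s * n))"
          using q by (intro powr_mono) auto
        also have "\<dots> = L n * real q ^ (s * n)" using q by (simp add: L_def powr_add powr_realpow del: of_nat_mult)
        finally show "real q powr ((\<theta>1 + \<theta>2) * n * s) \<le> L n * real q ^ (s * n)" .
      qed auto
      finally have "((\<phi>1 k * card (U' k)) * (\<phi>2 l * card (W' l))) * real q ^ (s * n)
          \<le> (16 * ((2 * real q ^ s) ^ s * (2 * real q ^ s) ^ s) * L n) * real q ^ (s * n)"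
        by (simp only: mult_ac)
      then have "(\<phi>1 k * card (U' k)) * (\<phi>2 l * card (W' l)) \<le> 16 * ((2 * real q ^ s) ^ s * (2 * real q ^ s) ^ s) * L n"
        by (rule mult_right_le_imp_le) (use q in simp)
      also have "\<dots> \<le> D * L n" using K by (intro mult_right_mono) (auto simp: D_def L_def)
      also have "\<dots> \<le> D * L n * real n"
        using mult_left_mono[of 1 "real n" "D * L n"] n D by (simp add: L_def)
      finally show ?thesis by (simp only: mult_ac)
    qed
    have "biased_measure \<sigma>1 n U * biased_measure \<sigma>2 n W
        = (\<Sum>k\<le>n. \<Sum>l\<le>n. (\<phi>1 k * card (U' k)) * (\<phi>2 l * card (W' l)))"
      unfolding biased_measure_layers[OF U] biased_measure_layers[OF W] sum_product
      by (simp add: \<phi>1_def \<phi>2_def U'_def W'_def q_def)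
    also have "\<dots> \<le> (\<Sum>k\<le>n. \<Sum>l\<le>n. D * real n * L n)"
      by (intro sum_mono entry) auto
    also have "\<dots> = (real n + 1)\<^sup>2 * (D * real n * L n)" by (simp add: power2_eq_square algebra_simps)
    also have "\<dots> \<le> (2 * real n)\<^sup>2 * (D * real n * L n)"
      using n D by (intro mult_right_mono power_mono) (auto simp: L_def)
    also have "\<dots> = (4 * D) * real n ^ 3 * L n" by (simp add: power2_eq_square power3_eq_cube)
    finally show ?thesis by (simp add: \<sigma>1_def \<sigma>2_def)
  qed
  moreover have "L n = (real q powr (- (2 - \<theta>1 - \<theta>2) * real t)) ^ n" for n
    using q by (simp add: L_def powr_power mult_ac)
  ultimately show ?thesis using D unfolding q_def by (intro exI[of _ "4 * D"]) simp
qed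

section \<open>The star of a fixed subspace\<close>

abbreviation star :: "nat \<Rightarrow> nat \<Rightarrow> 'a::field vec set set" where
  "star n t \<equiv> {x \<in> subspaces n. coord_space t \<subseteq> x}"

text \<open>
  These are the graphs of those linear maps from the first \<open>k\<close> coordinates to the last \<open>n - k\<close> that
  vanish on the first \<open>t\<close> coordinates; \<open>lft A\<close> parametrises the graph of the map with matrix \<open>A\<close>.
\<close>

lemma card_subspaces_containing_ge:
  assumes "t \<le> k" "k \<le> n"
  shows "CARD('a) ^ ((k - t) * (n - k))
    \<le> card {x \<in> subspaces n. coord_space t \<subseteq> (x :: 'a::{field,finite} vec set) \<and> seq_space.dim x = k}"
proof -
  define lft where "lft A w = (\<lambda>i. if i < k then w i else if i < n then \<Sum>p<k - t. w (t + p) * A p (i - k) else 0)"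
    for A :: "'a matrix" and w :: "'a vec"
  define G where "G A = lft A ` coord_space k" for A
  have inj_lft: "inj_on (lft A) (coord_space k)" for A
  proof (rule inj_onI)
    fix w w' assume w: "w \<in> coord_space k" "w' \<in> coord_space k" "lft A w = lft A w'"
    have "w i = w' i" for i
      using w(1,2) fun_cong[OF w(3), of i] by (cases "i < k") (auto simp: lft_def coord_space_def)
    then show "w = w'" by auto
  qed
  have sub: "G A \<in> subspaces n" for A
  proof -
    have add: "lft A (w + w') = lft A w + lft A w'" for w w'
      by (auto simp: lft_def fun_eq_iff algebra_simps sum.distrib)
    have scale: "lft A (seq_scale c w) = seq_scale c (lft A w)" for c w
      by (auto simp: lft_def fun_eq_iff seq_scale_def sum_distrib_left mult.assoc)
    have zero: "lft A 0 = 0" by (auto simp: lft_def fun_eq_iff)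
    note sp = subspace_coord_space[of k, where 'a = 'a]
    have "seq_space.subspace (G A)"
      unfolding seq_space.subspace_def G_def
    proof (intro conjI ballI allI)
      show "0 \<in> lft A ` coord_space k" using zero seq_space.subspace_0[OF sp] by (metis image_eqI)
      show "x + y \<in> lft A ` coord_space k" if "x \<in> lft A ` coord_space k" "y \<in> lft A ` coord_space k" for x y
        using that seq_space.subspace_add[OF sp] by (auto simp: add[symmetric])
      show "seq_scale c x \<in> lft A ` coord_space k" if "x \<in> lft A ` coord_space k" for x c
        using that seq_space.subspace_scale[OF sp] by (auto simp: scale[symmetric])
    qed
    moreover have "G A \<subseteq> coord_space n" using assms by (auto simp: G_def lft_def coord_space_def)
    ultimately show ?thesis by (simp add: subspaces_def)
  qed
  have dim: "seq_space.dim (G A) = k" for A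
  proof -
    have "card (G A) = CARD('a) ^ k" unfolding G_def by (simp add: card_image[OF inj_lft] card_coord_space)
    then show ?thesis
      using card_subspaces[OF sub] card_field_ge_2[where 'a = 'a] by (simp add: power_inject_exp)
  qed
  have contains: "coord_space t \<subseteq> G A" for A
  proof
    fix w :: "'a vec" assume w: "w \<in> coord_space t"
    have "lft A w = w" using w assms by (auto simp: lft_def coord_space_def fun_eq_iff)
    moreover have "w \<in> coord_space k" using w coord_space_mono[OF assms(1)] by auto
    ultimately show "w \<in> G A" unfolding G_def by (metis image_eqI)
  qed
  have "inj_on G (mat (k - t) (n - k))"
  proof (rule inj_onI)
    fix A A' assume A: "A \<in> mat (k - t) (n - k)" "A' \<in> mat (k - t) (n - k)" and eq: "G A = G A'"
    have "A p j = A' p j" if pj: "p < k - t" "j < n - k" for p j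
    proof -
      define e :: "'a vec" where "e = (\<lambda>i. if i = t + p then 1 else 0)"
      have e: "e \<in> coord_space k" using pj by (auto simp: e_def coord_space_def)
      have val: "lft B e (k + j) = B p j" for B
      proof -
        have "lft B e (k + j) = (\<Sum>p'<k - t. e (t + p') * B p' j)"
          using pj by (simp add: lft_def)
        also have "\<dots> = (\<Sum>p'<k - t. if p' = p then B p' j else 0)"
          by (intro sum.cong) (auto simp: e_def)
        finally show ?thesis using pj by simp
      qed
      have "lft A e \<in> G A'" using e eq by (auto simp: G_def)
      then obtain w where w: "w \<in> coord_space k" "lft A e = lft A' w" by (auto simp: G_def)
      have "w i = e i" for i
        using w(1) e fun_cong[OF w(2), of i] by (cases "i < k") (auto simp: lft_def coord_space_def)
      then have "w = e" by auto
      then show ?thesis using fun_cong[OF w(2), of "k + j"] val by simp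
    qed
    moreover have "A p j = A' p j" if "\<not> (p < k - t \<and> j < n - k)" for p j
      using A that by (auto simp: mat_iff not_less)
    ultimately show "A = A'" by (intro ext) blast
  qed
  then have "card (G ` mat (k - t) (n - k)) = CARD('a) ^ ((k - t) * (n - k))"
    by (simp add: card_image card_mat)
  moreover have "card (G ` mat (k - t) (n - k))
      \<le> card {x \<in> subspaces n. coord_space t \<subseteq> (x :: 'a vec set) \<and> seq_space.dim x = k}"
    by (rule card_mono[OF finite_subset[OF _ finite_subspaces[of n]]]) (use sub dim contains in auto)
  ultimately show ?thesis by simp
qed


lemma prod_one_plus_le_exp_2:
  assumes "\<And>i. i < N \<Longrightarrow> 0 \<le> f i" "\<And>i. i < N \<Longrightarrow> f i \<le> (1 / 2) ^ i"
  shows "(\<Prod>i<N. 1 + f i) \<le> exp (2 :: real)"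
proof -
  have "(\<Prod>i<N. 1 + f i) \<le> (\<Prod>i<N. exp ((1 / 2) ^ i))"
  proof (intro prod_mono conjI)
    fix i assume "i \<in> {..<N}"
    then have "0 \<le> f i" "f i \<le> (1 / 2) ^ i" using assms by auto
    then show "0 \<le> 1 + f i" "1 + f i \<le> exp ((1 / 2) ^ i)"
      using exp_ge_add_one_self[of "(1 / 2 :: real) ^ i"] by linarith+
  qed
  also have "\<dots> = exp (\<Sum>i<N. (1 / 2) ^ i)" by (simp add: exp_sum)
  also have "(\<Sum>i<N. (1 / 2 :: real) ^ i) \<le> 2" by (simp add: geometric_sum)
  finally show ?thesis by simp
qed

text \<open>
  In the product \<open>qpoch_neg\<close>, the \<open>k\<close> factors with \<open>j \<ge> n - k\<close> have \<open>\<sigma> q ^ j \<ge> 1\<close>, the others have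
  \<open>\<sigma> q ^ j \<le> 1\<close>. Replacing \<open>1 + \<sigma> q ^ j\<close> by \<open>\<sigma> q ^ j\<close> in the former and by \<open>1\<close> in the latter
  gives the numerator of the weighted layer, and each of the two replacements costs at most
  \<open>\<Prod>i. 1 + 2 ^ (- i) \<le> exp 2\<close>.
\<close>

lemma biased_phi_peak:
  assumes q: "2 \<le> q" and \<theta>: "0 < \<theta>" "\<theta> < 1" and k: "k = nat \<lfloor>\<theta> * n\<rfloor>"
  shows "exp (- 4) \<le> biased_phi q (sigma_theta q \<theta> n) n k * real q ^ (k * (n - k))"
proof -
  define \<sigma> where "\<sigma> = sigma_theta q \<theta> n"
  have \<sigma>: "0 < \<sigma>" using q by (simp add: \<sigma>_def sigma_theta_pos)
  have k1: "real k \<le> \<theta> * n" and k2: "\<theta> * n < real k + 1"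
    using \<theta> by (auto simp: k)
  have "\<theta> * real n \<le> 1 * real n" using \<theta> by (intro mult_right_mono) auto
  then have kn: "k \<le> n" using k1 by linarith
  have \<sigma>_powr: "\<sigma> * real q ^ j = real q powr (real j - (1 - \<theta>) * n)" for j
    using q by (simp add: \<sigma>_def sigma_theta_def powr_add[symmetric] algebra_simps flip: powr_realpow)
  have half: "real q powr (- real i) \<le> (1 / 2) ^ i" for i
  proof -
    have "real q powr (- real i) = 1 / real q ^ i" using q by (simp add: powr_minus powr_realpow divide_inverse)
    also have "\<dots> \<le> 1 / 2 ^ i" using q by (intro divide_left_mono power_mono) auto
    finally show ?thesis by (simp add: power_one_over)
  qed
  have low: "(\<Prod>j<n - k. 1 + \<sigma> * real q ^ j) \<le> exp 2"
  proof -
    have "(\<Prod>j<n - k. 1 + \<sigma> * real q ^ j) = (\<Prod>i<n - k. 1 + \<sigma> * real q ^ (n - k - Suc i))"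
      by (rule prod.nat_diff_reindex[symmetric])
    also have "\<dots> \<le> exp 2"
    proof (rule prod_one_plus_le_exp_2)
      fix i assume i: "i < n - k"
      have "\<sigma> * real q ^ (n - k - Suc i) \<le> real q powr (- real i)"
        unfolding \<sigma>_powr using q i k2 by (intro powr_mono) (auto simp: of_nat_diff algebra_simps)
      then show "\<sigma> * real q ^ (n - k - Suc i) \<le> (1 / 2) ^ i" using half[of i] by (rule order_trans)
    qed (use \<sigma> in auto)
    finally show ?thesis .
  qed
  have high: "(\<Prod>j\<in>{n - k..<n}. 1 + \<sigma> * real q ^ j) \<le> (\<Prod>j\<in>{n - k..<n}. \<sigma> * real q ^ j) * exp 2"
  proof -
    have shift: "(\<Prod>j\<in>{n - k..<n}. g j) = (\<Prod>i<k. g (n - k + i))" for g :: "nat \<Rightarrow> real"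
      using prod.shift_bounds_nat_ivl[of g 0 "n - k" k] kn by (simp add: atLeast0LessThan add.commute)
    have pos: "0 < \<sigma> * real q ^ j" for j using \<sigma> q by simp
    have "(\<Prod>i<k. 1 + \<sigma> * real q ^ (n - k + i)) = (\<Prod>i<k. (\<sigma> * real q ^ (n - k + i)) * (1 + 1 / (\<sigma> * real q ^ (n - k + i))))"
    proof -
      have expand: "1 + y = y * (1 + 1 / y)" if "0 < y" for y :: real using that by (simp add: field_simps)
      show ?thesis by (intro prod.cong refl) (rule expand[OF pos])
    qed
    also have "\<dots> = (\<Prod>i<k. \<sigma> * real q ^ (n - k + i)) * (\<Prod>i<k. 1 + 1 / (\<sigma> * real q ^ (n - k + i)))"
      by (rule prod.distrib)
    also have "\<dots> \<le> (\<Prod>i<k. \<sigma> * real q ^ (n - k + i)) * exp 2"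
    proof (intro mult_left_mono prod_one_plus_le_exp_2)
      fix i assume "i < k"
      have "1 / (\<sigma> * real q ^ (n - k + i)) = real q powr (- (real (n - k + i) - (1 - \<theta>) * n))"
        unfolding \<sigma>_powr by (rule powr_minus_divide[symmetric])
      also have "\<dots> \<le> real q powr (- real i)"
        using q kn k1 by (intro powr_mono) (auto simp: of_nat_diff algebra_simps)
      finally show "1 / (\<sigma> * real q ^ (n - k + i)) \<le> (1 / 2) ^ i" using half[of i] by (rule order_trans)
    qed (use \<sigma> in \<open>auto intro!: prod_nonneg\<close>)
    finally show ?thesis unfolding shift .
  qed
  have exp_4: "exp (4 :: real) = exp 2 * exp 2" by (simp flip: exp_add)
  have prod_eq: "(\<Prod>j\<in>{n - k..<n}. \<sigma> * real q ^ j) = \<sigma> ^ k * real q ^ (k choose 2) * real q ^ (k * (n - k))"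
    using prod_powers_interval[of \<sigma> "real q" "n - k" k] kn by (simp add: power_add mult_ac)
  have "qpoch_neg q \<sigma> n = (\<Prod>j<n - k. 1 + \<sigma> * real q ^ j) * (\<Prod>j\<in>{n - k..<n}. 1 + \<sigma> * real q ^ j)"
    unfolding qpoch_neg_def using kn by (simp add: prod.atLeastLessThan_concat flip: atLeast0LessThan)
  also have "\<dots> \<le> exp 2 * ((\<Prod>j\<in>{n - k..<n}. \<sigma> * real q ^ j) * exp 2)"
    using \<sigma> by (intro mult_mono low high) (auto intro!: prod_nonneg)
  also have "\<dots> = exp 4 * (\<sigma> ^ k * real q ^ (k choose 2) * real q ^ (k * (n - k)))"
    unfolding prod_eq exp_4 by (simp only: mult_ac)
  finally show ?thesis
    using qpoch_neg_pos[OF \<sigma>, of q n] unfolding \<sigma>_def[symmetric]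
    by (simp add: biased_phi_def exp_minus field_simps)
qed

text \<open>
  Only the layer \<open>k = \<lfloor>\<theta> n\<rfloor>\<close> of the star is used. Rounding costs the factor
  \<open>q powr (- t)\<close>, as \<open>n - k \<le> (1 - \<theta>) n + 1\<close>; and \<open>k \<ge> t\<close> holds from some \<open>n\<close> on.
\<close>

theorem star_measure_lower:
  assumes \<theta>: "0 < \<theta>" "\<theta> < 1"
  shows "\<exists>c>0. \<exists>N. \<forall>n\<ge>N. c * (real CARD('a) powr (- (1 - \<theta>) * real t)) ^ n
    \<le> biased_measure (sigma_theta CARD('a) \<theta> n) n (star n t :: 'a::{field,finite} vec set set)"
proof -
  define q where "q = CARD('a)"
  have q: "2 \<le> q" using card_field_ge_2[where 'a = 'a] unfolding q_def by linarith
  obtain N :: nat where N: "(t + 1) / \<theta> \<le> real N" using real_arch_simple by blast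
  have "exp (- 4) * real q powr (- real t) * (real q powr (- (1 - \<theta>) * real t)) ^ n
      \<le> biased_measure (sigma_theta q \<theta> n) n (star n t :: 'a vec set set)"
    if n: "N \<le> n" for n
  proof -
    define k where "k = nat \<lfloor>\<theta> * n\<rfloor>"
    have k1: "real k \<le> \<theta> * n" and k2: "\<theta> * n < real k + 1" using \<theta> by (auto simp: k_def)
    have "(t + 1) / \<theta> \<le> real n" using N n by linarith
    then have "real t + 1 \<le> \<theta> * n" using \<theta> by (simp add: field_simps)
    then have tk: "t \<le> k" using k2 by linarith
    have "\<theta> * real n \<le> 1 * real n" using \<theta> by (intro mult_right_mono) auto
    then have kn: "k \<le> n" using k1 by linarith
    let ?S = "(star n t :: 'a vec set set)"
    let ?T = "{x \<in> subspaces n. coord_space t \<subseteq> (x :: 'a vec set) \<and> seq_space.dim x = k}"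
    define \<phi> where "\<phi> = biased_phi q (sigma_theta q \<theta> n) n"
    have \<phi>0: "0 \<le> \<phi> j" for j using q by (simp add: \<phi>_def biased_phi_nonneg sigma_theta_pos)
    have "k * (n - k) = (k - t) * (n - k) + t * (n - k)"
      unfolding add_mult_distrib[symmetric] using tk by simp
    then have split: "real q ^ (k * (n - k)) = real q ^ ((k - t) * (n - k)) * real q ^ (t * (n - k))"
      by (simp only: power_add)
    have "(real q powr (- (1 - \<theta>) * real t)) ^ n = real q powr (- (1 - \<theta>) * real t * real n)"
      using q by (simp add: powr_power mult_ac)
    moreover have "- real t + - (1 - \<theta>) * real t * real n = - (real t * ((1 - \<theta>) * n + 1))"
      by (simp add: algebra_simps)
    ultimately have "exp (- 4) * real q powr (- real t) * (real q powr (- (1 - \<theta>) * real t)) ^ n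
        = exp (- 4) * real q powr (- (real t * ((1 - \<theta>) * n + 1)))"
      by (simp only: powr_add[symmetric] mult.assoc)
    also have "\<dots> \<le> exp (- 4) * real q powr (- real (t * (n - k)))"
    proof (intro mult_left_mono powr_mono)
      have "real (n - k) \<le> (1 - \<theta>) * n + 1" using k2 kn by (simp add: of_nat_diff algebra_simps)
      then have "real t * real (n - k) \<le> real t * ((1 - \<theta>) * n + 1)" by (intro mult_left_mono) auto
      then show "- (real t * ((1 - \<theta>) * n + 1)) \<le> - real (t * (n - k))" by simp
    qed (use q in auto)
    also have "\<dots> = exp (- 4) / real q ^ (t * (n - k))"
      using q by (simp add: powr_minus powr_realpow divide_inverse del: of_nat_mult)
    also have "\<dots> \<le> (\<phi> k * real q ^ (k * (n - k))) / real q ^ (t * (n - k))"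
      unfolding \<phi>_def using biased_phi_peak[OF q \<theta> k_def] by (intro divide_right_mono) auto
    also have "\<dots> = \<phi> k * real q ^ ((k - t) * (n - k))"
      using q by (simp add: split)
    also have "\<dots> \<le> \<phi> k * real (card ?T)"
    proof (intro mult_left_mono \<phi>0)
      show "real q ^ ((k - t) * (n - k)) \<le> real (card ?T)"
        unfolding q_def of_nat_power[symmetric] of_nat_le_iff by (rule card_subspaces_containing_ge[OF tk kn])
    qed
    also have "\<dots> = (\<Sum>x\<in>?T. \<phi> (seq_space.dim x))" by simp
    also have "\<dots> \<le> (\<Sum>x\<in>?S. \<phi> (seq_space.dim x))"
      using \<phi>0 by (intro sum_mono2 finite_subset[OF _ finite_subspaces[of n]]) auto
    finally show ?thesis by (simp add: biased_measure_def \<phi>_def q_def)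
  qed
  moreover have "0 < exp (- 4) * real q powr (- real t)" using q by simp
  ultimately show ?thesis unfolding q_def
    by (intro exI[of _ "exp (- 4) * real CARD('a) powr (- real t)"] exI[of _ N] conjI allI impI) simp_all
qed

section \<open>The limit\<close>

lemma powr_inverse_tendsto_1:
  assumes "0 < c"
  shows "(\<lambda>n. c powr (1 / real n)) \<longlonglongrightarrow> 1"
  by (rule Lim_transform_eventually[OF LIMSEQ_root_const[OF assms]])
     (use eventually_gt_at_top[of 0] in \<open>eventually_elim, simp add: root_powr_inverse less_imp_le[OF assms]\<close>)

lemma self_powr_inverse_tendsto_1: "(\<lambda>n. real n powr (1 / real n)) \<longlonglongrightarrow> 1"
  by (rule Lim_transform_eventually[OF LIMSEQ_root])
     (use eventually_gt_at_top[of 0] in \<open>eventually_elim, simp add: root_powr_inverse\<close>)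

theorem theorem3:
  fixes q t :: nat and \<theta>1 \<theta>2 :: real
  assumes "q = CARD('a::{field,finite})"
    and "t > 0"
    and "0 < \<theta>1" "\<theta>1 < 1 / 2"
    and "0 < \<theta>2" "\<theta>2 < 1 / 2"
  shows "(\<lambda>n. cross_max TYPE('a) n t (sigma_theta q \<theta>1 n) (sigma_theta q \<theta>2 n))
           \<longlonglongrightarrow> real q powr (- (2 - \<theta>1 - \<theta>2) * real t)"
proof -
  define L where "L = real q powr (- (2 - \<theta>1 - \<theta>2) * real t)"
  have q: "2 \<le> q" using card_field_ge_2[where 'a = 'a] assms(1) by simp
  have L: "L > 0" using q by (simp add: L_def)
  let ?\<sigma>1 = "sigma_theta q \<theta>1" and ?\<sigma>2 = "sigma_theta q \<theta>2"
  let ?g = "\<lambda>n. cross_max TYPE('a) n t (?\<sigma>1 n) (?\<sigma>2 n)"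
  have \<sigma>: "0 < ?\<sigma>1 n" "0 < ?\<sigma>2 n" for n using q by (simp_all add: sigma_theta_pos)
  have powr_L: "(L ^ n) powr (1 / real n) = L" if "1 \<le> n" for n
    using L that by (simp add: powr_powr flip: powr_realpow)
  obtain C where C: "C > 0" and upper: "\<And>n (U :: 'a vec set set) W. 1 \<le> n \<Longrightarrow>
    U \<subseteq> subspaces n \<Longrightarrow> W \<subseteq> subspaces n \<Longrightarrow> cross_intersecting t U W \<Longrightarrow>
    biased_measure (?\<sigma>1 n) n U * biased_measure (?\<sigma>2 n) n W \<le> C * real n ^ 3 * L ^ n"
    using cross_measure_upper[of t \<theta>1 \<theta>2, where 'a = 'a] assms unfolding L_def by auto
  define S where "S n = {x \<in> subspaces n. coord_space t \<subseteq> (x :: 'a vec set)}" for n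
  obtain c1 N1 where c1: "c1 > 0" and N1: "\<And>n. N1 \<le> n \<Longrightarrow>
      c1 * (real q powr (- (1 - \<theta>1) * real t)) ^ n \<le> biased_measure (?\<sigma>1 n) n (S n)"
    using star_measure_lower[of \<theta>1 t, where 'a = 'a] assms unfolding S_def by auto
  obtain c2 N2 where c2: "c2 > 0" and N2: "\<And>n. N2 \<le> n \<Longrightarrow>
      c2 * (real q powr (- (1 - \<theta>2) * real t)) ^ n \<le> biased_measure (?\<sigma>2 n) n (S n)"
    using star_measure_lower[of \<theta>2 t, where 'a = 'a] assms unfolding S_def by auto
  have S_sub: "S n \<subseteq> subspaces n" for n by (auto simp: S_def)
  have S_cross: "cross_intersecting t (S n) (S n)" for n
    unfolding cross_intersecting_def
  proof (intro ballI)
    fix x y assume xy: "x \<in> S n" "y \<in> S n"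
    have "x \<inter> y \<in> subspaces n" using xy seq_space.subspace_inter[of x y] by (auto simp: S_def subspaces_def)
    from card_subspaces[OF this] have "CARD('a) ^ t \<le> CARD('a) ^ seq_space.dim (x \<inter> y)"
      using card_mono[OF subspaces_finite[OF \<open>x \<inter> y \<in> subspaces n\<close>], of "coord_space t"] xy
      by (simp add: S_def card_coord_space)
    then show "t \<le> seq_space.dim (x \<inter> y)"
      using card_field_ge_2[where 'a = 'a] by (simp add: power_increasing_iff)
  qed
  have lower_ev: "\<forall>\<^sub>F n in sequentially. (c1 * c2) powr (1 / real n) * L \<le> ?g n"
    using eventually_ge_at_top[of "max 1 (max N1 N2)"]
  proof eventually_elim
    case (elim n)
    then have n: "1 \<le> n" "N1 \<le> n" "N2 \<le> n" by auto
    have "- (2 - \<theta>1 - \<theta>2) * real t = - (1 - \<theta>1) * real t + - (1 - \<theta>2) * real t"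
      by (simp add: algebra_simps)
    then have "L = real q powr (- (1 - \<theta>1) * real t) * real q powr (- (1 - \<theta>2) * real t)"
      unfolding L_def by (simp only: powr_add)
    then have "L ^ n = (real q powr (- (1 - \<theta>1) * real t)) ^ n * (real q powr (- (1 - \<theta>2) * real t)) ^ n"
      by (simp only: power_mult_distrib)
    then have "(c1 * c2) * L ^ n = (c1 * (real q powr (- (1 - \<theta>1) * real t)) ^ n) * (c2 * (real q powr (- (1 - \<theta>2) * real t)) ^ n)"
      by (simp add: mult_ac)
    also have "\<dots> \<le> biased_measure (?\<sigma>1 n) n (S n) * biased_measure (?\<sigma>2 n) n (S n)"
      using c1 c2 \<sigma> by (intro mult_mono N1 N2 n biased_measure_nonneg) auto
    finally have "((c1 * c2) * L ^ n) powr (1 / real n)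
        \<le> (biased_measure (?\<sigma>1 n) n (S n) * biased_measure (?\<sigma>2 n) n (S n)) powr (1 / real n)"
      using c1 c2 L by (intro powr_mono2) auto
    also have "\<dots> \<le> ?g n"
      unfolding cross_max_def
    proof (rule Max_ge[OF cross_values_finite])
      show "(biased_measure (?\<sigma>1 n) n (S n) * biased_measure (?\<sigma>2 n) n (S n)) powr (1 / real n)
          \<in> cross_values TYPE('a) n t (?\<sigma>1 n) (?\<sigma>2 n)"
        unfolding cross_values_def by (rule CollectI, intro exI[of _ "S n"] conjI refl S_sub S_cross)
    qed
    finally show ?case
      using c1 c2 L powr_L[OF n(1)] by (simp add: powr_mult)
  qed
  have upper_ev: "\<forall>\<^sub>F n in sequentially. ?g n \<le> C powr (1 / real n) * (real n powr (1 / real n)) ^ 3 * L"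
    using eventually_ge_at_top[of 1]
  proof eventually_elim
    case (elim n)
    have "(C * real n ^ 3 * L ^ n) powr (1 / real n) = C powr (1 / real n) * (real n ^ 3) powr (1 / real n) * (L ^ n) powr (1 / real n)"
      using C L by (simp add: powr_mult)
    also have "(real n ^ 3) powr (1 / real n) = (real n powr (1 / real n)) ^ 3"
      by (simp only: power3_eq_cube powr_mult of_nat_0_le_iff mult_nonneg_nonneg)
    finally have "(C * real n ^ 3 * L ^ n) powr (1 / real n) = C powr (1 / real n) * (real n powr (1 / real n)) ^ 3 * L"
      by (simp only: powr_L[OF elim])
    moreover have "v \<le> (C * real n ^ 3 * L ^ n) powr (1 / real n)"
      if "v \<in> cross_values TYPE('a) n t (?\<sigma>1 n) (?\<sigma>2 n)" for v
      using that upper[OF elim] \<sigma>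
      by (auto simp: cross_values_def intro!: powr_mono2 mult_nonneg_nonneg biased_measure_nonneg)
    ultimately show ?case
      unfolding cross_max_def by (simp add: Max_le_iff[OF cross_values_finite cross_values_nonempty])
  qed
  have "(\<lambda>n. (c1 * c2) powr (1 / real n) * L) \<longlonglongrightarrow> 1 * L"
    using c1 c2 by (intro tendsto_intros powr_inverse_tendsto_1) auto
  moreover have "(\<lambda>n. C powr (1 / real n) * (real n powr (1 / real n)) ^ 3 * L) \<longlonglongrightarrow> 1 * 1 ^ 3 * L"
    using C by (intro tendsto_intros powr_inverse_tendsto_1 self_powr_inverse_tendsto_1)
  ultimately have "?g \<longlonglongrightarrow> L"
    using tendsto_sandwich[OF lower_ev upper_ev] by simp
  then show ?thesis by (simp add: L_def)
qed

end
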